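(* Suppose there exists a shared-memory parallel algorithm $\mathcal{A}$ that, for every $\varepsilon$, computes a $(1+\varepsilon)$-approximate maximum weight matching in any graph with $n$ vertices, $m$ edges and maximum edge weight ratio $W$ using $B(n,m,W,\varepsilon)$ work and $D(n,m,W,\varepsilon)$ depth. Then there exists a parallel algorithm $\mathcal{A}'$ that computes a $(1+16\varepsilon)$-approximate maximum weight matching using $O\!\left(\frac{B(n,m,f(\varepsilon),\varepsilon)\cdot\log_{1/\varepsilon} W}{\varepsilon}\right)$ work and $O\!\left(D(n,m,f(\varepsilon),\varepsilon)\cdot\log_{1/\varepsilon} W\right)$ depth, where $f(\varepsilon)$ is some function of $\varepsilon$ only.
   Context: The maximum edge weight ratio $W$ of a weighted graph is the ratio of its maximum to its minimum edge weight. A $(1+\varepsilon)$-approximate maximum weight matching is a matching $M$ with $(1+\varepsilon)\,w(M)\ge w(\mathcal{M})$, where $w$ denotes total edge weight and $\mathcal{M}$ a maximum weight matching. Work is the total number of operations; depth is the longest chain of sequential dependencies. Here $\varepsilon\in(0,1/2)$.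
   Formalization: The factor log_{1/ε} W is read as max(1, log_{1/ε} W), since at W = 1 the literal bound would allow no work at all; n, m and W are read as upper bounds on the number of vertices, the number of edges and the weight ratio (ratio 1 for an edgeless graph). *)

theory Defs
  imports Complex_Main "HOL-Library.Log_Nat"
begin

section \<open>Weighted graphs and matchings\<close>

text \<open>A weighted graph is a finite simple undirected graph on the vertices \<open>0, \<dots>, n - 1\<close>; an edge
  is the two-element set of its endpoints, and edge weights are positive reals.\<close>

definition weighted_graph :: "nat \<Rightarrow> nat set set \<Rightarrow> (nat set \<Rightarrow> real) \<Rightarrow> bool" where
  "weighted_graph n E w \<longleftrightarrow> E \<subseteq> {{u, v} | u v. u < n \<and> v < n \<and> u \<noteq> v} \<and> (\<forall>e\<in>E. 0 < w e)"

text \<open>The value 1 for the edgeless graph is a convention: the quotient is meaningless there.\<close>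

definition edge_weight_ratio :: "nat set set \<Rightarrow> (nat set \<Rightarrow> real) \<Rightarrow> real" where
  "edge_weight_ratio E w = (if E = {} then 1 else Max (w ` E) / Min (w ` E))"

definition is_matching :: "nat set set \<Rightarrow> nat set set \<Rightarrow> bool" where
  "is_matching E M \<longleftrightarrow> M \<subseteq> E \<and> (\<forall>e\<in>M. \<forall>e'\<in>M. e \<noteq> e' \<longrightarrow> e \<inter> e' = {})"

definition max_weight_matching :: "nat set set \<Rightarrow> (nat set \<Rightarrow> real) \<Rightarrow> nat set set \<Rightarrow> bool" where
  "max_weight_matching E w M \<longleftrightarrow>
     is_matching E M \<and> (\<forall>M'. is_matching E M' \<longrightarrow> sum w M' \<le> sum w M)"

definition approx_max_weight_matching ::
    "real \<Rightarrow> nat set set \<Rightarrow> (nat set \<Rightarrow> real) \<Rightarrow> nat set set \<Rightarrow> bool" where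
  "approx_max_weight_matching c E w M \<longleftrightarrow>
     is_matching E M \<and> (\<forall>M'. max_weight_matching E w M' \<longrightarrow> c * sum w M \<ge> sum w M')"


section \<open>A shared-memory fork-join machine with work and depth\<close>

text \<open>The shared memory consists of named arrays of cells, each holding a real number (real RAM with
  floor); scalars live in cell 0 of an array. Only integer literals may occur in programs, so that
  no information can be hidden in real constants.\<close>

type_synonym store = "string \<Rightarrow> int \<Rightarrow> real"

datatype binop = Plus | Minus | Times | Divide | Less

datatype expr = Num int | Get string expr | Op binop expr expr | Floor expr

datatype scanop = ScanSum | ScanMax

datatype com =
    Skip
  | Put string expr expr         \<comment> \<open>\<open>a[i] := e\<close>\<close>
  | Seq com com
  | Cond expr com com
  | While expr com
  | Local string com             \<comment> \<open>run with a private, zero-initialised array of that name\<close>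
  | ParFor string expr com       \<comment> \<open>all iterations \<open>0 \<le> k < e\<close> in parallel\<close>
  | Scan scanop string expr      \<comment> \<open>in-place prefix sums or prefix maxima of the first \<open>e\<close> cells\<close>
  | Call nat                     \<comment> \<open>(recursive) procedure call\<close>

text \<open>A program is a finite procedure table together with a main command.\<close>

type_synonym program = "com list \<times> com"

fun binop_val :: "binop \<Rightarrow> real \<Rightarrow> real \<Rightarrow> real" where
  "binop_val Plus x y = x + y"
| "binop_val Minus x y = x - y"
| "binop_val Times x y = x * y"
| "binop_val Divide x y = x / y"
| "binop_val Less x y = (if x < y then 1 else 0)"

fun expr_val :: "store \<Rightarrow> expr \<Rightarrow> real" where
  "expr_val s (Num c) = of_int c"
| "expr_val s (Get a e) = s a \<lfloor>expr_val s e\<rfloor>"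
| "expr_val s (Op f e1 e2) = binop_val f (expr_val s e1) (expr_val s e2)"
| "expr_val s (Floor e) = of_int \<lfloor>expr_val s e\<rfloor>"

fun expr_cost :: "expr \<Rightarrow> nat" where
  "expr_cost (Num c) = 1"
| "expr_cost (Get a e) = 1 + expr_cost e"
| "expr_cost (Op f e1 e2) = 1 + expr_cost e1 + expr_cost e2"
| "expr_cost (Floor e) = 1 + expr_cost e"

fun scan_val :: "scanop \<Rightarrow> (int \<Rightarrow> real) \<Rightarrow> int \<Rightarrow> real" where
  "scan_val ScanSum x i = sum x {0..i}"
| "scan_val ScanMax x i = Max (x ` {0..i})"

text \<open>Joining parallel threads that all started from the store \<open>s\<close>: every cell changed by some
  thread receives the value of the lowest-numbered thread that changed it (priority concurrent
  writes); all other cells keep their contents.\<close>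

definition join :: "store \<Rightarrow> store list \<Rightarrow> store" where
  "join s ts = (\<lambda>a i. case find (\<lambda>t. t a i \<noteq> s a i) ts of None \<Rightarrow> s a i | Some t \<Rightarrow> t a i)"

definition scalar :: "real \<Rightarrow> int \<Rightarrow> real" where
  "scalar x = (\<lambda>_. 0)(0 := x)"

text \<open>\<open>exec P c s t w d\<close>: with procedure table \<open>P\<close>, command \<open>c\<close> started in store \<open>s\<close> terminates in
  store \<open>t\<close> with work \<open>w\<close> and depth \<open>d\<close>. Work adds up everywhere; depth adds up sequentially and is
  maximised over parallel threads. Forking is binary, so that starting and joining \<open>n\<close> threads, as
  well as a scan over \<open>n\<close> cells, has linear work and logarithmic depth.\<close>

inductive exec :: "com list \<Rightarrow> com \<Rightarrow> store \<Rightarrow> store \<Rightarrow> nat \<Rightarrow> nat \<Rightarrow> bool" for P where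
  Skip: "exec P Skip s s 1 1"
| Put: "k = 1 + expr_cost i + expr_cost e \<Longrightarrow>
    exec P (Put a i e) s (s(a := (s a)(\<lfloor>expr_val s i\<rfloor> := expr_val s e))) k k"
| Seq: "exec P c1 s s' w1 d1 \<Longrightarrow> exec P c2 s' t w2 d2 \<Longrightarrow>
    exec P (Seq c1 c2) s t (w1 + w2) (d1 + d2)"
| CondTrue: "expr_val s b \<noteq> 0 \<Longrightarrow> exec P c1 s t w d \<Longrightarrow>
    exec P (Cond b c1 c2) s t (1 + expr_cost b + w) (1 + expr_cost b + d)"
| CondFalse: "expr_val s b = 0 \<Longrightarrow> exec P c2 s t w d \<Longrightarrow>
    exec P (Cond b c1 c2) s t (1 + expr_cost b + w) (1 + expr_cost b + d)"
| WhileFalse: "expr_val s b = 0 \<Longrightarrow>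
    exec P (While b c) s s (1 + expr_cost b) (1 + expr_cost b)"
| WhileTrue: "expr_val s b \<noteq> 0 \<Longrightarrow> exec P c s s' w1 d1 \<Longrightarrow> exec P (While b c) s' t w2 d2 \<Longrightarrow>
    exec P (While b c) s t (1 + expr_cost b + w1 + w2) (1 + expr_cost b + d1 + d2)"
| Local: "exec P c (s(a := (\<lambda>_. 0))) t w d \<Longrightarrow>
    exec P (Local a c) s (t(a := s a)) (1 + w) (1 + d)"
| ParFor: "n = nat \<lfloor>expr_val s e\<rfloor> \<Longrightarrow>
    (\<And>k. k < n \<Longrightarrow> exec P c (s(x := scalar (real k))) (t k) (w k) (d k)) \<Longrightarrow>
    exec P (ParFor x e c) s (join s (map (\<lambda>k. (t k)(x := s x)) [0..<n]))
      (1 + expr_cost e + (\<Sum>k<n. 1 + w k))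
      (1 + expr_cost e + ceillog2 n + Max (insert 0 (d ` {..<n})))"
| Scan: "n = nat \<lfloor>expr_val s e\<rfloor> \<Longrightarrow>
    exec P (Scan f a e) s
      (s(a := (\<lambda>i. if 0 \<le> i \<and> i < int n then scan_val f (s a) i else s a i)))
      (1 + expr_cost e + n) (1 + expr_cost e + ceillog2 n)"
| Call: "k < length P \<Longrightarrow> exec P (P ! k) s t w d \<Longrightarrow> exec P (Call k) s t (1 + w) (1 + d)"

lemma exec_deterministic:
  assumes "exec P c s t w d" and "exec P c s t' w' d'"
  shows "t' = t \<and> w' = w \<and> d' = d"
  using assms
proof (induction arbitrary: t' w' d' rule: exec.induct)
  case (ParFor n s e c x t w d)
  from ParFor.prems obtain t2 w2 d2 where
      ex: "\<And>k. k < n \<Longrightarrow> exec P c (s(x := scalar (real k))) (t2 k) (w2 k) (d2 k)"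
    and eqs: "t' = join s (map (\<lambda>k. (t2 k)(x := s x)) [0..<n])"
      "w' = 1 + expr_cost e + (\<Sum>k<n. 1 + w2 k)"
      "d' = 1 + expr_cost e + ceillog2 n + Max (insert 0 (d2 ` {..<n}))"
    using ParFor.hyps by (cases rule: exec.cases) auto
  have same: "t2 k = t k \<and> w2 k = w k \<and> d2 k = d k" if "k < n" for k
    using ParFor.IH[OF that ex[OF that]] .
  have "map (\<lambda>k. (t2 k)(x := s x)) [0..<n] = map (\<lambda>k. (t k)(x := s x)) [0..<n]"
    using same by simp
  moreover have "(\<Sum>k<n. 1 + w2 k) = (\<Sum>k<n. 1 + w k)"
    using same by (intro sum.cong) auto
  moreover have "d2 ` {..<n} = d ` {..<n}"
    using same by (intro image_cong) auto
  ultimately show ?case unfolding eqs by metis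
next
  case (Seq c1 s s' w1 d1 c2 t w2 d2)
  from Seq.prems show ?case by (cases rule: exec.cases) (use Seq.IH in blast)
next
  case (CondTrue s b c1 t w d c2)
  from CondTrue.prems show ?case
    by (cases rule: exec.cases) (use CondTrue.IH CondTrue.hyps in blast)+
next
  case (CondFalse s b c2 t w d c1)
  from CondFalse.prems show ?case
    by (cases rule: exec.cases) (use CondFalse.IH CondFalse.hyps in blast)+
next
  case (WhileTrue s b c s' w1 d1 t w2 d2)
  from WhileTrue.prems show ?case
    by (cases rule: exec.cases) (use WhileTrue.IH WhileTrue.hyps in blast)+
next
  case (Local c s a t w d)
  from Local.prems show ?case by (cases rule: exec.cases) (use Local.IH in blast)
next
  case (Call k s t w d)
  from Call.prems show ?case by (cases rule: exec.cases) (use Call.IH in blast)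
next
  case (Skip s) then show ?case by (cases rule: exec.cases) auto
next
  case (Put k i e a s) from Put.prems Put.hyps show ?case by (cases rule: exec.cases) auto
next
  case (WhileFalse s b c)
  from WhileFalse.prems WhileFalse.hyps show ?case by (cases rule: exec.cases) auto
next
  case (Scan n s e f a) from Scan.prems Scan.hyps show ?case by (cases rule: exec.cases) auto
qed


section \<open>Computing approximate maximum weight matchings\<close>

fun edge_of :: "nat \<times> nat \<Rightarrow> nat set" where
  "edge_of (u, v) = {u, v}"

text \<open>The edges may be presented in any order and with either orientation.\<close>

definition lists_edges :: "(nat \<times> nat) list \<Rightarrow> nat set set \<Rightarrow> bool" where
  "lists_edges es E \<longleftrightarrow> distinct (map edge_of es) \<and> set (map edge_of es) = E"

definition list_array :: "real list \<Rightarrow> int \<Rightarrow> real" where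
  "list_array xs i = (if 0 \<le> i \<and> i < int (length xs) then xs ! nat i else 0)"

definition input_store ::
    "nat \<Rightarrow> (nat \<times> nat) list \<Rightarrow> (nat set \<Rightarrow> real) \<Rightarrow> real \<Rightarrow> store" where
  "input_store n es w \<epsilon> = (\<lambda>_ _. 0)
     (''n'' := scalar (real n),
      ''m'' := scalar (real (length es)),
      ''eps'' := scalar \<epsilon>,
      ''src'' := list_array (map (real \<circ> fst) es),
      ''dst'' := list_array (map (real \<circ> snd) es),
      ''wt'' := list_array (map (w \<circ> edge_of) es))"

text \<open>The output marks the chosen edges by nonzero entries.\<close>

definition output_edges :: "(nat \<times> nat) list \<Rightarrow> store \<Rightarrow> nat set set" where
  "output_edges es t = {edge_of (es ! k) | k. k < length es \<and> t ''out'' (int k) \<noteq> 0}"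

text \<open>Algorithm \<open>A\<close>, given a graph and \<open>\<epsilon> \<in> (0, 1/2)\<close>, computes an \<open>\<alpha> \<epsilon>\<close>-approximate maximum
  weight matching using \<open>B n m W \<epsilon>\<close> work and \<open>D n m W \<epsilon>\<close> depth. As usual for resource bounds, the
  parameters \<open>n\<close>, \<open>m\<close>, \<open>W\<close> bound the number of vertices, the number of edges and the maximum edge
  weight ratio of the input from above; for \<open>B\<close> and \<open>D\<close> that are monotone in these parameters this is
  the same as taking the exact values.\<close>

definition computes_approx_mwm ::
    "program \<Rightarrow> (real \<Rightarrow> real) \<Rightarrow> (nat \<Rightarrow> nat \<Rightarrow> real \<Rightarrow> real \<Rightarrow> real) \<Rightarrow>
     (nat \<Rightarrow> nat \<Rightarrow> real \<Rightarrow> real \<Rightarrow> real) \<Rightarrow> bool" where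
  "computes_approx_mwm A \<alpha> B D \<longleftrightarrow>
     (\<forall>\<epsilon> n m W N E w es.
        0 < \<epsilon> \<and> \<epsilon> < 1 / 2 \<and> weighted_graph N E w \<and> lists_edges es E \<and>
        N \<le> n \<and> card E \<le> m \<and> edge_weight_ratio E w \<le> W \<longrightarrow>
        (\<exists>t work depth.
           exec (fst A) (snd A) (input_store N es w \<epsilon>) t work depth \<and>
           approx_max_weight_matching (\<alpha> \<epsilon>) E w (output_edges es t) \<and>
           real work \<le> B n m W \<epsilon> \<and> real depth \<le> D n m W \<epsilon>))"

text \<open>\<open>log\<^bsub>1/\<epsilon>\<^esub> W\<close> as it occurs in asymptotic bounds: never smaller than 1. Without this
  convention a bound proportional to the logarithm would demand zero work for \<open>W = 1\<close>.\<close>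

definition log_inv :: "real \<Rightarrow> real \<Rightarrow> real" where
  "log_inv \<epsilon> W = max 1 (log (1 / \<epsilon>) W)"

end

theory Submission
  imports Defs "HOL-Library.Countable"
begin

text \<open>Let \<open>S = \<lceil>1 / \<epsilon>\<rceil>\<close> and \<open>f \<epsilon> = (1 / \<epsilon>) ^ S\<close>. If the weight ratio is at most \<open>f \<epsilon>\<close>, the given
  algorithm is run directly. Otherwise \<open>S\<close> is below the logarithm of the ratio; group the edges into
  levels by powers of \<open>\<epsilon>\<close> below the maximum weight. For each shift \<open>i < S\<close> delete the levels congruent
  to \<open>i\<close> modulo \<open>S\<close>. The rest splits into buckets of ratio at most \<open>f \<epsilon>\<close>, with weights of consecutive
  buckets a factor \<open>1 / \<epsilon>\<close> apart. Solve the buckets with the given algorithm and merge the results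
  greedily from heavy to light: a chosen edge blocks at most two edges of every later bucket, a
  geometric loss of order \<open>\<epsilon>\<close>. Some shift deletes at most a fraction \<open>1 / S \<le> \<epsilon>\<close> of the optimum.
  All shifts together need a number of runs proportional to the logarithm of the ratio, even
  one after the other.

  The passes over the edges that prepare and merge the buckets have to be paid for by \<open>B\<close> and \<open>D\<close>.
  This is possible because every correct algorithm must touch a constant fraction of the edges on
  complete bipartite graphs, and an execution touches at most \<open>work\<close> and at most \<open>2 ^ depth\<close> cells.\<close>

section \<open>Locality of execution\<close>

text \<open>\<open>B\<close> and \<open>D\<close> are arbitrary functions: no growth and no
  monotonicity is assumed, so only the correctness of \<open>A\<close> can show that they dominate
  even a single pass over the edges. Because \<open>n\<close>, \<open>m\<close> and \<open>W\<close>
  bound an input from above only, this may be shown on a graph chosen freely below them. The machine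
  shapes the rest. Programs contain integer literals but no logarithm, so levels exist in the
  analysis only; the program compares weights with a threshold that it multiplies by a power of
  \<epsilon>. That power must itself be found within the logarithmic budget, although
  \<open>S\<close> alone may be far larger than the logarithm of the ratio. It is obtained by making
  all arrays of \<open>A\<close> local and choosing fresh names for the others, and the locality
  theorem behind the lower bounds also justifies this.\<close>

fun expr_reads :: "store \<Rightarrow> expr \<Rightarrow> (string \<times> int) set" where
  "expr_reads s (Num c) = {}"
| "expr_reads s (Get a e) = insert (a, \<lfloor>expr_val s e\<rfloor>) (expr_reads s e)"
| "expr_reads s (Op f e1 e2) = expr_reads s e1 \<union> expr_reads s e2"
| "expr_reads s (Floor e) = expr_reads s e"

fun expr_names :: "expr \<Rightarrow> string set" where
  "expr_names (Num c) = {}"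
| "expr_names (Get a e) = insert a (expr_names e)"
| "expr_names (Op f e1 e2) = expr_names e1 \<union> expr_names e2"
| "expr_names (Floor e) = expr_names e"

text \<open>\<open>Call\<close> contributes nothing because procedures may be recursive; the names
  in the procedure table are collected separately where they matter.\<close>

fun com_names :: "com \<Rightarrow> string set" where
  "com_names Skip = {}"
| "com_names (Put a i e) = insert a (expr_names i \<union> expr_names e)"
| "com_names (Seq c1 c2) = com_names c1 \<union> com_names c2"
| "com_names (Cond b c1 c2) = expr_names b \<union> com_names c1 \<union> com_names c2"
| "com_names (While b c) = expr_names b \<union> com_names c"
| "com_names (Local a c) = insert a (com_names c)"
| "com_names (ParFor x e c) = insert x (expr_names e \<union> com_names c)"
| "com_names (Scan f a e) = insert a (expr_names e)"
| "com_names (Call k) = {}"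

lemma finite_expr_names: "finite (expr_names e)"
  by (induction e) auto

lemma finite_com_names: "finite (com_names c)"
  by (induction c) (auto simp: finite_expr_names)

lemma finite_expr_reads: "finite (expr_reads s e)"
  by (induction e) auto

lemma card_expr_reads: "card (expr_reads s e) \<le> expr_cost e"
proof (induction e)
  case (Get a e)
  then show ?case by (simp add: card_insert_if finite_expr_reads)
next
  case (Op f e1 e2)
  then show ?case using card_Un_le[of "expr_reads s e1" "expr_reads s e2"] by simp
qed auto

lemma expr_reads_names: "expr_reads s e \<subseteq> expr_names e \<times> UNIV"
  by (induction e) auto

lemma expr_val_cong:
  "(\<And>a i. (a, i) \<in> expr_reads s e \<Longrightarrow> s' a i = s a i) \<Longrightarrow> expr_val s' e = expr_val s e"
  by (induction e) auto

lemma exec_pos: "exec P c s t w d \<Longrightarrow> 0 < w \<and> 0 < d"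
  by (induction rule: exec.induct) auto

section \<open>Stores joined after parallel threads\<close>

lemma join_map:
  "join s (map r [0..<n]) a i =
     (case find (\<lambda>k. r k a i \<noteq> s a i) [0..<n] of None \<Rightarrow> s a i | Some k \<Rightarrow> r k a i)"
proof -
  have "(case find (\<lambda>t. t a i \<noteq> s a i) (map r ks) of None \<Rightarrow> s a i | Some t \<Rightarrow> t a i) =
      (case find (\<lambda>k. r k a i \<noteq> s a i) ks of None \<Rightarrow> s a i | Some k \<Rightarrow> r k a i)" for ks
    by (induction ks) auto
  then show ?thesis by (simp add: join_def)
qed

lemma join_map_cong:
  assumes "\<And>k. k < n \<Longrightarrow> r k a i = r' k a i" and "s a i = s' a i"
  shows "join s (map r [0..<n]) a i = join s' (map r' [0..<n]) a i"
proof -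
  have "(case find (\<lambda>k. r k a i \<noteq> s a i) ks of None \<Rightarrow> s a i | Some k \<Rightarrow> r k a i) =
      (case find (\<lambda>k. r' k a i \<noteq> s' a i) ks of None \<Rightarrow> s' a i | Some k \<Rightarrow> r' k a i)"
    if "set ks \<subseteq> {..<n}" for ks
    using that assms by (induction ks) auto
  from this[of "[0..<n]"] show ?thesis by (simp add: join_map atLeast0LessThan)
qed

text \<open>Priorities do not matter when all threads that change a cell agree on its new value. A
  thread that writes the old contents looks to \<open>join\<close> like one that does not write, so
  the value \<open>y\<close> may also be the old one.\<close>

lemma join_map_value:
  assumes "\<And>k. k < n \<Longrightarrow> r k a i = y \<or> r k a i = s a i"
    and "s a i = y \<or> (\<exists>k<n. r k a i = y)"
  shows "join s (map r [0..<n]) a i = y"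
proof (cases "find (\<lambda>k. r k a i \<noteq> s a i) [0..<n]")
  case None
  then have "\<forall>k<n. r k a i = s a i" by (auto simp: find_None_iff)
  then show ?thesis using None assms by (auto simp: join_map)
next
  case (Some k)
  then have "k < n" "r k a i \<noteq> s a i" by (auto simp: find_Some_iff)
  then show ?thesis using Some assms(1) by (auto simp: join_map)
qed

lemma join_map_unchanged:
  "(\<And>k. k < n \<Longrightarrow> r k a i = s a i) \<Longrightarrow> join s (map r [0..<n]) a i = s a i"
  by (rule join_map_value) auto

text \<open>The set \<open>T\<close> also contains the cells that are only written: a parallel join compares the written
  value with the old contents.\<close>

definition touches_only ::
    "com list \<Rightarrow> com \<Rightarrow> store \<Rightarrow> store \<Rightarrow> nat \<Rightarrow> nat \<Rightarrow> (string \<times> int) set \<Rightarrow> bool" where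
  "touches_only P c s t w d T \<longleftrightarrow>
     (\<forall>a i. (a, i) \<notin> T \<longrightarrow> t a i = s a i) \<and>
     (\<forall>s'. (\<forall>(a, i)\<in>T. s' a i = s a i) \<longrightarrow>
        exec P c s' (\<lambda>a i. if (a, i) \<in> T then t a i else s' a i) w d)"

lemma touches_onlyI:
  assumes "\<And>a i. (a, i) \<notin> T \<Longrightarrow> t a i = s a i"
    and "\<And>s'. (\<And>a i. (a, i) \<in> T \<Longrightarrow> s' a i = s a i) \<Longrightarrow>
      \<exists>t'. exec P c s' t' w d \<and> (\<forall>a i. t' a i = (if (a, i) \<in> T then t a i else s' a i))"
  shows "touches_only P c s t w d T"
  unfolding touches_only_def
proof (intro conjI allI impI)
  fix s' assume "\<forall>(a, i)\<in>T. s' a i = s a i"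
  then obtain t' where t': "exec P c s' t' w d"
      "\<forall>a i. t' a i = (if (a, i) \<in> T then t a i else s' a i)"
    using assms(2)[of s'] by auto
  then have "t' = (\<lambda>a i. if (a, i) \<in> T then t a i else s' a i)" by (intro ext) auto
  then show "exec P c s' (\<lambda>a i. if (a, i) \<in> T then t a i else s' a i) w d" using t' by simp
qed (use assms(1) in auto)

lemma touches_only_unchanged: "touches_only P c s t w d T \<Longrightarrow> (a, i) \<notin> T \<Longrightarrow> t a i = s a i"
  by (auto simp: touches_only_def)

lemma touches_only_exec:
  "touches_only P c s t w d T \<Longrightarrow> (\<And>a i. (a, i) \<in> T \<Longrightarrow> s' a i = s a i) \<Longrightarrow>
    exec P c s' (\<lambda>a i. if (a, i) \<in> T then t a i else s' a i) w d"
  unfolding touches_only_def by blast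

lemma add_power2_le: "x + 2 ^ d \<le> (2::nat) ^ (x + d)"
proof -
  have "x + 2 ^ d \<le> x * 2 ^ d + 2 ^ d" by simp
  also have "\<dots> = (x + 1) * 2 ^ d" by simp
  also have "\<dots> \<le> 2 ^ x * 2 ^ d" using less_exp[of x] by (intro mult_right_mono) (simp_all add: Suc_le_eq)
  finally show ?thesis by (simp add: power_add)
qed

text \<open>Two consecutive commands touch at most the sum of their numbers of cells, while their
  depths add. Positive exponents are essential, as \<open>1 + 2 ^ e\<close> exceeds
  \<open>2 ^ (0 + e)\<close>; \<open>exec_pos\<close> provides them.\<close>

lemma power2_add_power2_le:
  assumes "0 < d" "0 < e" shows "2 ^ d + 2 ^ e \<le> (2::nat) ^ (d + e)"
proof -
  have "(2::nat) \<le> 2 ^ d" "(2::nat) \<le> 2 ^ e" using assms by (auto simp: self_le_power)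
  then obtain x y where "(2::nat) ^ d = 2 + x" "(2::nat) ^ e = 2 + y"
    by (metis le_Suc_ex)
  then show ?thesis by (simp add: power_add algebra_simps)
qed

text \<open>Every read and write is charged to the work. For the depth, forking is binary:
  \<open>n\<close> threads touching at most \<open>2 ^ M\<close> cells each touch at most
  \<open>n * 2 ^ M \<le> 2 ^ (ceillog2 n + M)\<close> together, and \<open>ceillog2 n\<close> is
  what a fork or a scan is charged. Expression costs enter the exponent additively, more than enough
  for the cells read. The inclusion in \<open>X \<times> UNIV\<close> prepares the frame
  rule.\<close>

theorem exec_locality:
  assumes "exec P c s t w d" and "com_names c \<subseteq> X" and "\<Union> (com_names ` set P) \<subseteq> X"
  shows "\<exists>T. finite T \<and> card T \<le> w \<and> card T \<le> 2 ^ d \<and> T \<subseteq> X \<times> UNIV \<and>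
    touches_only P c s t w d T"
  using assms
proof (induction rule: exec.induct)
  case (Skip s)
  show ?case
    by (rule exI[of _ "{}"]) (use exec.Skip in \<open>auto simp: touches_only_def\<close>)
next
  case (Put k i e a s)
  let ?T = "insert (a, \<lfloor>expr_val s i\<rfloor>) (expr_reads s i \<union> expr_reads s e)"
  have fin: "finite ?T" by (simp add: finite_expr_reads)
  have "card ?T \<le> Suc (card (expr_reads s i \<union> expr_reads s e))"
    by (rule card_insert_le_m1) (auto simp: finite_expr_reads)
  also have "\<dots> \<le> k"
    using Put card_Un_le[of "expr_reads s i" "expr_reads s e"] card_expr_reads[of s i]
      card_expr_reads[of s e] by simp
  finally have "card ?T \<le> k" .
  moreover have "k \<le> 2 ^ k" by (simp add: less_imp_le)
  moreover have "?T \<subseteq> X \<times> UNIV" using Put.prems expr_reads_names[of s i] expr_reads_names[of s e] by auto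
  moreover have "touches_only P (Put a i e) s (s(a := (s a)(\<lfloor>expr_val s i\<rfloor> := expr_val s e))) k k ?T"
  proof (rule touches_onlyI)
    fix s' :: store assume eq: "\<And>b j. (b, j) \<in> ?T \<Longrightarrow> s' b j = s b j"
    have "expr_val s' i = expr_val s i" "expr_val s' e = expr_val s e"
      by (rule expr_val_cong; use eq in auto)+
    moreover have "exec P (Put a i e) s' (s'(a := (s' a)(\<lfloor>expr_val s' i\<rfloor> := expr_val s' e))) k k"
      by (rule exec.Put) (use Put in auto)
    ultimately show "\<exists>t'. exec P (Put a i e) s' t' k k \<and> (\<forall>b j. t' b j = (if (b, j) \<in> ?T
        then (s(a := (s a)(\<lfloor>expr_val s i\<rfloor> := expr_val s e))) b j else s' b j))"
      using eq by (intro exI conjI) auto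
  qed auto
  ultimately show ?case using fin by (meson le_trans)
next
  case (Seq c1 s u w1 d1 c2 t w2 d2)
  obtain T1 where T1: "finite T1" "card T1 \<le> w1" "card T1 \<le> 2 ^ d1" "T1 \<subseteq> X \<times> UNIV"
      "touches_only P c1 s u w1 d1 T1" using Seq by auto
  obtain T2 where T2: "finite T2" "card T2 \<le> w2" "card T2 \<le> 2 ^ d2" "T2 \<subseteq> X \<times> UNIV"
      "touches_only P c2 u t w2 d2 T2" using Seq by auto
  have le: "card (T1 \<union> T2) \<le> card T1 + card T2" by (rule card_Un_le)
  have "2 ^ d1 + 2 ^ d2 \<le> (2::nat) ^ (d1 + d2)"
    using exec_pos[OF Seq.hyps(1)] exec_pos[OF Seq.hyps(2)] by (intro power2_add_power2_le) auto
  moreover have "touches_only P (Seq c1 c2) s t (w1 + w2) (d1 + d2) (T1 \<union> T2)"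
  proof (rule touches_onlyI)
    fix s' :: store assume eq: "\<And>b j. (b, j) \<in> T1 \<union> T2 \<Longrightarrow> s' b j = s b j"
    let ?u = "\<lambda>a i. if (a, i) \<in> T1 then u a i else s' a i"
    have "exec P c1 s' ?u w1 d1" using T1(5) by (rule touches_only_exec) (use eq in auto)
    moreover have "exec P c2 ?u (\<lambda>a i. if (a, i) \<in> T2 then t a i else ?u a i) w2 d2"
      using T2(5) by (rule touches_only_exec) (use eq touches_only_unchanged[OF T1(5)] in auto)
    ultimately have "exec P (Seq c1 c2) s' (\<lambda>a i. if (a, i) \<in> T2 then t a i else ?u a i)
        (w1 + w2) (d1 + d2)" by (rule exec.Seq)
    then show "\<exists>t'. exec P (Seq c1 c2) s' t' (w1 + w2) (d1 + d2) \<and>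
        (\<forall>b j. t' b j = (if (b, j) \<in> T1 \<union> T2 then t b j else s' b j))"
      using touches_only_unchanged[OF T2(5)] by (intro exI conjI) auto
  qed (use touches_only_unchanged[OF T1(5)] touches_only_unchanged[OF T2(5)] in auto)
  ultimately show ?case using T1(1-4) T2(1-4) le by (intro exI[of _ "T1 \<union> T2"]) auto
next
  case (CondTrue s b c1 t w d c2)
  obtain T where T: "finite T" "card T \<le> w" "card T \<le> 2 ^ d" "T \<subseteq> X \<times> UNIV"
      "touches_only P c1 s t w d T" using CondTrue by auto
  have le: "card (expr_reads s b \<union> T) \<le> 1 + expr_cost b + card T"
    using card_Un_le[of "expr_reads s b" T] card_expr_reads[of s b] by simp
  have pow: "1 + expr_cost b + 2 ^ d \<le> (2::nat) ^ (1 + expr_cost b + d)" by (rule add_power2_le)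
  have sub: "expr_reads s b \<union> T \<subseteq> X \<times> UNIV"
    using T(4) CondTrue.prems expr_reads_names[of s b] by auto
  have "touches_only P (Cond b c1 c2) s t (1 + expr_cost b + w) (1 + expr_cost b + d) (expr_reads s b \<union> T)"
  proof (rule touches_onlyI)
    fix s' :: store assume eq: "\<And>a i. (a, i) \<in> expr_reads s b \<union> T \<Longrightarrow> s' a i = s a i"
    have "expr_val s' b = expr_val s b" by (rule expr_val_cong) (use eq in auto)
    moreover have "exec P c1 s' (\<lambda>a i. if (a, i) \<in> T then t a i else s' a i) w d"
      using T(5) by (rule touches_only_exec) (use eq in auto)
    ultimately have "exec P (Cond b c1 c2) s' (\<lambda>a i. if (a, i) \<in> T then t a i else s' a i)
      (1 + expr_cost b + w) (1 + expr_cost b + d)"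
      using CondTrue.hyps by (intro exec.CondTrue) auto
    then show "\<exists>t'. exec P (Cond b c1 c2) s' t' (1 + expr_cost b + w) (1 + expr_cost b + d) \<and>
        (\<forall>a i. t' a i = (if (a, i) \<in> expr_reads s b \<union> T then t a i else s' a i))"
      using eq touches_only_unchanged[OF T(5)] by (intro exI conjI) auto
  qed (use touches_only_unchanged[OF T(5)] in auto)
  then show ?case using T(1-4) le pow sub
    by (intro exI[of _ "expr_reads s b \<union> T"]) (auto simp: finite_expr_reads)
next
  case (CondFalse s b c2 t w d c1)
  obtain T where T: "finite T" "card T \<le> w" "card T \<le> 2 ^ d" "T \<subseteq> X \<times> UNIV"
      "touches_only P c2 s t w d T" using CondFalse by auto
  have le: "card (expr_reads s b \<union> T) \<le> 1 + expr_cost b + card T"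
    using card_Un_le[of "expr_reads s b" T] card_expr_reads[of s b] by simp
  have pow: "1 + expr_cost b + 2 ^ d \<le> (2::nat) ^ (1 + expr_cost b + d)" by (rule add_power2_le)
  have sub: "expr_reads s b \<union> T \<subseteq> X \<times> UNIV"
    using T(4) CondFalse.prems expr_reads_names[of s b] by auto
  have "touches_only P (Cond b c1 c2) s t (1 + expr_cost b + w) (1 + expr_cost b + d) (expr_reads s b \<union> T)"
  proof (rule touches_onlyI)
    fix s' :: store assume eq: "\<And>a i. (a, i) \<in> expr_reads s b \<union> T \<Longrightarrow> s' a i = s a i"
    have "expr_val s' b = expr_val s b" by (rule expr_val_cong) (use eq in auto)
    moreover have "exec P c2 s' (\<lambda>a i. if (a, i) \<in> T then t a i else s' a i) w d"
      using T(5) by (rule touches_only_exec) (use eq in auto)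
    ultimately have "exec P (Cond b c1 c2) s' (\<lambda>a i. if (a, i) \<in> T then t a i else s' a i)
      (1 + expr_cost b + w) (1 + expr_cost b + d)"
      using CondFalse.hyps by (intro exec.CondFalse) auto
    then show "\<exists>t'. exec P (Cond b c1 c2) s' t' (1 + expr_cost b + w) (1 + expr_cost b + d) \<and>
        (\<forall>a i. t' a i = (if (a, i) \<in> expr_reads s b \<union> T then t a i else s' a i))"
      using eq touches_only_unchanged[OF T(5)] by (intro exI conjI) auto
  qed (use touches_only_unchanged[OF T(5)] in auto)
  then show ?case using T(1-4) le pow sub
    by (intro exI[of _ "expr_reads s b \<union> T"]) (auto simp: finite_expr_reads)
next
  case (WhileFalse s b c)
  have "card (expr_reads s b) \<le> 1 + expr_cost b" using card_expr_reads[of s b] by simp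
  moreover have "1 + expr_cost b \<le> 2 ^ (1 + expr_cost b)" using less_imp_le less_exp by blast
  moreover have "expr_reads s b \<subseteq> X \<times> UNIV" using WhileFalse.prems expr_reads_names[of s b] by auto
  moreover have "touches_only P (While b c) s s (1 + expr_cost b) (1 + expr_cost b) (expr_reads s b)"
  proof (rule touches_onlyI)
    fix s' :: store assume eq: "\<And>a i. (a, i) \<in> expr_reads s b \<Longrightarrow> s' a i = s a i"
    have "expr_val s' b = expr_val s b" by (rule expr_val_cong) (use eq in auto)
    then have "exec P (While b c) s' s' (1 + expr_cost b) (1 + expr_cost b)"
      using WhileFalse.hyps by (intro exec.WhileFalse) auto
    then show "\<exists>t'. exec P (While b c) s' t' (1 + expr_cost b) (1 + expr_cost b) \<and>
        (\<forall>a i. t' a i = (if (a, i) \<in> expr_reads s b then s a i else s' a i))"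
      using eq by (intro exI conjI) auto
  qed auto
  ultimately show ?case
    by (intro exI[of _ "expr_reads s b"]) (auto simp: finite_expr_reads)
next
  case (WhileTrue s b c u w1 d1 t w2 d2)
  obtain T1 where T1: "finite T1" "card T1 \<le> w1" "card T1 \<le> 2 ^ d1" "T1 \<subseteq> X \<times> UNIV"
      "touches_only P c s u w1 d1 T1" using WhileTrue by auto
  obtain T2 where T2: "finite T2" "card T2 \<le> w2" "card T2 \<le> 2 ^ d2" "T2 \<subseteq> X \<times> UNIV"
      "touches_only P (While b c) u t w2 d2 T2" using WhileTrue by auto
  let ?T = "expr_reads s b \<union> (T1 \<union> T2)"
  have le: "card ?T \<le> 1 + expr_cost b + (card T1 + card T2)"
    using card_Un_le[of "expr_reads s b" "T1 \<union> T2"] card_Un_le[of T1 T2] card_expr_reads[of s b]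
    by simp
  have "2 ^ d1 + 2 ^ d2 \<le> (2::nat) ^ (d1 + d2)"
    using exec_pos[OF WhileTrue.hyps(2)] exec_pos[OF WhileTrue.hyps(3)]
    by (intro power2_add_power2_le) auto
  with le have le2: "card ?T \<le> 1 + expr_cost b + 2 ^ (d1 + d2)" using T1(3) T2(3) by linarith
  have pow: "card ?T \<le> 2 ^ (1 + expr_cost b + (d1 + d2))"
    using le2 add_power2_le by (rule le_trans)
  have sub: "?T \<subseteq> X \<times> UNIV"
    using T1(4) T2(4) WhileTrue.prems expr_reads_names[of s b] by auto
  have "touches_only P (While b c) s t (1 + expr_cost b + w1 + w2) (1 + expr_cost b + d1 + d2) ?T"
  proof (rule touches_onlyI)
    fix s' :: store assume eq: "\<And>a i. (a, i) \<in> ?T \<Longrightarrow> s' a i = s a i"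
    let ?u = "\<lambda>a i. if (a, i) \<in> T1 then u a i else s' a i"
    have "expr_val s' b = expr_val s b" by (rule expr_val_cong) (use eq in auto)
    moreover have "exec P c s' ?u w1 d1" using T1(5) by (rule touches_only_exec) (use eq in auto)
    moreover have "exec P (While b c) ?u (\<lambda>a i. if (a, i) \<in> T2 then t a i else ?u a i) w2 d2"
      using T2(5) by (rule touches_only_exec) (use eq touches_only_unchanged[OF T1(5)] in auto)
    ultimately have "exec P (While b c) s' (\<lambda>a i. if (a, i) \<in> T2 then t a i else ?u a i)
        (1 + expr_cost b + w1 + w2) (1 + expr_cost b + d1 + d2)"
      using WhileTrue.hyps by (intro exec.WhileTrue) auto
    then show "\<exists>t'. exec P (While b c) s' t' (1 + expr_cost b + w1 + w2) (1 + expr_cost b + d1 + d2) \<and>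
        (\<forall>b' j. t' b' j = (if (b', j) \<in> ?T then t b' j else s' b' j))"
      using eq touches_only_unchanged[OF T1(5)] touches_only_unchanged[OF T2(5)]
      by (intro exI conjI) auto
  qed (use touches_only_unchanged[OF T1(5)] touches_only_unchanged[OF T2(5)] in auto)
  then show ?case using T1(1-2) T2(1-2) le pow sub
    by (intro exI[of _ ?T]) (auto simp: finite_expr_reads add.assoc)
next
  case (Local c s a t w d)
  have names: "com_names c \<subseteq> X" using Local.prems by auto
  obtain T where T: "finite T" "card T \<le> w" "card T \<le> 2 ^ d" "T \<subseteq> X \<times> UNIV"
      "touches_only P c (s(a := \<lambda>_. 0)) t w d T"
    using Local.IH[OF names Local.prems(2)] by blast
  \<comment> \<open>The private array is zeroed on entry and restored on exit, so its outer contents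
    neither influence the run nor change.\<close>
  let ?T = "T - {a} \<times> UNIV"
  have le: "card ?T \<le> card T" using T(1) by (intro card_mono) auto
  have "touches_only P (Local a c) s (t(a := s a)) (1 + w) (1 + d) ?T"
  proof (rule touches_onlyI)
    fix s' :: store assume eq: "\<And>b i. (b, i) \<in> ?T \<Longrightarrow> s' b i = s b i"
    let ?s = "s'(a := \<lambda>_. 0)"
    have "exec P c ?s (\<lambda>b i. if (b, i) \<in> T then t b i else ?s b i) w d"
      using T(5) by (rule touches_only_exec) (use eq in auto)
    then have "exec P (Local a c) s' ((\<lambda>b i. if (b, i) \<in> T then t b i else ?s b i)(a := s' a)) (1 + w) (1 + d)"
      by (rule exec.Local)
    then show "\<exists>t'. exec P (Local a c) s' t' (1 + w) (1 + d) \<and>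
        (\<forall>b i. t' b i = (if (b, i) \<in> ?T then (t(a := s a)) b i else s' b i))"
      by (intro exI conjI) auto
  qed (use touches_only_unchanged[OF T(5)] in auto)
  moreover have "card ?T \<le> 1 + w" "card ?T \<le> 2 ^ (1 + d)" "finite ?T" "?T \<subseteq> X \<times> UNIV"
    using T(1-4) le by auto
  ultimately show ?case by blast
next
  case (ParFor n s e c x t w d)
  have names: "com_names c \<subseteq> X" using ParFor.prems by auto
  define Q where "Q k T \<longleftrightarrow> finite T \<and> card T \<le> w k \<and> card T \<le> 2 ^ d k \<and> T \<subseteq> X \<times> UNIV \<and>
      touches_only P c (s(x := scalar (real k))) (t k) (w k) (d k) T" for k T
  have "\<forall>k\<in>{..<n}. \<exists>T. Q k T"
    unfolding Q_def by (intro ballI ParFor.IH[OF _ names ParFor.prems(2)]) simp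
  then obtain T where Q: "\<forall>k\<in>{..<n}. Q k (T k)" by (rule bchoice[THEN exE])
  have T: "finite (T k)" "card (T k) \<le> w k" "card (T k) \<le> 2 ^ d k" "T k \<subseteq> X \<times> UNIV"
      "touches_only P c (s(x := scalar (real k))) (t k) (w k) (d k) (T k)" if "k < n" for k
    using Q that by (simp_all add: Q_def)
  let ?U = "\<Union>k<n. T k - {x} \<times> UNIV"
  let ?T = "expr_reads s e \<union> ?U"
  let ?M = "Max (insert 0 (d ` {..<n}))"
  have unch: "t k a i = s a i" if "k < n" "a \<noteq> x" "(a, i) \<notin> T k" for k a i
    using touches_only_unchanged[OF T(5)[OF that(1)] that(3)] that(2) by simp
  have card_U: "card ?U \<le> (\<Sum>k<n. card (T k))"
    by (rule order_trans[OF card_UN_le]) (use T(1) in \<open>auto intro!: sum_mono card_mono\<close>)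
  have le: "card ?T \<le> expr_cost e + card ?U"
    using card_Un_le[of "expr_reads s e" ?U] card_expr_reads[of s e] by simp
  have fin: "finite ?T" using T(1) by (auto simp: finite_expr_reads)
  have "?U \<subseteq> X \<times> UNIV" using T(4) by blast
  moreover have "expr_reads s e \<subseteq> X \<times> UNIV"
    using ParFor.prems expr_reads_names[of s e] by auto
  ultimately have sub: "?T \<subseteq> X \<times> UNIV" by blast
  have work: "card ?T \<le> 1 + expr_cost e + (\<Sum>k<n. 1 + w k)"
  proof -
    have "(\<Sum>k<n. card (T k)) \<le> (\<Sum>k<n. 1 + w k)" using T(2) by (intro sum_mono) (auto intro: le_SucI)
    then show ?thesis using le card_U by linarith
  qed
  have depth: "card ?T \<le> 2 ^ (1 + expr_cost e + ceillog2 n + ?M)"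
  proof -
    have "(\<Sum>k<n. card (T k)) \<le> (\<Sum>k<n. 2 ^ ?M)"
    proof (rule sum_mono)
      fix k assume "k \<in> {..<n}"
      then have "card (T k) \<le> 2 ^ d k" "d k \<le> ?M" using T(3) by auto
      then show "card (T k) \<le> 2 ^ ?M" by (meson le_trans one_le_numeral power_increasing)
    qed
    also have "\<dots> \<le> 2 ^ ceillog2 n * 2 ^ ?M" using le_two_power_ceillog2 by simp
    finally have "card ?T \<le> (1 + expr_cost e) + 2 ^ (ceillog2 n + ?M)"
      using le card_U by (simp add: power_add)
    also have "\<dots> \<le> 2 ^ (1 + expr_cost e + (ceillog2 n + ?M))" by (rule add_power2_le)
    finally show ?thesis by (simp only: add.assoc)
  qed
  have "touches_only P (ParFor x e c) s (join s (map (\<lambda>k. (t k)(x := s x)) [0..<n]))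
      (1 + expr_cost e + (\<Sum>k<n. 1 + w k)) (1 + expr_cost e + ceillog2 n + ?M) ?T"
  proof (rule touches_onlyI)
    fix a i assume "(a, i) \<notin> ?T"
    then show "join s (map (\<lambda>k. (t k)(x := s x)) [0..<n]) a i = s a i"
      using unch by (intro join_map_unchanged) auto
  next
    fix s' :: store assume eq: "\<And>a i. (a, i) \<in> ?T \<Longrightarrow> s' a i = s a i"
    let ?s = "\<lambda>k. s'(x := scalar (real k))"
    let ?t = "\<lambda>k a i. if (a, i) \<in> T k then t k a i else ?s k a i"
    have "expr_val s' e = expr_val s e" by (rule expr_val_cong) (use eq in auto)
    moreover have "exec P c (?s k) (?t k) (w k) (d k)" if "k < n" for k
      using T(5)[OF that] by (rule touches_only_exec) (use eq that in auto)
    ultimately have ex: "exec P (ParFor x e c) s' (join s' (map (\<lambda>k. (?t k)(x := s' x)) [0..<n]))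
      (1 + expr_cost e + (\<Sum>k<n. 1 + w k)) (1 + expr_cost e + ceillog2 n + ?M)"
      using ParFor.hyps by (intro exec.ParFor) auto
    \<comment> \<open>A cell of \<open>?T\<close> may be touched by some threads only; the others
      leave it at its initial value, which is the same in both runs, so the join makes the same
      decision.\<close>
    have "join s' (map (\<lambda>k. (?t k)(x := s' x)) [0..<n]) a i =
        (if (a, i) \<in> ?T then join s (map (\<lambda>k. (t k)(x := s x)) [0..<n]) a i else s' a i)" for a i
    proof (cases "(a, i) \<in> ?T")
      case True
      have "((?t k)(x := s' x)) a i = ((t k)(x := s x)) a i" if "k < n" for k
        using unch[OF that] eq[OF True] by auto
      then have "join s' (map (\<lambda>k. (?t k)(x := s' x)) [0..<n]) a i =
          join s (map (\<lambda>k. (t k)(x := s x)) [0..<n]) a i"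
        using eq[OF True] by (intro join_map_cong) auto
      then show ?thesis using True by simp
    next
      case False
      then show ?thesis by (subst join_map_unchanged) auto
    qed
    then show "\<exists>t'. exec P (ParFor x e c) s' t' (1 + expr_cost e + (\<Sum>k<n. 1 + w k))
          (1 + expr_cost e + ceillog2 n + ?M) \<and> (\<forall>a i. t' a i = (if (a, i) \<in> ?T
            then join s (map (\<lambda>k. (t k)(x := s x)) [0..<n]) a i else s' a i))"
      using ex by (intro exI conjI allI)
  qed
  with fin work depth sub show ?case by (intro exI[of _ ?T] conjI)
next
  case (Scan n s e f a)
  let ?T = "expr_reads s e \<union> {a} \<times> {0..<int n}"
  have card_T: "card ?T \<le> expr_cost e + n"
    using card_Un_le[of "expr_reads s e" "{a} \<times> {0..<int n}"] card_expr_reads[of s e]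
    by (simp add: card_cartesian_product)
  also have "\<dots> \<le> 1 + expr_cost e + 2 ^ ceillog2 n" using le_two_power_ceillog2[of n] by simp
  also have "\<dots> \<le> 2 ^ (1 + expr_cost e + ceillog2 n)" by (rule add_power2_le)
  finally have depth: "card ?T \<le> 2 ^ (1 + expr_cost e + ceillog2 n)" .
  have sub: "?T \<subseteq> X \<times> UNIV" using Scan.prems expr_reads_names[of s e] by auto
  let ?t = "\<lambda>s. s(a := (\<lambda>i. if 0 \<le> i \<and> i < int n then scan_val f (s a) i else s a i)) :: store"
  have "touches_only P (Scan f a e) s (?t s) (1 + expr_cost e + n) (1 + expr_cost e + ceillog2 n) ?T"
  proof (rule touches_onlyI)
    fix s' :: store assume eq: "\<And>b i. (b, i) \<in> ?T \<Longrightarrow> s' b i = s b i"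
    have "expr_val s' e = expr_val s e" by (rule expr_val_cong) (use eq in auto)
    then have ex: "exec P (Scan f a e) s' (?t s') (1 + expr_cost e + n) (1 + expr_cost e + ceillog2 n)"
      using Scan by (intro exec.Scan) auto
    have "scan_val f (s' a) i = scan_val f (s a) i" if "0 \<le> i" "i < int n" for i
    proof -
      have "s' a j = s a j" if "j \<in> {0..i}" for j using that \<open>i < int n\<close> eq by auto
      then show ?thesis
        by (cases f) (auto intro!: sum.cong arg_cong[where f = Max] image_cong)
    qed
    then have "?t s' b i = (if (b, i) \<in> ?T then ?t s b i else s' b i)" for b i
      using eq by auto
    then show "\<exists>t'. exec P (Scan f a e) s' t' (1 + expr_cost e + n) (1 + expr_cost e + ceillog2 n) \<and>
        (\<forall>b i. t' b i = (if (b, i) \<in> ?T then ?t s b i else s' b i))"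
      using ex by (intro exI conjI allI)
  qed auto
  moreover have "card ?T \<le> 1 + expr_cost e + n" "finite ?T"
    using card_T by (auto simp: finite_expr_reads)
  ultimately show ?case using depth sub by (intro exI[of _ ?T] conjI)
next
  case (Call k s t w d)
  have "com_names (P ! k) \<subseteq> X" using Call by (meson UN_least UN_subset_iff nth_mem)
  then obtain T where T: "finite T" "card T \<le> w" "card T \<le> 2 ^ d" "T \<subseteq> X \<times> UNIV"
      "touches_only P (P ! k) s t w d T" using Call by auto
  have "touches_only P (Call k) s t (1 + w) (1 + d) T"
    using T(5) exec.Call[OF Call.hyps(1)] unfolding touches_only_def by blast
  then show ?case using T(1-4) by (intro exI[of _ T]) auto
qed

text \<open>Turns a run of \<open>A\<close> from its own input store into a run inside the
  reduction: arrays outside \<open>X\<close> neither influence it nor are changed by it.\<close>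

lemma exec_frame:
  assumes "exec P c s t w d" and "com_names c \<subseteq> X" and "\<Union> (com_names ` set P) \<subseteq> X"
    and "\<And>a. a \<in> X \<Longrightarrow> s' a = s a"
  shows "exec P c s' (\<lambda>a. if a \<in> X then t a else s' a) w d"
proof -
  obtain T where T: "T \<subseteq> X \<times> UNIV" "touches_only P c s t w d T"
    using exec_locality[OF assms(1-3)] by blast
  have "exec P c s' (\<lambda>a i. if (a, i) \<in> T then t a i else s' a i) w d"
    using T(2) by (rule touches_only_exec) (use T(1) assms(4) in auto)
  moreover have "(\<lambda>a i. if (a, i) \<in> T then t a i else s' a i) = (\<lambda>a. if a \<in> X then t a else s' a)"
    using T(1) assms(4) touches_only_unchanged[OF T(2)] by (intro ext) auto
  ultimately show ?thesis by simp
qed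

section \<open>Every algorithm touches a constant fraction of the edges\<close>

lemma weighted_graph_finite:
  assumes "weighted_graph N E w"
  shows "finite E"
proof (rule finite_subset)
  show "E \<subseteq> edge_of ` ({..<N} \<times> {..<N})"
    using assms by (force simp: weighted_graph_def)
qed auto

lemma weighted_graph_card_le:
  assumes "weighted_graph N E w"
  shows "card E \<le> N * N"
proof -
  have "E \<subseteq> edge_of ` ({..<N} \<times> {..<N})"
    using assms by (force simp: weighted_graph_def)
  then have "card E \<le> card (edge_of ` ({..<N} \<times> {..<N}))" by (intro card_mono) auto
  also have "\<dots> \<le> card ({..<N} \<times> {..<N})" by (rule card_image_le) auto
  finally show ?thesis by simp
qed

lemma is_matching_subset: "is_matching E M \<Longrightarrow> M' \<subseteq> M \<Longrightarrow> M' \<subseteq> E' \<Longrightarrow> is_matching E' M'"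
  unfolding is_matching_def by blast

lemma max_weight_matching_exists:
  assumes "finite E"
  shows "\<exists>M. max_weight_matching E w M"
proof -
  let ?S = "{M. is_matching E M}"
  have "finite ?S" by (rule finite_subset[of _ "Pow E"]) (auto simp: is_matching_def assms)
  moreover have "{} \<in> ?S" by (simp add: is_matching_def)
  ultimately obtain M where "M \<in> ?S" "\<forall>M'\<in>?S. sum w M' \<le> sum w M"
    using obtains_MAX[of ?S "sum w"] Max_ge[of "sum w ` ?S"] by (metis empty_iff finite_imageI imageI)
  then show ?thesis by (auto simp: max_weight_matching_def)
qed

text \<open>The definition compares only with maximum weight matchings; on a finite graph one
  exists, and it dominates all others.\<close>

lemma approx_max_weight_matchingD:
  assumes "approx_max_weight_matching c E w M" and "finite E" and "is_matching E M'"
  shows "sum w M' \<le> c * sum w M"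
proof -
  obtain Opt where Opt: "max_weight_matching E w Opt"
    using max_weight_matching_exists[OF assms(2)] by blast
  then have "sum w M' \<le> sum w Opt" using assms(3) by (simp add: max_weight_matching_def)
  also have "\<dots> \<le> c * sum w M" using assms(1) Opt by (simp add: approx_max_weight_matching_def)
  finally show ?thesis .
qed

lemma computes_approx_mwmD:
  assumes "computes_approx_mwm A \<alpha> B D" "0 < \<epsilon>" "\<epsilon> < 1 / 2" "weighted_graph N E w"
    "lists_edges es E" "N \<le> n" "card E \<le> m" "edge_weight_ratio E w \<le> W"
  obtains t work depth where
    "exec (fst A) (snd A) (input_store N es w \<epsilon>) t work depth"
    "approx_max_weight_matching (\<alpha> \<epsilon>) E w (output_edges es t)"
    "real work \<le> B n m W \<epsilon>" "real depth \<le> D n m W \<epsilon>"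
proof -
  have "\<exists>t work depth.
           exec (fst A) (snd A) (input_store N es w \<epsilon>) t work depth \<and>
           approx_max_weight_matching (\<alpha> \<epsilon>) E w (output_edges es t) \<and>
           real work \<le> B n m W \<epsilon> \<and> real depth \<le> D n m W \<epsilon>"
    using assms unfolding computes_approx_mwm_def by blast
  then show ?thesis using that by blast
qed

text \<open>\<open>1 \<le> R\<close> takes care of the edgeless graph, whose ratio is 1 by
  convention.\<close>

lemma edge_weight_ratio_le:
  assumes "finite E" and "0 < l" and "\<And>e. e \<in> E \<Longrightarrow> l \<le> w e \<and> w e \<le> R * l" and "1 \<le> R"
  shows "edge_weight_ratio E w \<le> R"
proof (cases "E = {}")
  case False
  have "Max (w ` E) \<le> R * l" "l \<le> Min (w ` E)" using assms False by auto
  then have "Max (w ` E) / Min (w ` E) \<le> (R * l) / l"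
    using assms by (intro frac_le) auto
  then show ?thesis using False assms by (simp add: edge_weight_ratio_def)
qed (use assms in \<open>simp add: edge_weight_ratio_def\<close>)

text \<open>The adversary: on the complete bipartite graph with unit weights, raising the weights of the
  untouched edges to \<open>R\<close> changes neither the run nor the weight of its output. The class
  \<open>r - i\<close> modulo \<open>b\<close> of the edge between \<open>i\<close> and \<open>a + r\<close> partitions the edges into \<open>b\<close> matchings, none
  of which may become heavy, so only few edges are untouched.\<close>

lemma bipartite_touch_bound:
  assumes comp: "computes_approx_mwm A (\<lambda>\<epsilon>. 1 + \<epsilon>) B D" and eps: "0 < \<epsilon>" "\<epsilon> < 1 / 2"
    and R: "3 \<le> R" and ab: "0 < a" "a \<le> b" "a + b \<le> n" "a * b \<le> m"
  obtains work depth where "a * b \<le> 2 * work" "a * b \<le> 2 * 2 ^ depth"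
    "real work \<le> B n m R \<epsilon>" "real depth \<le> D n m R \<epsilon>"
proof -
  define edge where "edge k = {k div b, a + k mod b}" for k
  define es where "es = map (\<lambda>k. (k div b, a + k mod b)) [0..<a * b]"
  define E where "E = edge ` {..<a * b}"
  define wF where "wF F e = (if e \<in> edge ` F then R else 1)" for F e
  have b: "0 < b" using ab by simp
  have left: "k div b < a" if "k < a * b" for k
    using that by (simp add: less_mult_imp_div_less)
  have right: "k mod b < b" for k using b by simp
  have share: "k div b = l div b \<or> k mod b = l mod b"
    if "edge k \<inter> edge l \<noteq> {}" "k < a * b" "l < a * b" for k l
    using that left[of k] left[of l] by (auto simp: edge_def)
  have inj: "inj_on edge {..<a * b}"
  proof (rule inj_onI)
    fix k l assume kl: "k \<in> {..<a * b}" "l \<in> {..<a * b}" "edge k = edge l"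
    then have "k div b = l div b \<and> k mod b = l mod b"
      using left[of k] left[of l] by (auto simp: edge_def doubleton_eq_iff)
    then show "k = l" by (metis div_mult_mod_eq)
  qed
  have map_es: "map edge_of es = map edge [0..<a * b]" by (simp add: es_def edge_def)
  have len: "length es = a * b" by (simp add: es_def)
  have es_nth: "edge_of (es ! k) = edge k" if "k < a * b" for k
    using that by (simp add: es_def edge_def)
  have lists: "lists_edges es E"
    using inj by (auto simp: lists_edges_def map_es E_def distinct_map atLeast0LessThan)
  have fin: "finite E" by (simp add: E_def)
  have card_E: "card E \<le> m" using ab by (simp add: E_def card_image[OF inj])
  have graph: "weighted_graph (a + b) E (wF F)" for F
    unfolding weighted_graph_def
  proof (intro conjI subsetI ballI)
    fix e assume "e \<in> E"
    then obtain k where "k < a * b" "e = edge k" by (auto simp: E_def)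
    then show "e \<in> {{u, v} |u v. u < a + b \<and> v < a + b \<and> u \<noteq> v}"
      using left[of k] right[of k] unfolding edge_def
      by (intro CollectI exI[of _ "k div b"] exI[of _ "a + k mod b"]) auto
  qed (use R in \<open>auto simp: wF_def\<close>)
  have ratio: "edge_weight_ratio E (wF F) \<le> R" for F
    by (rule edge_weight_ratio_le[where l = 1]) (use R fin in \<open>auto simp: wF_def\<close>)
  obtain t work depth where run: "exec (fst A) (snd A) (input_store (a + b) es (wF {}) \<epsilon>) t work depth"
    and bounds: "real work \<le> B n m R \<epsilon>" "real depth \<le> D n m R \<epsilon>"
    by (rule computes_approx_mwmD[OF comp eps graph lists ab(3) card_E ratio])
  obtain T where T: "finite T" "card T \<le> work" "card T \<le> 2 ^ depth"
      "touches_only (fst A) (snd A) (input_store (a + b) es (wF {}) \<epsilon>) t work depth T"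
    using exec_locality[OF run, of UNIV] by auto
  \<comment> \<open>The weight of such an edge has no influence on the run, and its output cell
    keeps the initial 0, so the edge is not chosen.\<close>
  define F where "F = {k. k < a * b \<and> (''wt'', int k) \<notin> T \<and> (''out'', int k) \<notin> T}"
  have F_sub: "F \<subseteq> {..<a * b}" by (auto simp: F_def)
  have not_F: "edge k \<notin> edge ` F" if "k < a * b" "k \<notin> F" for k
    using that F_sub inj by (auto simp: inj_on_def)
  let ?s = "input_store (a + b) es (wF F) \<epsilon>"
  have same: "?s x i = input_store (a + b) es (wF {}) \<epsilon> x i" if "(x, i) \<in> T" for x i
  proof -
    have "wF F (edge (nat i)) = 1" if "x = ''wt''" "0 \<le> i" "i < int (a * b)"
    proof -
      have "nat i < a * b" using that by (simp add: nat_less_iff)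
      moreover have "nat i \<notin> F" using that \<open>(x, i) \<in> T\<close> by (simp add: F_def)
      ultimately show ?thesis using not_F by (simp add: wF_def)
    qed
    then show ?thesis
      by (auto simp: input_store_def list_array_def len es_nth nat_less_iff) (auto simp: wF_def)
  qed
  obtain t' work' depth' where run': "exec (fst A) (snd A) ?s t' work' depth'"
    and approx: "approx_max_weight_matching (1 + \<epsilon>) E (wF F) (output_edges es t')"
    by (rule computes_approx_mwmD[OF comp eps graph lists ab(3) card_E ratio])
  \<comment> \<open>Determinism identifies the run guaranteed for the heavy weights with the
    unit-weight run transported along \<open>T\<close>.\<close>
  have "t' = (\<lambda>x i. if (x, i) \<in> T then t x i else ?s x i)"
    using exec_deterministic[OF touches_only_exec[OF T(4)] run'] same by blast
  then have out: "(''out'', i) \<in> T" if "t' ''out'' i \<noteq> 0" for i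
    using that by (auto simp: input_store_def split: if_splits)
  define M where "M = output_edges es t'"
  have M: "is_matching E M" using approx by (simp add: M_def approx_max_weight_matching_def)
  have M_edge: "\<exists>k<a * b. e = edge k \<and> k \<notin> F" if "e \<in> M" for e
    using that out unfolding M_def output_edges_def len F_def by (auto simp: es_nth)
  have "wF F e = 1" if "e \<in> M" for e using M_edge[OF that] not_F unfolding wF_def by metis
  then have "sum (wF F) M = sum (\<lambda>_. 1) M" by (intro sum.cong) auto
  then have weight_M: "sum (wF F) M = real (card M)" by simp
  have Min_edge: "Min (edge k) = k div b" if "k < a * b" for k
    using left[OF that] by (simp add: edge_def)
  \<comment> \<open>Right endpoints are at least \<open>a\<close>, so \<open>Min\<close> is the left
    endpoint, and a matching uses each of the \<open>a\<close> left vertices at most once.\<close>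
  have "card M \<le> card {..<a}"
  proof (rule card_inj_on_le[of Min])
    show "inj_on Min M"
    proof (rule inj_onI)
      fix e e' assume e: "e \<in> M" "e' \<in> M" "Min e = Min e'"
      then obtain k l where kl: "k < a * b" "e = edge k" "l < a * b" "e' = edge l"
        using M_edge by blast
      then have "k div b \<in> e \<inter> e'" using e Min_edge by (auto simp: edge_def)
      then show "e = e'" using M e unfolding is_matching_def by blast
    qed
    show "Min ` M \<subseteq> {..<a}" using M_edge Min_edge left by fastforce
  qed simp
  then have card_M: "card M \<le> a" by simp
  \<comment> \<open>The residue of \<open>k mod b - k div b\<close> modulo \<open>b\<close>, written
    with a case split since subtraction on naturals truncates; \<open>a \<le> b\<close> makes it
    injective on edges that share an endpoint.\<close>
  define cl where "cl k = (if k div b \<le> k mod b then k mod b - k div b else k mod b + b - k div b)" for k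
  have cl: "cl k < b" if "k < a * b" for k
  proof -
    have "(if i \<le> r then r - i else r + b - i) < b" if "i < a" "r < b" for i r :: nat
      using that by auto
    then show ?thesis unfolding cl_def using left[OF that] right by blast
  qed
  have cl_aux: "i = i' \<and> r = r'" if "i < b" "i' < b" "r < b" "r' < b" "i = i' \<or> r = r'"
    "(if i \<le> r then r - i else r + b - i) = (if i' \<le> r' then r' - i' else r' + b - i')"
    for i i' r r' :: nat
    using that by (auto split: if_splits)
  have cl_inj: "k = l" if "edge k \<inter> edge l \<noteq> {}" "cl k = cl l" "k < a * b" "l < a * b" for k l
  proof -
    have "k div b = l div b \<and> k mod b = l mod b"
    proof (rule cl_aux)
      show "k div b < b" "l div b < b" using left[OF that(3)] left[OF that(4)] ab by linarith+
    qed (use share[OF that(1,3,4)] that(2) right in \<open>simp_all add: cl_def\<close>)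
    then show ?thesis by (metis div_mult_mod_eq)
  qed
  have class_bound: "R * real (card {k\<in>F. cl k = j}) \<le> (1 + \<epsilon>) * real a" for j
  proof -
    let ?F = "{k\<in>F. cl k = j}"
    have injF: "inj_on edge ?F" by (rule inj_on_subset[OF inj]) (use F_sub in auto)
    have "is_matching E (edge ` ?F)"
      unfolding is_matching_def E_def using F_sub cl_inj by (auto; blast)
    then have "sum (wF F) (edge ` ?F) \<le> (1 + \<epsilon>) * sum (wF F) M"
      unfolding M_def by (rule approx_max_weight_matchingD[OF approx fin])
    also have "\<dots> \<le> (1 + \<epsilon>) * real a" using eps card_M by (simp add: weight_M)
    also have "sum (wF F) (edge ` ?F) = sum (\<lambda>_. R) (edge ` ?F)"
      by (rule sum.cong) (auto simp: wF_def)
    finally show ?thesis using card_image[OF injF] by (simp add: mult.commute)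
  qed
  have finF: "finite F" using F_sub finite_subset by blast
  have "card F = (\<Sum>j<b. card {k\<in>F. cl k = j})"
  proof -
    have "F = (\<Union>j<b. {k\<in>F. cl k = j})" using cl F_sub by auto
    then have "card F = card (\<Union>j<b. {k\<in>F. cl k = j})" by simp
    also have "\<dots> = (\<Sum>j<b. card {k\<in>F. cl k = j})"
      by (rule card_UN_disjoint) (use finF in auto)
    finally show ?thesis .
  qed
  then have "R * real (card F) = (\<Sum>j<b. R * real (card {k\<in>F. cl k = j}))"
    by (simp add: sum_distrib_left)
  also have "\<dots> \<le> (\<Sum>j<b. (1 + \<epsilon>) * real a)" by (rule sum_mono) (rule class_bound)
  also have "\<dots> = (1 + \<epsilon>) * real (a * b)" by simp
  also have "\<dots> \<le> (3 / 2) * real (a * b)" using eps by (intro mult_right_mono) auto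
  finally have "R * real (card F) \<le> 3 / 2 * real (a * b)" .
  \<comment> \<open>This is the source of \<open>3 \<le> R\<close>: together with
    \<open>1 + \<epsilon> \<le> 3 / 2\<close> it leaves at most half of the edges untouched.\<close>
  moreover have "3 * real (card F) \<le> R * real (card F)" using R by (intro mult_right_mono) auto
  ultimately have "real (2 * card F) \<le> real (a * b)" by simp
  then have "2 * card F \<le> a * b" by (simp only: of_nat_le_iff)
  moreover have "card ({..<a * b} - F) = a * b - card F"
    using F_sub finF by (simp add: card_Diff_subset)
  moreover have "card ({..<a * b} - F) \<le> card T"
  proof -
    have "card ({..<a * b} - F) = card (int ` ({..<a * b} - F))" by (simp add: card_image)
    also have "\<dots> \<le> card (snd ` T)"
      using T(1) by (intro card_mono) (force simp: F_def)+
    also have "\<dots> \<le> card T" using T(1) by (rule card_image_le)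
    finally show ?thesis .
  qed
  ultimately have "a * b \<le> 2 * card T" by linarith
  then show ?thesis using that[of work depth] T(2,3) bounds by linarith
qed

text \<open>A star serves \<open>k \<le> h\<close>. Otherwise one side gets
  \<open>h = N div 2\<close> vertices and the other as many as \<open>k\<close> allows. Rounding
  \<open>k div h\<close> loses a factor of at most 2; when the side is capped at \<open>h\<close>
  instead, \<open>N \<le> 3 * h\<close> gives the factor 9, with \<open>N = 3\<close> as the extreme
  case.\<close>

lemma bipartite_size:
  fixes k N :: nat
  assumes "0 < k" and "k \<le> N * N" and "2 \<le> N"
  obtains a b where "0 < a" "a \<le> b" "a + b \<le> N" "a * b \<le> k" "k \<le> 9 * (a * b)"
proof -
  define h where "h = N div 2"
  have h: "0 < h" "2 * h \<le> N" "N \<le> 3 * h" using assms(3) by (auto simp: h_def)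
  show ?thesis
  proof (cases "k \<le> h")
    case True
    then show ?thesis using that[of 1 k] assms h by simp
  next
    case False
    define a where "a = min (k div h) h"
    have "k div h > 0" using False h by (simp add: div_greater_zero_iff)
    then have "0 < a" using h by (simp add: a_def)
    moreover have "a * h \<le> k"
      by (rule le_trans[OF mult_le_mono1 div_times_less_eq_dividend]) (simp add: a_def)
    moreover have "k \<le> 9 * (a * h)"
    proof (cases "k div h \<le> h")
      case True
      have "k = h * (k div h) + k mod h" by simp
      also have "\<dots> \<le> h * (k div h) + h * (k div h)"
      proof (rule add_left_mono)
        have "k mod h \<le> h * 1" using mod_less_divisor[OF h(1), of k] by simp
        also have "\<dots> \<le> h * (k div h)" using \<open>k div h > 0\<close> by (intro mult_le_mono2) simp
        finally show "k mod h \<le> h * (k div h)" .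
      qed
      finally show ?thesis using True by (simp add: a_def mult.commute)
    next
      case False
      have "N * N \<le> (3 * h) * (3 * h)" using h by (intro mult_le_mono) auto
      then show ?thesis using False assms by (simp add: a_def)
    qed
    ultimately show ?thesis using that[of a h] h by (simp add: a_def)
  qed
qed

text \<open>The parameters bound the input from above only, so the same values of \<open>B\<close>
  and \<open>D\<close> govern a bipartite graph with at most \<open>N\<close> vertices and at most
  \<open>card E\<close> edges, and also the edgeless graph, which yields the two bounds by 1. The
  constants: \<open>18 = 9 * 2\<close>, and
  \<open>card E \<le> 18 * 2 ^ depth \<le> 2 ^ (5 + depth)\<close>, where
  \<open>5 \<le> 5 * D n m R \<epsilon>\<close>.\<close>

lemma cost_lower_bounds:
  assumes comp: "computes_approx_mwm A (\<lambda>\<epsilon>. 1 + \<epsilon>) B D" and eps: "0 < \<epsilon>" "\<epsilon> < 1 / 2"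
    and R: "3 \<le> R" and graph: "weighted_graph N E w" and le: "N \<le> n" "card E \<le> m"
  shows "1 \<le> B n m R \<epsilon>" and "1 \<le> D n m R \<epsilon>"
    and "real (card E) \<le> 18 * B n m R \<epsilon>" and "real (ceillog2 (card E)) \<le> 6 * D n m R \<epsilon>"
proof -
  obtain t work depth where
    "exec (fst A) (snd A) (input_store 0 [] w \<epsilon>) t work depth"
    "real work \<le> B n m R \<epsilon>" "real depth \<le> D n m R \<epsilon>"
    by (rule computes_approx_mwmD[OF comp eps, of 0 "{}" w "[]" n m R])
      (use R in \<open>auto simp: weighted_graph_def lists_edges_def edge_weight_ratio_def\<close>)
  then show one: "1 \<le> B n m R \<epsilon>" "1 \<le> D n m R \<epsilon>" using exec_pos by fastforce+
  have "real (card E) \<le> 18 * B n m R \<epsilon> \<and> real (ceillog2 (card E)) \<le> 6 * D n m R \<epsilon>"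
  proof (cases "card E = 0")
    case True
    then show ?thesis using one by simp
  next
    case False
    have "2 \<le> N"
    proof (rule ccontr)
      assume "\<not> 2 \<le> N"
      then have "E = {}" using graph unfolding weighted_graph_def by fastforce
      then show False using False by simp
    qed
    then obtain a b where ab: "0 < a" "a \<le> b" "a + b \<le> N" "a * b \<le> card E" "card E \<le> 9 * (a * b)"
      using bipartite_size[of "card E" N] False weighted_graph_card_le[OF graph] by auto
    obtain work depth where w: "a * b \<le> 2 * work" "a * b \<le> 2 * 2 ^ depth"
      "real work \<le> B n m R \<epsilon>" "real depth \<le> D n m R \<epsilon>"
      using bipartite_touch_bound[OF comp eps R ab(1,2), of n m] ab(3,4) le by auto
    have "card E \<le> 18 * work" using ab w by linarith
    then have "real (card E) \<le> 18 * real work" by (metis of_nat_le_iff of_nat_mult of_nat_numeral)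
    moreover have "card E \<le> 2 ^ (5 + depth)" using ab w by (simp add: power_add)
    then have "ceillog2 (card E) \<le> 5 + depth" using False by (subst ceillog2_le_iff) auto
    ultimately show ?thesis using w one by auto
  qed
  then show "real (card E) \<le> 18 * B n m R \<epsilon>" "real (ceillog2 (card E)) \<le> 6 * D n m R \<epsilon>" by auto
qed

section \<open>Executions measured in units of one parallel pass over the edges\<close>

notation Seq (infixr ";;" 60)

definition par_put :: "string \<Rightarrow> expr \<Rightarrow> expr \<Rightarrow> string \<Rightarrow> expr \<Rightarrow> expr \<Rightarrow> com" where
  "par_put x l b a i e = ParFor x l (Cond b (Put a i e) Skip)"

fun locals :: "string list \<Rightarrow> com \<Rightarrow> com" where
  "locals [] c = c"
| "locals (a # as) c = Local a (locals as c)"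

lemma exec_locals:
  "exec P c (\<lambda>a. if a \<in> set as then (\<lambda>_. 0) else s a) t w d \<Longrightarrow>
    exec P (locals as c) s (\<lambda>a. if a \<in> set as then s a else t a) (length as + w) (length as + d)"
proof (induction as arbitrary: s)
  case (Cons a as)
  let ?s = "s(a := \<lambda>_. 0)"
  have "(\<lambda>b. if b \<in> set as then (\<lambda>_. 0) else ?s b) = (\<lambda>b. if b \<in> set (a # as) then (\<lambda>_. 0) else s b)"
    by auto
  then have "exec P (locals as c) ?s (\<lambda>b. if b \<in> set as then ?s b else t b) (length as + w) (length as + d)"
    using Cons by (intro Cons.IH) auto
  from exec.Local[OF this]
  have "exec P (locals (a # as) c) s ((\<lambda>b. if b \<in> set as then ?s b else t b)(a := s a))
      (1 + (length as + w)) (1 + (length as + d))" by simp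
  moreover have "(\<lambda>b. if b \<in> set as then ?s b else t b)(a := s a) =
      (\<lambda>b. if b \<in> set (a # as) then s b else t b)" by auto
  ultimately show ?case by simp
qed simp

lemma scalar_0 [simp]: "scalar x 0 = x"
  by (simp add: scalar_def)

text \<open>One unit of work \<open>U\<close> and of depth \<open>V\<close> pays for a pass over \<open>m\<close> edges with a loop body of
  bounded size.\<close>

locale cost_units =
  fixes P :: "com list" and m U V :: nat
  assumes U: "60 * (m + 1) \<le> U" and V: "60 + ceillog2 m \<le> V"
begin

text \<open>One counter serves both measures: work and depth of the reduction need the same number
  of units, and only the sizes of \<open>U\<close> and \<open>V\<close> differ.\<close>

definition reach :: "nat \<Rightarrow> com \<Rightarrow> store \<Rightarrow> store \<Rightarrow> bool" where
  "reach k c s t \<longleftrightarrow> (\<exists>w d. exec P c s t w d \<and> w \<le> k * U \<and> d \<le> k * V)"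

definition runs :: "nat \<Rightarrow> com \<Rightarrow> store \<Rightarrow> (store \<Rightarrow> bool) \<Rightarrow> bool" where
  "runs k c s Q \<longleftrightarrow> (\<exists>t. reach k c s t \<and> Q t)"

lemma reachI: "exec P c s t w d \<Longrightarrow> w \<le> k * U \<Longrightarrow> d \<le> k * V \<Longrightarrow> reach k c s t"
  unfolding reach_def by blast

lemma runsI: "reach k c s t \<Longrightarrow> Q t \<Longrightarrow> runs k c s Q"
  by (auto simp: runs_def)

lemma reach_mono: "reach k c s t \<Longrightarrow> k \<le> l \<Longrightarrow> reach l c s t"
  unfolding reach_def by (meson le_trans mult_le_mono1)

lemma runs_mono: "runs k c s Q \<Longrightarrow> k \<le> l \<Longrightarrow> (\<And>t. Q t \<Longrightarrow> Q' t) \<Longrightarrow> runs l c s Q'"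
  unfolding runs_def using reach_mono by blast

lemma reach_Seq: "reach k c1 s t \<Longrightarrow> reach l c2 t u \<Longrightarrow> reach (k + l) (c1 ;; c2) s u"
  unfolding reach_def add_mult_distrib using exec.Seq add_mono by metis

lemma runs_Seq:
  "runs k c1 s R \<Longrightarrow> (\<And>t. R t \<Longrightarrow> runs l c2 t Q) \<Longrightarrow> runs (k + l) (c1 ;; c2) s Q"
  unfolding runs_def using reach_Seq by blast

lemma runs_Seq_reach: "reach k c1 s t \<Longrightarrow> runs l c2 t Q \<Longrightarrow> runs (k + l) (c1 ;; c2) s Q"
  unfolding runs_def using reach_Seq by blast

lemma reach_Skip: "reach 1 Skip s s"
  by (rule reachI[OF exec.Skip]) (use U V in auto)

lemma reach_Put:
  assumes "expr_cost i + expr_cost e \<le> 50"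
  shows "reach 1 (Put a i e) s (s(a := (s a)(\<lfloor>expr_val s i\<rfloor> := expr_val s e)))"
  by (rule reachI[OF exec.Put[OF refl]]) (use U V assms in auto)

lemma runs_Cond:
  assumes "expr_cost b \<le> 50"
    and "expr_val s b \<noteq> 0 \<Longrightarrow> runs k c1 s Q" and "expr_val s b = 0 \<Longrightarrow> runs k c2 s Q"
  shows "runs (Suc k) (Cond b c1 c2) s Q"
proof -
  have bnd: "1 + expr_cost b + x \<le> Suc k * U" if "x \<le> k * U" for x using U assms(1) that by simp
  have bnd': "1 + expr_cost b + x \<le> Suc k * V" if "x \<le> k * V" for x using V assms(1) that by simp
  show ?thesis
  proof (cases "expr_val s b = 0")
    case True
    then obtain t w d where "exec P c2 s t w d" "w \<le> k * U" "d \<le> k * V" "Q t"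
      using assms(3) unfolding runs_def reach_def by blast
    then show ?thesis unfolding runs_def reach_def
      using exec.CondFalse[OF True] bnd bnd' by blast
  next
    case False
    then obtain t w d where "exec P c1 s t w d" "w \<le> k * U" "d \<le> k * V" "Q t"
      using assms(2) unfolding runs_def reach_def by blast
    then show ?thesis unfolding runs_def reach_def
      using exec.CondTrue[OF False] bnd bnd' by blast
  qed
qed

text \<open>Termination is hidden in \<open>step\<close>: an iteration that is entered must have an
  index below \<open>n\<close>. An iteration costs \<open>Suc k\<close>, the additional unit paying
  for its test, and the final unit pays for the failing test.\<close>

lemma runs_While:
  assumes cost: "expr_cost b \<le> 50"
    and step: "\<And>j s. I j s \<Longrightarrow> expr_val s b \<noteq> 0 \<Longrightarrow> j < n \<and> runs k c s (I (Suc j))"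
    and init: "I 0 s"
  shows "runs (n * Suc k + 1) (While b c) s (\<lambda>t. \<exists>j\<le>n. I j t \<and> expr_val t b = 0)"
proof -
  have loop: "runs (l * Suc k + 1) (While b c) s (\<lambda>t. \<exists>j\<le>n. I j t \<and> expr_val t b = 0)"
    if "I j s" "j + l = n" for j l s
    using that
  proof (induction l arbitrary: j s)
    case 0
    then have "expr_val s b = 0" using step by fastforce
    then have "reach 1 (While b c) s s"
      by (rule reachI[OF exec.WhileFalse]) (use U V cost in auto)
    then show ?case using 0 \<open>expr_val s b = 0\<close> by (auto simp: runs_def)
  next
    case (Suc l)
    show ?case
    proof (cases "expr_val s b = 0")
      case True
      have "exec P (While b c) s s (1 + expr_cost b) (1 + expr_cost b)"
        using True by (rule exec.WhileFalse)
      moreover have "1 + expr_cost b \<le> (Suc l * Suc k + 1) * U" "1 + expr_cost b \<le> (Suc l * Suc k + 1) * V"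
        using U V cost by (auto intro: trans_le_add1)
      moreover have "j \<le> n" using Suc.prems by simp
      ultimately show ?thesis using True Suc.prems(1) unfolding runs_def reach_def by blast
    next
      case False
      then obtain u w1 d1 where u: "exec P c s u w1 d1" "w1 \<le> k * U" "d1 \<le> k * V" "I (Suc j) u"
        using step[OF Suc.prems(1)] unfolding runs_def reach_def by blast
      moreover have "Suc j + l = n" using Suc.prems by simp
      ultimately obtain t w2 d2 where t: "exec P (While b c) u t w2 d2" "w2 \<le> (l * Suc k + 1) * U"
          "d2 \<le> (l * Suc k + 1) * V" "\<exists>j\<le>n. I j t \<and> expr_val t b = 0"
        using Suc.IH unfolding runs_def reach_def by blast
      have "exec P (While b c) s t (1 + expr_cost b + w1 + w2) (1 + expr_cost b + d1 + d2)"
        using False u(1) t(1) by (rule exec.WhileTrue)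
      moreover have "1 + expr_cost b + w1 + w2 \<le> (Suc l * Suc k + 1) * U"
        using u(2) t(2) U cost by (simp add: add_mult_distrib)
      moreover have "1 + expr_cost b + d1 + d2 \<le> (Suc l * Suc k + 1) * V"
        using u(3) t(3) V cost by (simp add: add_mult_distrib)
      ultimately show ?thesis using t(4) unfolding runs_def reach_def by blast
    qed
  qed
  show ?thesis using loop[OF init, of n] by simp
qed

lemma runs_locals:
  assumes "length as \<le> U" "length as \<le> V"
    and "runs k c (\<lambda>a. if a \<in> set as then (\<lambda>_. 0) else s a)
      (\<lambda>t. Q (\<lambda>a. if a \<in> set as then s a else t a))"
  shows "runs (Suc k) (locals as c) s Q"
proof -
  obtain t w d where t: "exec P c (\<lambda>a. if a \<in> set as then (\<lambda>_. 0) else s a) t w d"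
      "w \<le> k * U" "d \<le> k * V" "Q (\<lambda>a. if a \<in> set as then s a else t a)"
    using assms(3) unfolding runs_def reach_def by blast
  have "length as + w \<le> Suc k * U" "length as + d \<le> Suc k * V" using t(2,3) assms(1,2) by auto
  then show ?thesis unfolding runs_def reach_def using exec_locals[OF t(1)] t(4) by blast
qed

lemma reach_Scan:
  assumes "\<lfloor>expr_val s l\<rfloor> = int m" and "expr_cost l \<le> 50"
  shows "reach 1 (Scan f a l) s (s(a := (\<lambda>i. if 0 \<le> i \<and> i < int m then scan_val f (s a) i else s a i)))"
  by (rule reachI[OF exec.Scan]) (use U V assms in auto)

text \<open>\<open>h\<close> is the final array. Several threads may write to the same cell;
  \<open>written\<close> makes each of them store \<open>h\<close> there, so the join does not
  depend on priorities.\<close>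

lemma reach_par_put:
  assumes len: "\<lfloor>expr_val s l\<rfloor> = int m" and "x \<noteq> a"
    and written: "\<And>k. k < m \<Longrightarrow> expr_val (s(x := scalar (real k))) b \<noteq> 0 \<Longrightarrow>
      h \<lfloor>expr_val (s(x := scalar (real k))) i\<rfloor> = expr_val (s(x := scalar (real k))) e"
    and unwritten: "\<And>j. (\<And>k. k < m \<Longrightarrow> expr_val (s(x := scalar (real k))) b \<noteq> 0 \<Longrightarrow>
      \<lfloor>expr_val (s(x := scalar (real k))) i\<rfloor> \<noteq> j) \<Longrightarrow> h j = s a j"
    and cost: "expr_cost l + expr_cost b + expr_cost i + expr_cost e \<le> 50"
  shows "reach 1 (par_put x l b a i e) s (s(a := h))"
proof -
  define S where "S k = s(x := scalar (real k))" for k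
  define t where "t k = (if expr_val (S k) b = 0 then S k
    else (S k)(a := (S k a)(\<lfloor>expr_val (S k) i\<rfloor> := expr_val (S k) e)))" for k
  define w where "w k = (if expr_val (S k) b = 0 then 1 + expr_cost b + 1
    else 1 + expr_cost b + (1 + expr_cost i + expr_cost e))" for k
  have body: "exec P (Cond b (Put a i e) Skip) (S k) (t k) (w k) (w k)" for k
  proof (cases "expr_val (S k) b = 0")
    case True
    from exec.CondFalse[OF this exec.Skip] show ?thesis using True by (simp add: t_def w_def)
  next
    case False
    from exec.CondTrue[OF this exec.Put[OF refl]] show ?thesis using False by (simp add: t_def w_def)
  qed
  have w_le: "w k \<le> 2 + expr_cost b + expr_cost i + expr_cost e" for k by (simp add: w_def)
  let ?r = "\<lambda>k. (t k)(x := s x)"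
  have "join s (map ?r [0..<m]) c j = (s(a := h)) c j" for c j
  proof (cases "c = a \<and> (\<exists>k<m. expr_val (S k) b \<noteq> 0 \<and> \<lfloor>expr_val (S k) i\<rfloor> = j)")
    case True
    then obtain k where k: "k < m" "expr_val (S k) b \<noteq> 0" "\<lfloor>expr_val (S k) i\<rfloor> = j" by blast
    have val: "?r k' a j = h j" if "k' < m" "expr_val (S k') b \<noteq> 0" "\<lfloor>expr_val (S k') i\<rfloor> = j" for k'
      using written[of k'] that \<open>x \<noteq> a\<close> by (auto simp: t_def S_def)
    have "?r k' a j = h j \<or> ?r k' a j = s a j" if "k' < m" for k'
      using val[OF that] \<open>x \<noteq> a\<close> by (auto simp: t_def S_def)
    then have "join s (map ?r [0..<m]) a j = h j"
      using val[OF k] k(1) by (intro join_map_value) auto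
    then show ?thesis using True by simp
  next
    case False
    have "?r k c j = s c j" if "k < m" for k
      using False that by (auto simp: t_def S_def)
    then have "join s (map ?r [0..<m]) c j = s c j" by (rule join_map_unchanged)
    moreover have "h j = s a j" if "c = a" using False that unwritten by (auto simp: S_def)
    ultimately show ?thesis by auto
  qed
  then have "join s (map ?r [0..<m]) = s(a := h)" by (intro ext)
  moreover have "exec P (par_put x l b a i e) s (join s (map ?r [0..<m]))
      (1 + expr_cost l + (\<Sum>k<m. 1 + w k)) (1 + expr_cost l + ceillog2 m + Max (insert 0 (w ` {..<m})))"
    unfolding par_put_def using len body by (intro exec.ParFor) (auto simp: S_def)
  \<comment> \<open>53 is the budget of 50 plus one unit each for the test, the assignment and the
    fork.\<close>
  moreover have "(\<Sum>k<m. 1 + w k) \<le> (\<Sum>k<m. 53)"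
  proof (rule sum_mono)
    show "1 + w k \<le> 53" for k using w_le[of k] cost by linarith
  qed
  moreover have max_le: "Max (insert 0 (w ` {..<m})) \<le> 52 - expr_cost l"
  proof (rule Max.boundedI)
    show "y \<le> 52 - expr_cost l" if "y \<in> insert 0 (w ` {..<m})" for y
      using that
    proof
      assume "y \<in> w ` {..<m}"
      then obtain k where "y = w k" by blast
      then show ?thesis using w_le[of k] cost by linarith
    qed simp
  qed auto
  ultimately have "exec P (par_put x l b a i e) s (s(a := h))
      (1 + expr_cost l + (\<Sum>k<m. 1 + w k)) (1 + expr_cost l + ceillog2 m + Max (insert 0 (w ` {..<m})))"
    and "1 + expr_cost l + (\<Sum>k<m. 1 + w k) \<le> 1 * U"
    using U cost by auto
  moreover have "1 + expr_cost l + ceillog2 m + Max (insert 0 (w ` {..<m})) \<le> 1 * V"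
    using V cost max_le by linarith
  ultimately show ?thesis unfolding reach_def by blast
qed

end

section \<open>Weight levels and greedy merging\<close>

text \<open>The level is the exponent with \<open>wmax * \<epsilon> ^ (lev e + 1) < w e \<le> wmax *
  \<epsilon> ^ lev e\<close>; it exists since the powers of \<epsilon> tend to 0. The equivalence
  for all \<open>k\<close> matches the threshold comparisons of the program and avoids
  logarithms.\<close>

lemma level_exists:
  fixes \<epsilon> :: real
  assumes "0 < \<epsilon>" "\<epsilon> < 1" and "\<And>e. e \<in> E \<Longrightarrow> 0 < w e \<and> w e \<le> wmax"
  shows "\<exists>lev. \<forall>e\<in>E. \<forall>k. w e \<le> wmax * \<epsilon> ^ k \<longleftrightarrow> k \<le> lev e"
proof -
  have "\<exists>l. \<forall>k. w e \<le> wmax * \<epsilon> ^ k \<longleftrightarrow> k \<le> l" if "e \<in> E" for e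
  proof -
    have w: "0 < w e" "w e \<le> wmax" "0 < wmax" using assms(3)[OF that] by auto
    define k0 where "k0 = (LEAST k. wmax * \<epsilon> ^ k < w e)"
    have "0 < w e / wmax" using w by simp
    then obtain k where "\<epsilon> ^ k < w e / wmax" using real_arch_pow_inv[OF _ assms(2)] by blast
    then have "wmax * \<epsilon> ^ k < w e" using w by (simp add: field_simps)
    then have k0: "wmax * \<epsilon> ^ k0 < w e" unfolding k0_def by (rule LeastI)
    have "k0 \<noteq> 0" using k0 w by (cases k0) auto
    have "w e \<le> wmax * \<epsilon> ^ k \<longleftrightarrow> k \<le> k0 - 1" for k
    proof
      assume "k \<le> k0 - 1"
      then have "k < k0" using \<open>k0 \<noteq> 0\<close> by simp
      then show "w e \<le> wmax * \<epsilon> ^ k" 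
        using not_less_Least[of k "\<lambda>k. wmax * \<epsilon> ^ k < w e"] unfolding k0_def by linarith
    next
      assume le: "w e \<le> wmax * \<epsilon> ^ k"
      show "k \<le> k0 - 1"
      proof (rule ccontr)
        assume "\<not> k \<le> k0 - 1"
        then have "\<epsilon> ^ k \<le> \<epsilon> ^ k0" using assms by (intro power_decreasing) auto
        then have "wmax * \<epsilon> ^ k \<le> wmax * \<epsilon> ^ k0" using w by simp
        then show False using k0 le by linarith
      qed
    qed
    then show ?thesis by blast
  qed
  then show ?thesis by (rule bchoice[OF ballI])
qed

lemma card_Union_matching_le:
  assumes "finite F" and "\<And>e. e \<in> F \<Longrightarrow> card e = 2"
  shows "card (\<Union>F) \<le> 2 * card F"
proof -
  have "card (\<Union>F) \<le> (\<Sum>e\<in>F. card e)" by (rule card_Union_le_sum_card)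
  also have "\<dots> = 2 * card F" using assms by simp
  finally show ?thesis .
qed

lemma greedy_merge_matching:
  assumes "is_matching E F" "is_matching E M"
  shows "is_matching E (F \<union> {e\<in>M. e \<inter> \<Union>F = {}})"
  unfolding is_matching_def
proof (intro conjI ballI impI)
  show "F \<union> {e \<in> M. e \<inter> \<Union>F = {}} \<subseteq> E" using assms unfolding is_matching_def by blast
  fix e e' assume "e \<in> F \<union> {e \<in> M. e \<inter> \<Union>F = {}}" "e' \<in> F \<union> {e \<in> M. e \<inter> \<Union>F = {}}" "e \<noteq> e'"
  then consider "e \<in> F" "e' \<in> F" | "e \<in> F" "e' \<inter> \<Union>F = {}" | "e' \<in> F" "e \<inter> \<Union>F = {}" | "e \<in> M" "e' \<in> M"
    by blast
  then show "e \<inter> e' = {}"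
  proof cases
    case 1
    then show ?thesis using assms(1) \<open>e \<noteq> e'\<close> by (simp add: is_matching_def)
  next
    case 4
    then show ?thesis using assms(2) \<open>e \<noteq> e'\<close> by (simp add: is_matching_def)
  qed blast+
qed

text \<open>A blocked edge is charged to an endpoint that it shares with \<open>F\<close>. Edges of
  the matching \<open>M\<close> are disjoint, so no vertex is charged twice, and \<open>F\<close>
  covers at most \<open>2 * card F\<close> vertices.\<close>

lemma greedy_merge_loss:
  assumes M: "is_matching E M" and E: "finite E" "\<And>e. e \<in> E \<Longrightarrow> card e = 2"
    and F: "is_matching E F"
    and T: "\<And>e. e \<in> M \<Longrightarrow> w e \<le> T" and "0 \<le> T"
  shows "sum w M \<le> sum w {e\<in>M. e \<inter> \<Union>F = {}} + 2 * T * real (card F)"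
proof -
  let ?N = "{e\<in>M. e \<inter> \<Union>F = {}}" and ?L = "{e\<in>M. e \<inter> \<Union>F \<noteq> {}}"
  have fin: "finite M" "finite F" using M F finite_subset[OF _ E(1)] by (simp_all add: is_matching_def)
  have two: "card e = 2" if "e \<in> F" for e using F E(2) that by (auto simp: is_matching_def)
  have "finite e" if "e \<in> F" for e using two[OF that] by (metis card.infinite zero_neq_numeral)
  then have finU: "finite (\<Union>F)" using fin by auto
  define g where "g e = (SOME u. u \<in> e \<inter> \<Union>F)" for e :: "nat set"
  have g: "g e \<in> e \<inter> \<Union>F" if "e \<in> ?L" for e
    using that some_in_eq[of "e \<inter> \<Union>F"] by (simp add: g_def)
  have "inj_on g ?L"
  proof (rule inj_onI)
    fix e e' assume e: "e \<in> ?L" "e' \<in> ?L" "g e = g e'"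
    then have "e \<inter> e' \<noteq> {}" using g[of e] g[of e'] by auto
    then show "e = e'" using M e unfolding is_matching_def by blast
  qed
  then have "card ?L \<le> card (\<Union>F)" using g finU by (intro card_inj_on_le[of g]) auto
  also have "\<dots> \<le> 2 * card F" using fin two by (intro card_Union_matching_le) auto
  finally have card_L: "real (card ?L) \<le> 2 * real (card F)" by linarith
  have "sum w ?L \<le> real (card ?L) * T" using T by (intro sum_bounded_above) auto
  also have "\<dots> \<le> (2 * real (card F)) * T" using card_L \<open>0 \<le> T\<close> by (rule mult_right_mono)
  finally have "sum w ?L \<le> 2 * T * real (card F)" by (simp add: mult_ac)
  moreover have "sum w M = sum w ?N + sum w ?L"
  proof -
    have "M = ?N \<union> ?L" by blast
    moreover have "sum w (?N \<union> ?L) = sum w ?N + sum w ?L"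
      using fin by (intro sum.union_disjoint) auto
    ultimately show ?thesis by simp
  qed
  ultimately show ?thesis by linarith
qed

text \<open>The term \<open>3 * T * card F\<close> is a reserve: every chosen edge can block two edges of weight at most
  \<open>T\<close> of the next bucket, and the geometric decrease of \<open>T\<close> keeps the reserve affordable.\<close>

lemma greedy_merge_potential:
  fixes \<epsilon> p T :: real
  assumes M: "is_matching E M" and E: "finite E" "\<And>e. e \<in> E \<Longrightarrow> card e = 2"
    and F: "is_matching E F" and eps: "0 < \<epsilon>" and p: "0 \<le> p" "p \<le> 1 / 4" and "0 \<le> T"
    and T: "\<And>e. e \<in> M \<Longrightarrow> w e \<le> T" and low: "\<And>e. e \<in> M \<Longrightarrow> p * T \<le> \<epsilon> * w e"
    and old: "a + (1 + \<epsilon>) * (3 * T * real (card F)) \<le> (1 + \<epsilon>) * ((1 + 3 * \<epsilon>) * sum w F)"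
    and new: "b \<le> (1 + \<epsilon>) * sum w M"
    and F': "F' = F \<union> {e\<in>M. e \<inter> \<Union>F = {}}"
  shows "a + b + (1 + \<epsilon>) * (3 * (T * p) * real (card F')) \<le> (1 + \<epsilon>) * ((1 + 3 * \<epsilon>) * sum w F')"
proof -
  let ?N = "{e\<in>M. e \<inter> \<Union>F = {}}"
  have fin: "finite M" "finite F" using M F finite_subset[OF _ E(1)] by (simp_all add: is_matching_def)
  have "F \<inter> ?N = {}"
  proof -
    have "{} \<notin> E" using E(2)[of "{}"] by auto
    then have "{} \<notin> F" using F by (auto simp: is_matching_def)
    moreover have "e = {}" if "e \<in> F" "e \<in> ?N" for e using that Union_upper[OF that(1)] by auto
    ultimately show ?thesis by (intro equals0I) (metis IntE)
  qed
  then have sums: "sum w F' = sum w F + sum w ?N" "card F' = card F + card ?N"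
    using fin by (auto simp: F' sum.union_disjoint card_Un_disjoint)
  have loss: "sum w M \<le> sum w ?N + 2 * T * real (card F)"
    by (rule greedy_merge_loss[OF M E F T \<open>0 \<le> T\<close>])
  \<comment> \<open>A new edge needs the reserve \<open>3 * (T * p)\<close> for the following
    bucket; \<open>low\<close> bounds it by \<open>3 * \<epsilon>\<close> times the weight of the
    edge, which is the origin of the factor \<open>1 + 3 * \<epsilon>\<close>.\<close>
  have "real (card ?N) * (p * T) \<le> sum (\<lambda>e. \<epsilon> * w e) ?N"
    using low by (intro sum_bounded_below) auto
  then have N: "3 * (T * p) * real (card ?N) \<le> 3 * \<epsilon> * sum w ?N"
    by (simp add: sum_distrib_left[symmetric] mult_ac)
  \<comment> \<open>An old edge spends \<open>2 * T\<close> on blocked edges and keeps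
    \<open>3 * (T * p)\<close>; with \<open>p \<le> 1 / 4\<close> this takes at most
    \<open>11 / 4 * T\<close> out of its reserve \<open>3 * T\<close>.\<close>
  have "(2 * T + 3 * (T * p)) * real (card F) \<le> 3 * T * real (card F)"
  proof (rule mult_right_mono)
    have "T * p \<le> T * (1 / 4)" using p \<open>0 \<le> T\<close> by (intro mult_left_mono) auto
    then show "2 * T + 3 * (T * p) \<le> 3 * T" using \<open>0 \<le> T\<close> by linarith
  qed simp
  then have "sum w M + 3 * (T * p) * real (card F') \<le> 3 * T * real (card F) + (1 + 3 * \<epsilon>) * sum w ?N"
    using loss N by (simp add: sums algebra_simps)
  then have "(1 + \<epsilon>) * (sum w M + 3 * (T * p) * real (card F')) \<le>
      (1 + \<epsilon>) * (3 * T * real (card F) + (1 + 3 * \<epsilon>) * sum w ?N)"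
    using eps by (intro mult_left_mono) auto
  then show ?thesis using old new by (simp add: sums algebra_simps)
qed

lemma approximation_factor:
  fixes \<epsilon> S Opt best :: real
  assumes eps: "0 < \<epsilon>" "\<epsilon> < 1 / 2" and S: "0 < S" "1 \<le> S * \<epsilon>" and nonneg: "0 \<le> best" "0 \<le> Opt"
    and le: "S * Opt \<le> Opt + S * ((1 + \<epsilon>) * (1 + 3 * \<epsilon>) * best)"
  shows "Opt \<le> (1 + 16 * \<epsilon>) * best"
proof -
  have "Opt \<le> S * \<epsilon> * Opt" using S nonneg mult_right_mono[of 1 "S * \<epsilon>" Opt] by simp
  then have "S * ((1 - \<epsilon>) * Opt) \<le> S * ((1 + \<epsilon>) * (1 + 3 * \<epsilon>) * best)"
    using le by (simp add: algebra_simps)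
  then have "(1 - \<epsilon>) * Opt \<le> (1 + \<epsilon>) * (1 + 3 * \<epsilon>) * best" using S by simp
  also have "\<dots> \<le> ((1 - \<epsilon>) * (1 + 16 * \<epsilon>)) * best"
  proof (rule mult_right_mono)
    \<comment> \<open>The difference of the two sides of the goal; the bracket is positive because
      \<open>\<epsilon> < 1 / 2\<close>. This is where the 16 of the theorem enters.\<close>
    have "0 \<le> \<epsilon> * (11 - 19 * \<epsilon>)" using eps by simp
    then show "(1 + \<epsilon>) * (1 + 3 * \<epsilon>) \<le> (1 - \<epsilon>) * (1 + 16 * \<epsilon>)"
      by (simp add: algebra_simps)
  qed (rule nonneg)
  finally have "(1 - \<epsilon>) * Opt \<le> (1 - \<epsilon>) * ((1 + 16 * \<epsilon>) * best)" by (simp only: mult.assoc)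
  then show ?thesis using eps by (simp add: mult_le_cancel_left)
qed

section \<open>The reduction as a program\<close>

text \<open>Symbolic names, to be mapped to strings that do not occur in \<open>A\<close>.
  Countability supplies the numbering from which these strings are built.\<close>

datatype var = NV | MV | EpsV | SrcV | DstV | WtV | IdxV | TmpV | WmaxV | WminV | PowV | CntV
  | ShiftV | StartV | QV | FlagV | PosV | SelV | CandV | UsedV | BestV

instance var :: countable by countable_datatype

abbreviation times_expr :: "expr \<Rightarrow> expr \<Rightarrow> expr" (infixl "\<^bold>*" 70) where "x \<^bold>* y \<equiv> Op Times x y"
abbreviation plus_expr :: "expr \<Rightarrow> expr \<Rightarrow> expr" (infixl "\<^bold>+" 65) where "x \<^bold>+ y \<equiv> Op Plus x y"
abbreviation minus_expr :: "expr \<Rightarrow> expr \<Rightarrow> expr" (infixl "\<^bold>-" 65) where "x \<^bold>- y \<equiv> Op Minus x y"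
abbreviation less_expr :: "expr \<Rightarrow> expr \<Rightarrow> expr" (infix "\<^bold><" 50) where "x \<^bold>< y \<equiv> Op Less x y"

text \<open>\<open>X\<close> contains every array accessible to \<open>A\<close>, including the
  input and output arrays. Declaring all of \<open>X\<close> local therefore presents each call of
  \<open>A\<close> with zeroed arrays, from which its input store can be built exactly.\<close>

locale reduction =
  fixes A :: program and X :: "string list" and v :: "var \<Rightarrow> string"
  assumes names_main: "com_names (snd A) \<subseteq> set X"
    and names_procs: "\<Union> (com_names ` set (fst A)) \<subseteq> set X"
    and io_names: "set [''n'', ''m'', ''eps'', ''src'', ''dst'', ''wt'', ''out''] \<subseteq> set X"
    and v_inj [simp]: "v x = v y \<longleftrightarrow> x = y"
    and v_fresh [simp]: "v x \<notin> set X"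
begin

abbreviation sc :: "var \<Rightarrow> expr" where "sc x \<equiv> Get (v x) (Num 0)"
abbreviation arr :: "var \<Rightarrow> expr \<Rightarrow> expr" where "arr x i \<equiv> Get (v x) i"
abbreviation idx :: expr where "idx \<equiv> sc IdxV"

definition par_map :: "string \<Rightarrow> expr \<Rightarrow> com" where
  "par_map a e = par_put (v IdxV) (sc MV) (Num 1) a idx e"

definition set_scalar :: "string \<Rightarrow> expr \<Rightarrow> com" where
  "set_scalar a e = Put a (Num 0) e"

text \<open>Stream compaction: \<open>PosV\<close> holds prefix sums of the flags, so a flagged
  entry moves to its position minus 1, as positions count from 1.\<close>

definition compact :: "string \<Rightarrow> var \<Rightarrow> com" where
  "compact a x = par_put (v IdxV) (sc MV) (arr FlagV idx) a (arr PosV idx \<^bold>- Num 1) (arr x idx)"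

text \<open>The last prefix sum is the number of flagged edges. The answer has to be copied to
  \<open>SelV\<close> before the private arrays vanish; the factor \<open>FlagV\<close> masks
  unflagged edges, whose position belongs to another edge or is out of range.\<close>

definition solve_flagged :: com where
  "solve_flagged = locals X (
     set_scalar ''n'' (sc NV) ;;
     set_scalar ''eps'' (sc EpsV) ;;
     set_scalar ''m'' (arr PosV (sc MV \<^bold>- Num 1)) ;;
     compact ''src'' SrcV ;; compact ''dst'' DstV ;; compact ''wt'' WtV ;;
     snd A ;;
     par_map (v SelV) (arr FlagV idx \<^bold>* Get ''out'' (arr PosV idx \<^bold>- Num 1)))"

text \<open>Products serve as conjunction and subtraction from 1 as negation. All tests precede all
  marks: edges selected together do not conflict, being a matching, so only vertices used by earlier
  buckets have to be excluded.\<close>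

definition merge :: com where
  "merge =
     par_put (v IdxV) (sc MV)
       (arr SelV idx \<^bold>* ((Num 1 \<^bold>- arr UsedV (arr SrcV idx)) \<^bold>* (Num 1 \<^bold>- arr UsedV (arr DstV idx))))
       (v CandV) idx (Num 1) ;;
     par_put (v IdxV) (sc MV) (arr CandV idx) (v UsedV) (arr SrcV idx) (Num 1) ;;
     par_put (v IdxV) (sc MV) (arr CandV idx) (v UsedV) (arr DstV idx) (Num 1)"

text \<open>With \<open>QV\<close> holding \<open>q\<close> and \<open>PowV\<close> holding
  \<open>\<epsilon> ^ S\<close>, the flags select
  \<open>q < w \<le> q * \<epsilon> / \<epsilon> ^ S\<close>, with the division cleared. The next
  threshold \<open>q * \<epsilon> ^ S\<close> has upper end \<open>q * \<epsilon>\<close>, so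
  precisely the weights above \<open>q * \<epsilon>\<close> and at most \<open>q\<close> are
  skipped: this is the deleted level.\<close>

definition bucket_round :: com where
  "bucket_round =
     par_map (v FlagV)
       ((sc QV \<^bold>< arr WtV idx) \<^bold>* (Num 1 \<^bold>- (sc QV \<^bold>* sc EpsV \<^bold>< arr WtV idx \<^bold>* sc PowV))) ;;
     par_map (v PosV) (arr FlagV idx) ;;
     Scan ScanSum (v PosV) (sc MV) ;;
     solve_flagged ;;
     merge ;;
     set_scalar (v QV) (sc QV \<^bold>* sc PowV)"

definition keep_best :: com where
  "keep_best =
     par_map (v TmpV) (arr CandV idx \<^bold>* arr WtV idx) ;;
     Scan ScanSum (v TmpV) (sc MV) ;;
     Cond (sc BestV \<^bold>< arr TmpV (sc MV \<^bold>- Num 1))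
       (par_map ''out'' (arr CandV idx) ;; set_scalar (v BestV) (arr TmpV (sc MV \<^bold>- Num 1)))
       Skip"

text \<open>The local arrays make every shift start from the empty matching. The loop ends when even
  the minimum weight exceeds the upper end of the current bucket.\<close>

definition shift :: com where
  "shift =
     locals [v CandV, v UsedV] (
       set_scalar (v QV) (sc StartV) ;;
       While (Num 1 \<^bold>- (sc QV \<^bold>* sc EpsV \<^bold>< sc WminV \<^bold>* sc PowV)) bucket_round ;;
       keep_best) ;;
     set_scalar (v StartV) (sc StartV \<^bold>* sc EpsV) ;;
     set_scalar (v ShiftV) (sc ShiftV \<^bold>+ Num 1)"

definition all_shifts :: com where
  "all_shifts =
     set_scalar (v StartV) (sc WmaxV) ;; While (sc ShiftV \<^bold>< sc CntV) shift"

text \<open>The input arrays belong to \<open>X\<close> and are shadowed while \<open>A\<close> runs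
  on a bucket, so the buckets are built from fresh copies.\<close>

definition copy_input :: com where
  "copy_input =
     set_scalar (v NV) (Get ''n'' (Num 0)) ;;
     set_scalar (v MV) (Get ''m'' (Num 0)) ;;
     set_scalar (v EpsV) (Get ''eps'' (Num 0)) ;;
     par_map (v SrcV) (Get ''src'' idx) ;;
     par_map (v DstV) (Get ''dst'' idx) ;;
     par_map (v WtV) (Get ''wt'' idx)"

text \<open>Scans offer sums and maxima only, so the minimum is obtained from the negated
  weights.\<close>

definition weight_range :: com where
  "weight_range =
     par_map (v TmpV) (arr WtV idx) ;;
     Scan ScanMax (v TmpV) (sc MV) ;;
     set_scalar (v WmaxV) (arr TmpV (sc MV \<^bold>- Num 1)) ;;
     par_map (v TmpV) (Num 0 \<^bold>- arr WtV idx) ;;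
     Scan ScanMax (v TmpV) (sc MV) ;;
     set_scalar (v WminV) (Num 0 \<^bold>- arr TmpV (sc MV \<^bold>- Num 1))"

text \<open>The counter stops at the first \<open>j\<close> with
  \<open>j * \<epsilon> \<ge> 1\<close>, which is \<open>S\<close>. The second conjunct stops
  earlier, once \<open>\<epsilon> ^ j\<close> times the maximum no longer exceeds the minimum:
  \<open>S\<close> steps would not be covered by the logarithm of a small ratio.\<close>

definition bounded_power :: com where
  "bounded_power =
     set_scalar (v PowV) (Num 1) ;;
     While ((sc CntV \<^bold>* sc EpsV \<^bold>< Num 1) \<^bold>* (sc WminV \<^bold>< sc PowV \<^bold>* sc WmaxV))
       (set_scalar (v PowV) (sc PowV \<^bold>* sc EpsV) ;; set_scalar (v CntV) (sc CntV \<^bold>+ Num 1))"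

text \<open>If the inner test succeeds, the power loop was not cut short by the weights, so
  \<open>PowV\<close> is \<open>\<epsilon> ^ S\<close> and \<open>CntV\<close> is \<open>S\<close>.
  If it fails, the ratio is at most the inverse of \<open>PowV\<close>, hence at most
  \<open>f \<epsilon>\<close>, and \<open>A\<close> can run on the original, unmodified
  arrays.\<close>

definition main :: com where
  "main =
     copy_input ;;
     Cond (Num 0 \<^bold>< sc MV)
       (weight_range ;; bounded_power ;;
        Cond (sc WminV \<^bold>< sc PowV \<^bold>* sc WmaxV) all_shifts (snd A))
       Skip"

lemma io_in_X [simp]:
  "''n'' \<in> set X" "''m'' \<in> set X" "''eps'' \<in> set X" "''src'' \<in> set X" "''dst'' \<in> set X"
  "''wt'' \<in> set X" "''out'' \<in> set X"
  using io_names by auto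

lemma v_not_io [simp]:
  "v x \<noteq> ''n''" "v x \<noteq> ''m''" "v x \<noteq> ''eps''" "v x \<noteq> ''src''" "v x \<noteq> ''dst''" "v x \<noteq> ''wt''"
  "v x \<noteq> ''out''"
  "''n'' \<noteq> v x" "''m'' \<noteq> v x" "''eps'' \<noteq> v x" "''src'' \<noteq> v x" "''dst'' \<noteq> v x" "''wt'' \<noteq> v x"
  "''out'' \<noteq> v x"
  using v_fresh[of x] io_in_X by metis+

end

section \<open>Prefix sums and compaction\<close>

definition rank :: "(nat \<Rightarrow> bool) \<Rightarrow> nat \<Rightarrow> nat" where
  "rank fl k = length (filter fl [0..<k])"

lemma rank_nth:
  assumes "k < m" "fl k"
  shows "rank fl k < length (filter fl [0..<m])" "filter fl [0..<m] ! rank fl k = k"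
proof -
  have "[0..<m] = [0..<k] @ k # [Suc k..<m]"
    using assms(1) by (metis le_add_same_cancel1 less_imp_le_nat upt_add_eq_append upt_conv_Cons le_Suc_ex zero_le)
  then have "filter fl [0..<m] = filter fl [0..<k] @ k # filter fl [Suc k..<m]" using assms(2) by simp
  then show "rank fl k < length (filter fl [0..<m])" "filter fl [0..<m] ! rank fl k = k"
    by (auto simp: rank_def nth_append)
qed

lemma rank_surj:
  assumes "j < length (filter fl [0..<m])"
  shows "\<exists>k<m. fl k \<and> rank fl k = j"
proof -
  define k where "k = filter fl [0..<m] ! j"
  have "k \<in> set (filter fl [0..<m])" unfolding k_def using assms by (rule nth_mem)
  then have k: "k < m" "fl k" by auto
  have "rank fl k = j"
    using rank_nth[of k m fl, OF k] assms nth_eq_iff_index_eq[of "filter fl [0..<m]" "rank fl k" j]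
    by (simp add: k_def)
  then show ?thesis using k by blast
qed

lemma sum_of_bool_rank: "(\<Sum>j\<le>k. of_bool (fl j)) = (real (rank fl (Suc k)))"
  by (induction k) (auto simp: rank_def)

lemma rank_Suc: "fl k \<Longrightarrow> rank fl (Suc k) = Suc (rank fl k)"
  by (simp add: rank_def)

context cost_units
begin

text \<open>A pass leaves the cells outside the first \<open>m\<close> at arbitrary old contents;
  keeping \<open>g\<close> there allows equations between whole arrays.\<close>

definition patch :: "(int \<Rightarrow> real) \<Rightarrow> (nat \<Rightarrow> real) \<Rightarrow> int \<Rightarrow> real" where
  "patch g f i = (if 0 \<le> i \<and> i < int m then f (nat i) else g i)"

lemma patch_int [simp]: "k < m \<Longrightarrow> patch g f (int k) = f k"
  by (simp add: patch_def)

lemma patch_last [simp]: "0 < m \<Longrightarrow> patch g f (int m - 1) = f (m - 1)"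
  by (simp add: patch_def nat_diff_distrib)

lemma patch_outside: "\<not> (0 \<le> i \<and> i < int m) \<Longrightarrow> patch g f i = g i"
  by (auto simp: patch_def)

lemma patch_patch [simp]: "patch (patch g f) f' = patch g f'"
  by (auto simp: patch_def)

lemma scan_patch:
  "(\<lambda>i. if 0 \<le> i \<and> i < int m then scan_val ScanSum (patch g f) i else patch g f i) =
    patch g (\<lambda>k. \<Sum>j\<le>k. f j)"
  "(\<lambda>i. if 0 \<le> i \<and> i < int m then scan_val ScanMax (patch g f) i else patch g f i) =
    patch g (\<lambda>k. Max (f ` {..k}))"
proof -
  have interval: "{0..i} = int ` {..nat i}" if "0 \<le> i" for i :: int
    using that image_int_atLeastAtMost[of 0 "nat i"] by (simp add: atMost_atLeast0)
  have vals: "patch g f (int j) = f j" if "j \<le> nat i" "0 \<le> i" "i < int m" for i j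
    using that by (intro patch_int) auto
  have "sum (patch g f) {0..i} = sum f {..nat i}" if "0 \<le> i" "i < int m" for i
    unfolding interval[OF that(1)] using vals that by (subst sum.reindex) (auto intro: sum.cong)
  then show "(\<lambda>i. if 0 \<le> i \<and> i < int m then scan_val ScanSum (patch g f) i else patch g f i) =
    patch g (\<lambda>k. \<Sum>j\<le>k. f j)"
    by (intro ext) (auto simp: patch_def)
  have "patch g f ` {0..i} = f ` {..nat i}" if "0 \<le> i" "i < int m" for i
    unfolding interval[OF that(1)] image_image using vals that by (intro image_cong) auto
  then show "(\<lambda>i. if 0 \<le> i \<and> i < int m then scan_val ScanMax (patch g f) i else patch g f i) =
    patch g (\<lambda>k. Max (f ` {..k}))"
    by (intro ext) (auto simp: patch_def)
qed

lemma reach_scan_patch: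
  assumes "s a = patch g f" and "\<lfloor>expr_val s l\<rfloor> = int m" and "expr_cost l \<le> 50"
  shows "reach 1 (Scan ScanSum a l) s (s(a := patch g (\<lambda>k. \<Sum>j\<le>k. f j)))"
    and "reach 1 (Scan ScanMax a l) s (s(a := patch g (\<lambda>k. Max (f ` {..k}))))"
  using reach_Scan[OF assms(2,3), of ScanSum a] reach_Scan[OF assms(2,3), of ScanMax a]
  unfolding assms(1) scan_patch by auto

end

section \<open>Correctness and cost of the reduction\<close>

text \<open>\<open>subrun\<close> states that a call of \<open>A\<close> on any bucket also costs a
  single unit, so that passes and calls are counted together. \<open>R\<close> is the value of
  \<open>f\<close> at \<epsilon>.\<close>

locale reduction_run = reduction A X v + cost_units "fst A" m U V
  for A X v m U V +
  fixes N :: nat and E :: "nat set set" and w :: "nat set \<Rightarrow> real" and es :: "(nat \<times> nat) list"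
    and \<epsilon> R :: real
  assumes eps: "0 < \<epsilon>" "\<epsilon> < 1 / 2" and graph: "weighted_graph N E w" and lists: "lists_edges es E"
    and R: "R = (1 / \<epsilon>) ^ nat \<lceil>1 / \<epsilon>\<rceil>"
    and m: "m = length es" and X_le: "length X \<le> U" "length X \<le> V"
    and subrun: "\<And>E' es'. E' \<subseteq> E \<Longrightarrow> lists_edges es' E' \<Longrightarrow> edge_weight_ratio E' w \<le> R \<Longrightarrow>
      \<exists>t. reach 1 (snd A) (input_store N es' w \<epsilon>) t \<and>
        approx_max_weight_matching (1 + \<epsilon>) E' w (output_edges es' t)"
begin

definition ed :: "nat \<Rightarrow> nat set" where "ed k = edge_of (es ! k)"

lemma ed_eq: "ed k = {fst (es ! k), snd (es ! k)}"
  by (cases "es ! k") (simp add: ed_def)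

lemma map_edge_of: "map edge_of es = map ed [0..<m]"
  by (rule nth_equalityI) (auto simp: ed_def m)

lemma E_eq: "E = ed ` {..<m}"
  using lists unfolding lists_edges_def map_edge_of by (simp add: atLeast0LessThan)

lemma inj_ed: "inj_on ed {..<m}"
  using lists unfolding lists_edges_def map_edge_of by (simp add: distinct_map atLeast0LessThan)

lemma ed_eq_iff: "k < m \<Longrightarrow> l < m \<Longrightarrow> ed k = ed l \<longleftrightarrow> k = l"
  using inj_ed by (auto simp: inj_on_def)

lemma finite_E: "finite E"
  by (simp add: E_eq)

lemma w_pos: "e \<in> E \<Longrightarrow> 0 < w e"
  using graph by (simp add: weighted_graph_def)

lemma card_edge: "e \<in> E \<Longrightarrow> card e = 2"
  using graph unfolding weighted_graph_def by auto

lemma reach_set_scalar: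
  "expr_cost e \<le> 40 \<Longrightarrow> expr_val s e = x \<Longrightarrow> reach 1 (set_scalar a e) s (s(a := (s a)(0 := x)))"
  unfolding set_scalar_def using reach_Put[of "Num 0" e a s] by simp

lemma reach_par_map:
  assumes "s (v MV) 0 = real m" and "v IdxV \<noteq> a" and "expr_cost e \<le> 40"
    and "\<And>k. k < m \<Longrightarrow> expr_val (s(v IdxV := scalar (real k))) e = f k"
  shows "reach 1 (par_map a e) s (s(a := patch (s a) f))"
  unfolding par_map_def
proof (rule reach_par_put)
  fix j assume "\<And>k. k < m \<Longrightarrow> expr_val (s(v IdxV := scalar (real k))) (Num 1) \<noteq> 0 \<Longrightarrow>
    \<lfloor>expr_val (s(v IdxV := scalar (real k))) idx\<rfloor> \<noteq> j"
  then have "int k \<noteq> j" if "k < m" for k using that by auto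
  then have "\<not> (0 \<le> j \<and> j < int m)" using zero_le_imp_eq_int[of j] by (metis of_nat_less_iff)
  then show "patch (s a) f j = s a j" by (rule patch_outside)
qed (use assms in auto)

lemma call_frame:
  assumes "reach 1 (snd A) s t" and "\<And>a. a \<in> set X \<Longrightarrow> s' a = s a"
  shows "reach 1 (snd A) s' (\<lambda>a. if a \<in> set X then t a else s' a)"
  using assms(1) exec_frame[OF _ names_main names_procs, of s t _ _ s'] assms(2)
  unfolding reach_def by blast


definition holds_input :: "store \<Rightarrow> bool" where
  "holds_input s \<longleftrightarrow> s (v NV) 0 = real N \<and> s (v MV) 0 = real m \<and> s (v EpsV) 0 = \<epsilon> \<and>
     (\<forall>k<m. s (v SrcV) (int k) = real (fst (es ! k)) \<and> s (v DstV) (int k) = real (snd (es ! k)) \<and>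
       s (v WtV) (int k) = w (ed k))"

lemma holds_inputD:
  assumes "holds_input s"
  shows "s (v NV) 0 = real N" "s (v MV) 0 = real m" "s (v EpsV) 0 = \<epsilon>"
    "k < m \<Longrightarrow> s (v SrcV) (int k) = real (fst (es ! k))"
    "k < m \<Longrightarrow> s (v DstV) (int k) = real (snd (es ! k))"
    "k < m \<Longrightarrow> s (v WtV) (int k) = w (ed k)"
  using assms by (auto simp: holds_input_def)

lemma holds_input_cong:
  "holds_input s \<Longrightarrow> (\<And>x. x \<in> {NV, MV, EpsV, SrcV, DstV, WtV} \<Longrightarrow> t (v x) = s (v x)) \<Longrightarrow> holds_input t"
  unfolding holds_input_def by simp

text \<open>\<open>rank\<close> numbers the flagged indices bijectively, so every position of the
  compacted list is written exactly once; beyond its end \<open>list_array\<close> is 0, which is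
  why the target array has to be zeroed.\<close>

lemma reach_compact:
  assumes "s (v MV) 0 = real m" and "a \<in> set X" and zero: "s a = (\<lambda>_. 0)"
    and flag: "\<And>k. k < m \<Longrightarrow> s (v FlagV) (int k) = of_bool (fl k)"
    and pos: "\<And>k. k < m \<Longrightarrow> s (v PosV) (int k) = real (rank fl (Suc k))"
    and x: "x \<noteq> IdxV" "\<And>k. k < m \<Longrightarrow> s (v x) (int k) = g (es ! k)"
  shows "reach 1 (compact a x) s
    (s(a := list_array (map g (map ((!) es) (filter fl [0..<m])))))"
  unfolding compact_def
proof (rule reach_par_put)
  let ?h = "list_array (map g (map ((!) es) (filter fl [0..<m])))"
  let ?s = "\<lambda>k. s(v IdxV := scalar (real k))"
  have fl: "fl k" and index: "\<lfloor>expr_val (?s k) (arr PosV idx \<^bold>- Num 1)\<rfloor> = int (rank fl k)"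
    if "k < m" "expr_val (?s k) (arr FlagV idx) \<noteq> 0" for k
  proof -
    show "fl k" using that flag by simp
    then show "\<lfloor>expr_val (?s k) (arr PosV idx \<^bold>- Num 1)\<rfloor> = int (rank fl k)"
      using that pos by (simp add: rank_Suc)
  qed
  show "?h \<lfloor>expr_val (?s k) (arr PosV idx \<^bold>- Num 1)\<rfloor> = expr_val (?s k) (arr x idx)"
    if k: "k < m" "expr_val (?s k) (arr FlagV idx) \<noteq> 0" for k
    unfolding index[OF k] using rank_nth[of k m fl, OF k(1) fl[OF k]] x k by (simp add: list_array_def)
  show "?h j = s a j" if unwritten: "\<And>k. k < m \<Longrightarrow> expr_val (?s k) (arr FlagV idx) \<noteq> 0 \<Longrightarrow>
    \<lfloor>expr_val (?s k) (arr PosV idx \<^bold>- Num 1)\<rfloor> \<noteq> j" for j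
  proof (rule ccontr)
    assume "?h j \<noteq> s a j"
    then have j: "0 \<le> j" "j < int (length (filter fl [0..<m]))"
      by (auto simp: zero list_array_def split: if_splits)
    then obtain k where k: "k < m" "fl k" "rank fl k = nat j"
      using rank_surj[of "nat j" fl m] by (auto simp: nat_less_iff)
    then have "expr_val (?s k) (arr FlagV idx) \<noteq> 0" using flag by simp
    then show False using unwritten[OF k(1)] index[OF k(1)] k j by auto
  qed
qed (use assms in \<open>auto\<close>)

lemma solve_flagged_correct:
  assumes input: "holds_input s" and "0 < m"
    and flag: "\<And>k. k < m \<Longrightarrow> s (v FlagV) (int k) = of_bool (fl k)"
    and pos: "\<And>k. k < m \<Longrightarrow> s (v PosV) (int k) = real (rank fl (Suc k))"
    and ratio: "edge_weight_ratio (ed ` {k. k < m \<and> fl k}) w \<le> R"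
  shows "runs 9 solve_flagged s (\<lambda>t. \<exists>sel.
    approx_max_weight_matching (1 + \<epsilon>) (ed ` {k. k < m \<and> fl k}) w (ed ` {k. k < m \<and> sel k \<noteq> 0}) \<and>
    t = s(v SelV := patch (s (v SelV)) sel))"
proof -
  define es' where "es' = map ((!) es) (filter fl [0..<m])"
  define E' where "E' = ed ` {k. k < m \<and> fl k}"
  have map_es': "map edge_of es' = map ed (filter fl [0..<m])" by (simp add: es'_def ed_def)
  have "lists_edges es' E'"
    unfolding lists_edges_def map_es' E'_def
    by (auto simp: distinct_map intro: inj_on_subset[OF inj_ed])
  moreover have "E' \<subseteq> E" by (auto simp: E'_def E_eq)
  ultimately obtain tA where tA: "reach 1 (snd A) (input_store N es' w \<epsilon>) tA"
    and approx: "approx_max_weight_matching (1 + \<epsilon>) E' w (output_edges es' tA)"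
    using subrun ratio unfolding E'_def by blast
  define u0 where "u0 = (\<lambda>a. if a \<in> set X then (\<lambda>_. 0) else s a)"
  have u0_v [simp]: "u0 (v x) = s (v x)" for x by (simp add: u0_def)
  have u0_X: "u0 a = (\<lambda>_. 0)" if "a \<in> set X" for a using that by (simp add: u0_def)
  note in_s = holds_inputD[OF input]
  define u1 where "u1 = u0(''n'' := scalar (real N))"
  define u2 where "u2 = u1(''eps'' := scalar \<epsilon>)"
  define u3 where "u3 = u2(''m'' := scalar (real (length es')))"
  define u4 where "u4 = u3(''src'' := list_array (map (real \<circ> fst) es'))"
  define u5 where "u5 = u4(''dst'' := list_array (map (real \<circ> snd) es'))"
  define u6 where "u6 = u5(''wt'' := list_array (map (w \<circ> edge_of) es'))"
  note u_defs = u6_def u5_def u4_def u3_def u2_def u1_def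
  have len: "real (rank fl (Suc (m - 1))) = real (length es')"
    using \<open>0 < m\<close> by (simp add: rank_def es'_def)
  have last: "expr_val u2 (arr PosV (sc MV \<^bold>- Num 1)) = real (length es')"
  proof -
    have "\<lfloor>real m - 1\<rfloor> = int (m - 1)" using \<open>0 < m\<close> by (simp add: of_nat_diff)
    then show ?thesis using \<open>0 < m\<close> in_s pos[of "m - 1"] len by (simp add: u_defs)
  qed
  have 1: "reach 1 (set_scalar ''n'' (sc NV)) u0 u1"
    using reach_set_scalar[of "sc NV" u0 "real N" "''n''"] in_s
    by (simp add: u1_def u0_X scalar_def)
  have 2: "reach 1 (set_scalar ''eps'' (sc EpsV)) u1 u2"
    using reach_set_scalar[of "sc EpsV" u1 \<epsilon> "''eps''"] in_s
    by (simp add: u2_def u1_def u0_X scalar_def)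
  have 3: "reach 1 (set_scalar ''m'' (arr PosV (sc MV \<^bold>- Num 1))) u2 u3"
    using reach_set_scalar[OF _ last, of "''m''"]
    by (simp add: u3_def u2_def u1_def u0_X scalar_def)
  have 4: "reach 1 (compact ''src'' SrcV) u3 u4"
    using reach_compact[of u3 "''src''" fl SrcV "real \<circ> fst"] in_s flag pos
    unfolding u4_def es'_def[symmetric] by (simp add: u3_def u2_def u1_def u0_X)
  have 5: "reach 1 (compact ''dst'' DstV) u4 u5"
    using reach_compact[of u4 "''dst''" fl DstV "real \<circ> snd"] in_s flag pos
    unfolding u5_def es'_def[symmetric] by (simp add: u4_def u3_def u2_def u1_def u0_X)
  have 6: "reach 1 (compact ''wt'' WtV) u5 u6"
    using reach_compact[of u5 "''wt''" fl WtV "w \<circ> edge_of"] in_s flag pos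
    unfolding u6_def es'_def[symmetric] by (simp add: u5_def u4_def u3_def u2_def u1_def u0_X ed_def)
  \<comment> \<open>The frame rule needs agreement on \<open>X\<close> only; there the freshly
    zeroed arrays have now become the input for the bucket.\<close>
  have "u6 a = input_store N es' w \<epsilon> a" if "a \<in> set X" for a
    unfolding input_store_def u_defs using that by (simp add: u0_X)
  then have 7: "reach 1 (snd A) u6 (\<lambda>a. if a \<in> set X then tA a else u6 a)" (is "reach 1 _ _ ?u7")
    by (rule call_frame[OF tA])
  define sel where "sel k = of_bool (fl k) * tA ''out'' (int (rank fl (Suc k)) - 1)" for k
  have u7_v: "?u7 (v x) = s (v x)" for x by (simp add: u_defs)
  have 8: "reach 1 (par_map (v SelV) (arr FlagV idx \<^bold>* Get ''out'' (arr PosV idx \<^bold>- Num 1))) ?u7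
      (?u7(v SelV := patch (?u7 (v SelV)) sel))"
  proof (rule reach_par_map)
    fix k assume "k < m"
    then have "\<lfloor>real (rank fl (Suc k)) - 1\<rfloor> = int (rank fl (Suc k)) - 1" by linarith
    then show "expr_val (?u7(v IdxV := scalar (real k)))
        (arr FlagV idx \<^bold>* Get ''out'' (arr PosV idx \<^bold>- Num 1)) = sel k"
      using \<open>k < m\<close> flag pos u7_v[of FlagV] u7_v[of PosV] by (simp add: sel_def)
  qed (use u7_v[of MV] in_s in auto)
  have sel_iff: "sel k \<noteq> 0 \<longleftrightarrow> fl k \<and> tA ''out'' (int (rank fl k)) \<noteq> 0" for k
    by (auto simp: sel_def rank_Suc)
  have out: "output_edges es' tA = ed ` {k. k < m \<and> sel k \<noteq> 0}"
  proof -
    have 1: "\<exists>j<length es'. e = edge_of (es' ! j) \<and> tA ''out'' (int j) \<noteq> 0"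
      if "k < m" "sel k \<noteq> 0" "e = ed k" for k e
      using that rank_nth[of k m fl] unfolding sel_iff
      by (intro exI[of _ "rank fl k"]) (auto simp: es'_def ed_def)
    have 2: "\<exists>k<m. sel k \<noteq> 0 \<and> edge_of (es' ! j) = ed k"
      if j: "j < length es'" "tA ''out'' (int j) \<noteq> 0" for j
    proof -
      obtain k where "k < m" "fl k" "rank fl k = j" using rank_surj[of j fl m] j by (auto simp: es'_def)
      then show ?thesis using j rank_nth[of k m fl]
        by (intro exI[of _ k]) (auto simp: sel_iff es'_def ed_def)
    qed
    show ?thesis
    proof (intro equalityI subsetI)
      fix e assume "e \<in> output_edges es' tA"
      then obtain j where "e = edge_of (es' ! j)" "j < length es'" "tA ''out'' (int j) \<noteq> 0"
        unfolding output_edges_def by blast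
      then show "e \<in> ed ` {k. k < m \<and> sel k \<noteq> 0}" using 2 by blast
    next
      fix e assume "e \<in> ed ` {k. k < m \<and> sel k \<noteq> 0}"
      then show "e \<in> output_edges es' tA" using 1 unfolding output_edges_def by blast
    qed
  qed
  have all: "reach 8 (set_scalar ''n'' (sc NV) ;; set_scalar ''eps'' (sc EpsV) ;;
     set_scalar ''m'' (arr PosV (sc MV \<^bold>- Num 1)) ;;
     compact ''src'' SrcV ;; compact ''dst'' DstV ;; compact ''wt'' WtV ;; snd A ;;
     par_map (v SelV) (arr FlagV idx \<^bold>* Get ''out'' (arr PosV idx \<^bold>- Num 1))) u0
     (?u7(v SelV := patch (?u7 (v SelV)) sel))"
    by (rule reach_mono[OF reach_Seq[OF 1 reach_Seq[OF 2 reach_Seq[OF 3 reach_Seq[OF 4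
      reach_Seq[OF 5 reach_Seq[OF 6 reach_Seq[OF 7 8]]]]]]]]) simp
  have final: "(\<lambda>a. if a \<in> set X then s a else (?u7(v SelV := patch (?u7 (v SelV)) sel)) a) =
      s(v SelV := patch (s (v SelV)) sel)"
    by (rule ext) (auto simp: u_defs u0_def)
  have "runs (Suc 8) solve_flagged s (\<lambda>t. \<exists>sel.
    approx_max_weight_matching (1 + \<epsilon>) E' w (ed ` {k. k < m \<and> sel k \<noteq> 0}) \<and>
    t = s(v SelV := patch (s (v SelV)) sel))"
    unfolding solve_flagged_def
  proof (rule runs_locals[OF X_le])
    show "runs 8 (set_scalar ''n'' (sc NV) ;; set_scalar ''eps'' (sc EpsV) ;;
     set_scalar ''m'' (arr PosV (sc MV \<^bold>- Num 1)) ;;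
     compact ''src'' SrcV ;; compact ''dst'' DstV ;; compact ''wt'' WtV ;; snd A ;;
     par_map (v SelV) (arr FlagV idx \<^bold>* Get ''out'' (arr PosV idx \<^bold>- Num 1)))
     (\<lambda>a. if a \<in> set X then (\<lambda>_. 0) else s a)
     (\<lambda>t. \<exists>sel. approx_max_weight_matching (1 + \<epsilon>) E' w (ed ` {k. k < m \<and> sel k \<noteq> 0}) \<and>
       (\<lambda>a. if a \<in> set X then s a else t a) = s(v SelV := patch (s (v SelV)) sel))"
      using all unfolding u0_def[symmetric]
      by (rule runsI) (use approx final in \<open>auto simp only: out\<close>)
  qed
  then show ?thesis by (simp add: E'_def)
qed

end

lemma sum_le_sum_cover:
  fixes w :: "'a \<Rightarrow> real"
  assumes "finite A" "finite B" "Z \<subseteq> A \<union> B" "\<And>e. e \<in> A \<union> B \<Longrightarrow> 0 \<le> w e"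
  shows "sum w Z \<le> sum w A + sum w B"
proof -
  have "sum w Z \<le> sum w (A \<union> B)" using assms by (intro sum_mono2) auto
  moreover have "sum w (A \<union> B) + sum w (A \<inter> B) = sum w A + sum w B"
    using assms by (intro sum.union_inter) auto
  moreover have "0 \<le> sum w (A \<inter> B)" using assms by (intro sum_nonneg) auto
  ultimately show ?thesis by linarith
qed

section \<open>One bucket: merging its matching into the chosen edges\<close>

context reduction_run
begin

text \<open>The marks are exactly 0 or 1, since \<open>merge\<close> and \<open>keep_best\<close>
  calculate with them.\<close>

definition chosen :: "store \<Rightarrow> nat set set \<Rightarrow> bool" where
  "chosen s F \<longleftrightarrow> F \<subseteq> E \<and> (\<forall>k<m. s (v CandV) (int k) = of_bool (ed k \<in> F)) \<and>
     (\<forall>u::nat. s (v UsedV) (int u) = of_bool (u \<in> \<Union>F))"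

lemma merge_correct:
  assumes input: "holds_input s" and F: "chosen s F" and M: "M \<subseteq> E"
    and sel: "\<And>k. k < m \<Longrightarrow> s (v SelV) (int k) \<noteq> 0 \<longleftrightarrow> ed k \<in> M"
  shows "runs 3 merge s (\<lambda>t. chosen t (F \<union> {e\<in>M. e \<inter> \<Union>F = {}}) \<and>
    (\<forall>a. a \<noteq> v CandV \<and> a \<noteq> v UsedV \<longrightarrow> t a = s a))"
proof -
  define F' where "F' = F \<union> {e\<in>M. e \<inter> \<Union>F = {}}"
  note in_s = holds_inputD[OF input]
  have F_E: "F \<subseteq> E" and cand: "\<And>k. k < m \<Longrightarrow> s (v CandV) (int k) = of_bool (ed k \<in> F)"
    and used: "\<And>u. s (v UsedV) (int u) = of_bool (u \<in> \<Union>F)"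
    using F by (auto simp: chosen_def)
  have F'_E: "F' \<subseteq> E" using F_E M by (auto simp: F'_def)
  define s1 where "s1 = s(v CandV := patch (s (v CandV)) (\<lambda>k. of_bool (ed k \<in> F')))"
  define u2 where "u2 i = (if \<exists>k<m. ed k \<in> F' \<and> i = int (fst (es ! k)) then 1 else s (v UsedV) i)" for i
  define s2 where "s2 = s1(v UsedV := u2)"
  define u3 where "u3 i = (if \<exists>k<m. ed k \<in> F' \<and> i = int (snd (es ! k)) then 1 else u2 i)" for i
  define s3 where "s3 = s2(v UsedV := u3)"
  let ?c = "arr SelV idx \<^bold>* ((Num 1 \<^bold>- arr UsedV (arr SrcV idx)) \<^bold>* (Num 1 \<^bold>- arr UsedV (arr DstV idx)))"
  have cond: "expr_val (s(v IdxV := scalar (real k))) ?c \<noteq> 0 \<longleftrightarrow> ed k \<in> M \<and> ed k \<inter> \<Union>F = {}"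
    if "k < m" for k
    using that in_s used sel by (auto simp: ed_eq)
  have 1: "reach 1 (par_put (v IdxV) (sc MV) ?c (v CandV) idx (Num 1)) s s1"
    unfolding s1_def
  proof (rule reach_par_put)
    fix k assume k: "k < m" "expr_val (s(v IdxV := scalar (real k))) ?c \<noteq> 0"
    then have "ed k \<in> F'" using cond[OF k(1)] by (auto simp: F'_def)
    then show "patch (s (v CandV)) (\<lambda>k. of_bool (ed k \<in> F')) \<lfloor>expr_val (s(v IdxV := scalar (real k))) idx\<rfloor> =
        expr_val (s(v IdxV := scalar (real k))) (Num 1)"
      using k by simp
  next
    fix j assume unwritten: "\<And>k. k < m \<Longrightarrow> expr_val (s(v IdxV := scalar (real k))) ?c \<noteq> 0 \<Longrightarrow>
      \<lfloor>expr_val (s(v IdxV := scalar (real k))) idx\<rfloor> \<noteq> j"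
    show "patch (s (v CandV)) (\<lambda>k. of_bool (ed k \<in> F')) j = s (v CandV) j"
    proof (cases "0 \<le> j \<and> j < int m")
      case True
      then obtain k where k: "j = int k" "k < m" using zero_le_imp_eq_int[of j] by auto
      then have "\<not> (ed k \<in> M \<and> ed k \<inter> \<Union>F = {})" using unwritten[OF k(2)] cond[OF k(2)] by auto
      then have "ed k \<in> F' \<longleftrightarrow> ed k \<in> F" by (auto simp: F'_def)
      then show ?thesis using k cand by simp
    qed (rule patch_outside)
  qed (use in_s in auto)
  have 2: "reach 1 (par_put (v IdxV) (sc MV) (arr CandV idx) (v UsedV) (arr SrcV idx) (Num 1)) s1 s2"
    unfolding s2_def
  proof (rule reach_par_put)
    fix k assume k: "k < m" "expr_val (s1(v IdxV := scalar (real k))) (arr CandV idx) \<noteq> 0"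
    then show "u2 \<lfloor>expr_val (s1(v IdxV := scalar (real k))) (arr SrcV idx)\<rfloor> =
        expr_val (s1(v IdxV := scalar (real k))) (Num 1)"
      using in_s by (auto simp: s1_def u2_def)
  next
    fix j assume unwritten: "\<And>k. k < m \<Longrightarrow> expr_val (s1(v IdxV := scalar (real k))) (arr CandV idx) \<noteq> 0 \<Longrightarrow>
      \<lfloor>expr_val (s1(v IdxV := scalar (real k))) (arr SrcV idx)\<rfloor> \<noteq> j"
    then have "\<not> (\<exists>k<m. ed k \<in> F' \<and> j = int (fst (es ! k)))" using in_s by (auto simp: s1_def)
    then show "u2 j = s1 (v UsedV) j" by (auto simp: u2_def s1_def)
  qed (use in_s in \<open>auto simp: s1_def\<close>)
  have 3: "reach 1 (par_put (v IdxV) (sc MV) (arr CandV idx) (v UsedV) (arr DstV idx) (Num 1)) s2 s3"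
    unfolding s3_def
  proof (rule reach_par_put)
    fix k assume k: "k < m" "expr_val (s2(v IdxV := scalar (real k))) (arr CandV idx) \<noteq> 0"
    then show "u3 \<lfloor>expr_val (s2(v IdxV := scalar (real k))) (arr DstV idx)\<rfloor> =
        expr_val (s2(v IdxV := scalar (real k))) (Num 1)"
      using in_s by (auto simp: s2_def s1_def u3_def)
  next
    fix j assume unwritten: "\<And>k. k < m \<Longrightarrow> expr_val (s2(v IdxV := scalar (real k))) (arr CandV idx) \<noteq> 0 \<Longrightarrow>
      \<lfloor>expr_val (s2(v IdxV := scalar (real k))) (arr DstV idx)\<rfloor> \<noteq> j"
    then have "\<not> (\<exists>k<m. ed k \<in> F' \<and> j = int (snd (es ! k)))" using in_s by (auto simp: s2_def s1_def)
    then show "u3 j = s2 (v UsedV) j" by (auto simp: u3_def s2_def)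
  qed (use in_s in \<open>auto simp: s2_def s1_def\<close>)
  have "u3 (int u) = of_bool (u \<in> \<Union>F')" for u
  proof (cases "u \<in> \<Union>F'")
    case True
    then obtain k where "k < m" "ed k \<in> F'" "u \<in> ed k" using F'_E unfolding E_eq by blast
    then show ?thesis using True by (auto simp: u3_def u2_def ed_eq)
  next
    case False
    then have "\<not> (\<exists>k<m. ed k \<in> F' \<and> (u = fst (es ! k) \<or> u = snd (es ! k)))" by (auto simp: ed_eq)
    moreover have "u \<notin> \<Union>F" using False by (auto simp: F'_def)
    ultimately show ?thesis using False used by (auto simp: u3_def u2_def)
  qed
  then have "chosen s3 F'"
    using F'_E unfolding chosen_def by (simp add: s3_def s2_def s1_def)
  moreover have "s3 a = s a" if "a \<noteq> v CandV" "a \<noteq> v UsedV" for a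
    using that by (simp add: s3_def s2_def s1_def)
  moreover have "reach 3 merge s s3"
    unfolding merge_def by (rule reach_mono[OF reach_Seq[OF 1 reach_Seq[OF 2 3]]]) simp
  ultimately show ?thesis by (auto intro: runsI simp: F'_def)
qed

definition scratch :: "string set" where
  "scratch = v ` {FlagV, PosV, SelV, CandV, UsedV, QV, TmpV}"

definition agrees :: "store \<Rightarrow> store \<Rightarrow> bool" where
  "agrees t s \<longleftrightarrow> (\<forall>a. a \<notin> scratch \<longrightarrow> t a = s a)"

lemma agrees_v: "agrees t s \<Longrightarrow> x \<notin> {FlagV, PosV, SelV, CandV, UsedV, QV, TmpV} \<Longrightarrow> t (v x) = s (v x)"
  by (auto simp: agrees_def scratch_def)

lemma agrees_trans: "agrees u t \<Longrightarrow> agrees t s \<Longrightarrow> agrees u s"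
  by (simp add: agrees_def)

lemma agrees_input: "agrees t s \<Longrightarrow> holds_input s \<Longrightarrow> holds_input t"
  by (erule holds_input_cong) (auto intro!: agrees_v)

lemma bucket_round_correct:
  assumes input: "holds_input s" and "0 < m" and F: "chosen s F"
    and q: "s (v QV) 0 = q" and p: "s (v PowV) 0 = p"
    and E': "E' = {e\<in>E. q < w e \<and> \<not> q * \<epsilon> < w e * p}" and ratio: "edge_weight_ratio E' w \<le> R"
  shows "runs 16 bucket_round s (\<lambda>t. \<exists>M. approx_max_weight_matching (1 + \<epsilon>) E' w M \<and>
    chosen t (F \<union> {e\<in>M. e \<inter> \<Union>F = {}}) \<and> t (v QV) 0 = q * p \<and> agrees t s)"
proof -
  note in_s = holds_inputD[OF input]
  define fl where "fl k \<longleftrightarrow> q < w (ed k) \<and> \<not> q * \<epsilon> < w (ed k) * p" for k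
  define s1 where "s1 = s(v FlagV := patch (s (v FlagV)) (\<lambda>k. of_bool (fl k)))"
  define s2 where "s2 = s1(v PosV := patch (s (v PosV)) (\<lambda>k. of_bool (fl k)))"
  define s3 where "s3 = s2(v PosV := patch (s (v PosV)) (\<lambda>k. real (rank fl (Suc k))))"
  have 1: "reach 1 (par_map (v FlagV)
      ((sc QV \<^bold>< arr WtV idx) \<^bold>* (Num 1 \<^bold>- (sc QV \<^bold>* sc EpsV \<^bold>< arr WtV idx \<^bold>* sc PowV)))) s s1"
    unfolding s1_def by (rule reach_par_map) (use in_s q p in \<open>auto simp: fl_def\<close>)
  have 2: "reach 1 (par_map (v PosV) (arr FlagV idx)) s1 s2"
  proof -
    have "reach 1 (par_map (v PosV) (arr FlagV idx)) s1
        (s1(v PosV := patch (s1 (v PosV)) (\<lambda>k. of_bool (fl k))))"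
      by (rule reach_par_map) (use in_s in \<open>auto simp: s1_def\<close>)
    then show ?thesis by (simp add: s2_def s1_def)
  qed
  have 3: "reach 1 (Scan ScanSum (v PosV) (sc MV)) s2 s3"
  proof -
    have "reach 1 (Scan ScanSum (v PosV) (sc MV)) s2
        (s2(v PosV := patch (s (v PosV)) (\<lambda>k. \<Sum>j\<le>k. of_bool (fl j))))"
      by (rule reach_scan_patch(1)) (use in_s in \<open>auto simp: s2_def s1_def\<close>)
    then show ?thesis unfolding sum_of_bool_rank s3_def .
  qed
  have E'_ed: "ed ` {k. k < m \<and> fl k} = E'" by (auto simp: E' E_eq fl_def)
  have input3: "holds_input s3"
    by (rule holds_input_cong[OF input]) (auto simp: s3_def s2_def s1_def)
  have 4: "runs 9 solve_flagged s3 (\<lambda>t. \<exists>sel.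
    approx_max_weight_matching (1 + \<epsilon>) E' w (ed ` {k. k < m \<and> sel k \<noteq> 0}) \<and>
    t = s3(v SelV := patch (s3 (v SelV)) sel))"
    using solve_flagged_correct[OF input3 \<open>0 < m\<close>, of fl] ratio unfolding E'_ed
    by (simp add: s3_def s2_def s1_def)
  then obtain sel where r4: "reach 9 solve_flagged s3 (s3(v SelV := patch (s3 (v SelV)) sel))"
    and approx: "approx_max_weight_matching (1 + \<epsilon>) E' w (ed ` {k. k < m \<and> sel k \<noteq> 0})"
    unfolding runs_def by blast
  define s4 where "s4 = s3(v SelV := patch (s3 (v SelV)) sel)"
  define M where "M = ed ` {k. k < m \<and> sel k \<noteq> 0}"
  have input4: "holds_input s4" by (rule holds_input_cong[OF input3]) (auto simp: s4_def)
  have chosen4: "chosen s4 F" using F by (simp add: chosen_def s4_def s3_def s2_def s1_def)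
  have M_E: "M \<subseteq> E" by (auto simp: M_def E_eq)
  have sel_M: "s4 (v SelV) (int k) \<noteq> 0 \<longleftrightarrow> ed k \<in> M" if "k < m" for k
    using that ed_eq_iff by (auto simp: s4_def M_def)
  obtain s5 where r5: "reach 3 merge s4 s5" and chosen5: "chosen s5 (F \<union> {e\<in>M. e \<inter> \<Union>F = {}})"
    and frame5: "\<And>a. a \<noteq> v CandV \<Longrightarrow> a \<noteq> v UsedV \<Longrightarrow> s5 a = s4 a"
    using merge_correct[OF input4 chosen4 M_E sel_M] unfolding runs_def by blast
  define s6 where "s6 = s5(v QV := (s5 (v QV))(0 := q * p))"
  have "expr_val s5 (sc QV \<^bold>* sc PowV) = q * p"
    using q p by (simp add: frame5 s4_def s3_def s2_def s1_def)
  then have r6: "reach 1 (set_scalar (v QV) (sc QV \<^bold>* sc PowV)) s5 s6"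
    unfolding s6_def by (intro reach_set_scalar) auto
  have "chosen s6 (F \<union> {e\<in>M. e \<inter> \<Union>F = {}})" using chosen5 by (simp add: chosen_def s6_def)
  moreover have "agrees s6 s"
    unfolding agrees_def scratch_def using frame5 by (auto simp: s6_def s4_def s3_def s2_def s1_def)
  moreover have "reach 16 bucket_round s s6"
    unfolding bucket_round_def
    by (rule reach_mono[OF reach_Seq[OF 1 reach_Seq[OF 2 reach_Seq[OF 3 reach_Seq[OF
      r4[folded s4_def] reach_Seq[OF r5 r6]]]]]]) simp
  moreover have "s6 (v QV) 0 = q * p" by (simp add: s6_def)
  ultimately show ?thesis using approx unfolding M_def[symmetric] runs_def by blast
qed

section \<open>Bucket geometry and the number of rounds\<close>

definition S :: nat where "S = nat \<lceil>1 / \<epsilon>\<rceil>"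
definition wmax :: real where "wmax = Max (w ` E)"
definition wmin :: real where "wmin = Min (w ` E)"

lemma S_eps: "1 \<le> real S * \<epsilon>"
proof -
  have "1 / \<epsilon> \<le> real S" unfolding S_def using eps by (simp add: of_nat_ceiling)
  then show ?thesis using eps by (simp add: field_simps)
qed

lemma S_ge: "2 \<le> S"
proof (rule ccontr)
  assume "\<not> 2 \<le> S"
  then have "real S * \<epsilon> \<le> 1 * \<epsilon>" using eps by (intro mult_right_mono) auto
  then show False using S_eps eps by linarith
qed

text \<open>Consecutive bucket thresholds differ by the factor \<open>\<epsilon> ^ S\<close>; 1/4 is
  the decrease that \<open>greedy_merge_potential\<close> asks for, and \<open>S \<ge> 2\<close>
  supplies it.\<close>

lemma power_S_le: "\<epsilon> ^ S \<le> 1 / 4"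
proof -
  have "\<epsilon> ^ S \<le> \<epsilon> ^ 2" using eps S_ge by (intro power_decreasing) auto
  also have "\<dots> \<le> (1 / 2) ^ 2" using eps by (intro power_mono) auto
  finally show ?thesis by (simp add: power2_eq_square)
qed

lemma R_eq: "R * \<epsilon> ^ S = 1"
  using eps by (simp add: R S_def power_divide)

lemma R_ge: "3 \<le> R"
proof -
  have "R * (1 / 4) \<ge> R * \<epsilon> ^ S" using power_S_le eps by (intro mult_left_mono) (auto simp: R)
  then show ?thesis using R_eq by simp
qed

lemma weight_bounds: "e \<in> E \<Longrightarrow> wmin \<le> w e \<and> w e \<le> wmax"
  using finite_E by (simp add: wmin_def wmax_def)

lemma wmin_pos: "0 < m \<Longrightarrow> 0 < wmin \<and> wmin \<le> wmax"
proof -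
  assume "0 < m"
  then have "E \<noteq> {}" by (auto simp: E_eq)
  then have "wmin \<in> w ` E" using finite_E by (simp add: wmin_def)
  then show ?thesis using w_pos weight_bounds by auto
qed

lemma bucket_ratio:
  assumes "0 < q"
  shows "edge_weight_ratio {e\<in>E. q < w e \<and> \<not> q * \<epsilon> < w e * \<epsilon> ^ S} w \<le> R"
proof (rule edge_weight_ratio_le[where l = q])
  fix e assume "e \<in> {e\<in>E. q < w e \<and> \<not> q * \<epsilon> < w e * \<epsilon> ^ S}"
  then have e: "q < w e" "w e * \<epsilon> ^ S \<le> q * \<epsilon>" by auto
  have "w e = R * (w e * \<epsilon> ^ S)" using R_eq by (simp add: mult.left_commute)
  also have "\<dots> \<le> R * (q * \<epsilon>)" using e R_ge by (intro mult_left_mono) auto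
  also have "\<dots> \<le> R * q" using assms eps R_ge by (intro mult_left_mono) auto
  finally show "q \<le> w e \<and> w e \<le> R * q" using e by simp
qed (use assms finite_E R_ge in auto)

text \<open>Round \<open>j\<close> is entered only if \<open>wmin * \<epsilon> ^ S \<le> wmax *
  \<epsilon> ^ (i + j * S) * \<epsilon>\<close>. Bounding \<open>\<epsilon> ^ (i + 1)\<close> by 1
  leaves \<open>j - 1\<close> at most the quotient, and the strict bound required by
  \<open>runs_While\<close> turns the 1 into 2.\<close>

definition sweeps :: nat where
  "sweeps = nat \<lfloor>log (1 / \<epsilon>) (wmax / wmin) / real S\<rfloor> + 2"

lemma sweep_terminates:
  assumes "0 < m" and "\<not> wmax * \<epsilon> ^ (i + j * S) * \<epsilon> < wmin * \<epsilon> ^ S"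
  shows "j < sweeps"
proof -
  let ?a = "1 / \<epsilon>" and ?r = "wmax / wmin"
  have a: "1 < ?a" using eps by simp
  have r: "0 < ?r" using wmin_pos[OF assms(1)] by simp
  have w: "0 < wmin" "0 < wmax" using wmin_pos[OF assms(1)] by auto
  have "wmin * \<epsilon> ^ S \<le> wmax * \<epsilon> ^ (i + j * S) * \<epsilon>" using assms(2) by simp
  also have "\<dots> = wmax * \<epsilon> ^ (j * S) * \<epsilon> ^ Suc i" by (simp add: power_add)
  also have "\<dots> \<le> wmax * \<epsilon> ^ (j * S) * 1"
    using eps w by (intro mult_left_mono power_le_one) auto
  finally have "?a ^ (j * S) \<le> ?r * ?a ^ S"
    using eps w by (simp add: field_simps power_divide)
  then have "log ?a (?a ^ (j * S)) \<le> log ?a (?r * ?a ^ S)"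
    using a eps w by (subst log_le_cancel_iff) simp_all
  also have "log ?a (?r * ?a ^ S) = log ?a ?r + real S"
    using a r w eps by (subst log_mult) (auto simp: log_pow_cancel)
  also have "log ?a (?a ^ (j * S)) = real (j * S)" using a eps by (subst log_pow_cancel) auto
  finally have "real j * real S \<le> log ?a ?r + real S" by simp
  then have "real j - 1 \<le> log ?a ?r / real S"
    using S_ge by (simp add: field_simps)
  then have "int j - 1 \<le> \<lfloor>log ?a ?r / real S\<rfloor>" by (simp add: le_floor_iff)
  then show ?thesis unfolding sweeps_def by linarith
qed

section \<open>The sweep over all buckets of one shift\<close>

context
  fixes lev :: "nat set \<Rightarrow> nat"
  assumes lev: "\<forall>e\<in>E. \<forall>k. w e \<le> wmax * \<epsilon> ^ k \<longleftrightarrow> k \<le> lev e"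
begin

text \<open>Adding \<open>S\<close> to the level avoids the difference \<open>k - S\<close>, which
  truncates; for \<open>k < S\<close> both sides are true.\<close>

lemma lev_shifted:
  assumes "e \<in> E"
  shows "w e * \<epsilon> ^ S \<le> wmax * \<epsilon> ^ k \<longleftrightarrow> k \<le> lev e + S"
proof (cases "S \<le> k")
  case True
  then obtain l where k: "k = S + l" using le_Suc_ex by blast
  have split: "wmax * \<epsilon> ^ k = wmax * \<epsilon> ^ l * \<epsilon> ^ S" by (simp add: k power_add)
  have "w e * \<epsilon> ^ S \<le> wmax * \<epsilon> ^ k \<longleftrightarrow> w e \<le> wmax * \<epsilon> ^ l"
    unfolding split using eps by (intro mult_le_cancel_right_pos) simp
  then show ?thesis using lev assms by (simp add: k)
next
  case False
  have "w e * \<epsilon> ^ S \<le> wmax * \<epsilon> ^ S"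
    using weight_bounds[OF assms] eps by (intro mult_right_mono) auto
  also have "\<dots> \<le> wmax * \<epsilon> ^ k"
    using False eps weight_bounds[OF assms] w_pos[OF assms]
    by (intro mult_left_mono power_decreasing) auto
  finally show ?thesis using False by simp
qed

lemma sweep_correct:
  assumes input: "holds_input s" and "0 < m" and p: "s (v PowV) 0 = \<epsilon> ^ S"
    and wmin: "s (v WminV) 0 = wmin" and q: "s (v QV) 0 = wmax * \<epsilon> ^ i" and "i < S"
    and empty: "chosen s {}" and Opt: "is_matching E Opt"
  shows "runs (sweeps * Suc 16 + 1)
    (While (Num 1 \<^bold>- (sc QV \<^bold>* sc EpsV \<^bold>< sc WminV \<^bold>* sc PowV)) bucket_round) s
    (\<lambda>t. \<exists>F. chosen t F \<and> is_matching E F \<and> agrees t s \<and>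
      sum w {e\<in>Opt. lev e mod S \<noteq> i} \<le> (1 + \<epsilon>) * ((1 + 3 * \<epsilon>) * sum w F))"
proof -
  \<comment> \<open>Before round \<open>j\<close>, the optimum edges of undeleted levels with weight
    above the upper end \<open>T = wmax * \<epsilon> ^ (i + j * S) * \<epsilon> / \<epsilon> ^
    S\<close> of the coming bucket are accounted for, and every chosen edge holds the reserve
    \<open>3 * T\<close>. The level condition carries \<open>+ S\<close> so that it is right, namely
    unsatisfiable, for \<open>j = 0\<close>.\<close>
  define I where "I j t \<longleftrightarrow> t (v QV) 0 = wmax * \<epsilon> ^ (i + j * S) \<and> agrees t s \<and>
    (\<exists>F. chosen t F \<and> is_matching E F \<and>
      sum w {e\<in>Opt. lev e + S < 1 + i + j * S \<and> lev e mod S \<noteq> i} +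
        (1 + \<epsilon>) * (3 * (wmax * \<epsilon> ^ (i + j * S) * \<epsilon> / \<epsilon> ^ S) * real (card F))
      \<le> (1 + \<epsilon>) * ((1 + 3 * \<epsilon>) * sum w F))" for j t
  have wmax: "0 < wmax" using wmin_pos[OF \<open>0 < m\<close>] by simp
  have Opt_E: "Opt \<subseteq> E" and fin: "finite Opt"
    using Opt finite_subset[OF _ finite_E] by (auto simp: is_matching_def)
  let ?b = "Num 1 \<^bold>- (sc QV \<^bold>* sc EpsV \<^bold>< sc WminV \<^bold>* sc PowV)"
  have guard: "expr_val t ?b \<noteq> 0 \<longleftrightarrow> \<not> wmax * \<epsilon> ^ (i + j * S) * \<epsilon> < wmin * \<epsilon> ^ S" if "I j t" for j t
  proof -
    have "t (v QV) 0 = wmax * \<epsilon> ^ (i + j * S)" "agrees t s" using that by (auto simp: I_def)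
    then show ?thesis
      using wmin p holds_inputD(3)[OF input]
      by (simp add: agrees_v[of t s WminV] agrees_v[of t s PowV] agrees_v[of t s EpsV])
  qed
  have "runs (sweeps * Suc 16 + 1) (While ?b bucket_round) s
    (\<lambda>t. \<exists>j\<le>sweeps. I j t \<and> expr_val t ?b = 0)"
  proof (rule runs_While)
    fix j t assume I: "I j t" and "expr_val t ?b \<noteq> 0"
    then have ge: "\<not> wmax * \<epsilon> ^ (i + j * S) * \<epsilon> < wmin * \<epsilon> ^ S" using guard by blast
    define q' where "q' = wmax * \<epsilon> ^ (i + j * S)"
    have q'_pos: "0 < q'" using wmax eps by (simp add: q'_def)
    have agr: "agrees t s" and tq: "t (v QV) 0 = q'" using I by (auto simp: I_def q'_def)
    obtain F where F: "chosen t F" "is_matching E F" and pot: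
      "sum w {e\<in>Opt. lev e + S < 1 + i + j * S \<and> lev e mod S \<noteq> i} +
        (1 + \<epsilon>) * (3 * (q' * \<epsilon> / \<epsilon> ^ S) * real (card F)) \<le> (1 + \<epsilon>) * ((1 + 3 * \<epsilon>) * sum w F)"
      using I by (auto simp: I_def q'_def)
    define E' where "E' = {e\<in>E. q' < w e \<and> \<not> q' * \<epsilon> < w e * \<epsilon> ^ S}"
    have tp: "t (v PowV) 0 = \<epsilon> ^ S" using p agr by (simp add: agrees_v)
    have ratio: "edge_weight_ratio E' w \<le> R" unfolding E'_def by (rule bucket_ratio[OF q'_pos])
    have "runs 16 bucket_round t (I (Suc j))"
    proof (rule runs_mono[OF bucket_round_correct[OF agrees_input[OF agr input] \<open>0 < m\<close> F(1) tq tp E'_def ratio]])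
      fix u assume "\<exists>M. approx_max_weight_matching (1 + \<epsilon>) E' w M \<and>
        chosen u (F \<union> {e\<in>M. e \<inter> \<Union>F = {}}) \<and> u (v QV) 0 = q' * \<epsilon> ^ S \<and> agrees u t"
      then obtain M where M: "approx_max_weight_matching (1 + \<epsilon>) E' w M"
        and chosen_u: "chosen u (F \<union> {e\<in>M. e \<inter> \<Union>F = {}})"
        and uq: "u (v QV) 0 = q' * \<epsilon> ^ S" and agr_u: "agrees u t" by blast
      define F' where "F' = F \<union> {e\<in>M. e \<inter> \<Union>F = {}}"
      have M_E': "is_matching E' M" "M \<subseteq> E'"
        using M by (auto simp: approx_max_weight_matching_def is_matching_def)
      have "M \<subseteq> E" using M_E' by (auto simp: E'_def)
      then have M_E: "is_matching E M" by (rule is_matching_subset[OF M_E'(1) order_refl])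
      have "is_matching E' (Opt \<inter> E')" using Opt by (rule is_matching_subset) auto
      moreover have finE': "finite E'" using finite_E by (simp add: E'_def)
      ultimately have new: "sum w (Opt \<inter> E') \<le> (1 + \<epsilon>) * sum w M"
        using approx_max_weight_matchingD[OF M] by blast
      have "sum w {e\<in>Opt. lev e + S < 1 + i + j * S \<and> lev e mod S \<noteq> i} + sum w (Opt \<inter> E') +
          (1 + \<epsilon>) * (3 * (q' * \<epsilon> / \<epsilon> ^ S * \<epsilon> ^ S) * real (card F'))
          \<le> (1 + \<epsilon>) * ((1 + 3 * \<epsilon>) * sum w F')"
      \<comment> \<open>Here \<open>T\<close> is the upper end of the bucket and
        \<open>p = \<epsilon> ^ S\<close>, so \<open>p * T = q' * \<epsilon>\<close>; the two weight
        conditions of the lemma are the two conditions that define the bucket.\<close>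
      proof (rule greedy_merge_potential[OF M_E finite_E card_edge F(2) eps(1) _ power_S_le _ _ _ pot new F'_def])
        show "w e \<le> q' * \<epsilon> / \<epsilon> ^ S" if "e \<in> M" for e
          using that M_E'(2) eps by (auto simp: E'_def field_simps)
        show "\<epsilon> ^ S * (q' * \<epsilon> / \<epsilon> ^ S) \<le> \<epsilon> * w e" if "e \<in> M" for e
          using that M_E'(2) eps by (auto simp: E'_def)
      qed (use eps q'_pos in auto)
      moreover have "sum w {e\<in>Opt. lev e + S < 1 + i + Suc j * S \<and> lev e mod S \<noteq> i} \<le>
          sum w {e\<in>Opt. lev e + S < 1 + i + j * S \<and> lev e mod S \<noteq> i} + sum w (Opt \<inter> E')"
      proof (rule sum_le_sum_cover)
        show "{e\<in>Opt. lev e + S < 1 + i + Suc j * S \<and> lev e mod S \<noteq> i} \<subseteq>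
          {e\<in>Opt. lev e + S < 1 + i + j * S \<and> lev e mod S \<noteq> i} \<union> (Opt \<inter> E')"
        proof
          fix e assume "e \<in> {e\<in>Opt. lev e + S < 1 + i + Suc j * S \<and> lev e mod S \<noteq> i}"
          then have e: "e \<in> Opt" "lev e \<le> i + j * S" "lev e mod S \<noteq> i" "e \<in> E" using Opt_E by auto
          \<comment> \<open>Here the deletion enters: level \<open>i + j * S\<close> has weights at
            most \<open>q'\<close> and would fall below the bucket.\<close>
          have "lev e \<noteq> i + j * S" using e(3) \<open>i < S\<close> by auto
          then have "lev e < i + j * S" using e(2) by simp
          then have low: "q' < w e" using lev e(4) by (metis q'_def not_le)
          have "w e * \<epsilon> ^ S \<le> wmax * \<epsilon> ^ (1 + i + j * S) \<longleftrightarrow> 1 + i + j * S \<le> lev e + S"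
            by (rule lev_shifted[OF e(4)])
          moreover have "wmax * \<epsilon> ^ (1 + i + j * S) = q' * \<epsilon>" by (simp add: q'_def)
          ultimately have "\<not> q' * \<epsilon> < w e * \<epsilon> ^ S \<longleftrightarrow> \<not> lev e + S < 1 + i + j * S" by linarith
          then show "e \<in> {e\<in>Opt. lev e + S < 1 + i + j * S \<and> lev e mod S \<noteq> i} \<union> (Opt \<inter> E')"
            using e low by (auto simp: E'_def)
        qed
      qed (use fin Opt_E w_pos in \<open>auto intro: less_imp_le\<close>)
      moreover have next_q: "q' * \<epsilon> ^ S = wmax * \<epsilon> ^ (i + Suc j * S)"
        by (simp add: q'_def power_add)
      moreover have "q' * \<epsilon> / \<epsilon> ^ S * \<epsilon> ^ S = (q' * \<epsilon> ^ S) * \<epsilon> / \<epsilon> ^ S" using eps by simp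
      ultimately have "sum w {e\<in>Opt. lev e + S < 1 + i + Suc j * S \<and> lev e mod S \<noteq> i} +
          (1 + \<epsilon>) * (3 * (wmax * \<epsilon> ^ (i + Suc j * S) * \<epsilon> / \<epsilon> ^ S) * real (card F'))
          \<le> (1 + \<epsilon>) * ((1 + 3 * \<epsilon>) * sum w F')"
        by simp
      moreover have "is_matching E F'" unfolding F'_def by (rule greedy_merge_matching[OF F(2) M_E])
      moreover have "u (v QV) 0 = wmax * \<epsilon> ^ (i + Suc j * S)" using uq next_q by simp
      ultimately show "I (Suc j) u"
        unfolding I_def using agrees_trans[OF agr_u agr] chosen_u[folded F'_def]
        by (intro conjI exI[of _ F'])
    qed simp
    then show "j < sweeps \<and> runs 16 bucket_round t (I (Suc j))"
      using sweep_terminates[OF \<open>0 < m\<close> ge] by blast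
  next
    have none: "{e \<in> Opt. lev e + S < 1 + i + 0 * S \<and> lev e mod S \<noteq> i} = {}" using \<open>i < S\<close> by auto
    have "agrees s s" by (simp add: agrees_def)
    moreover have "is_matching E {}" by (simp add: is_matching_def)
    ultimately show "I 0 s" unfolding I_def none using q empty by (auto intro!: exI[of _ "{}"])
  qed simp
  then show ?thesis
  proof (rule runs_mono)
    fix t assume "\<exists>j\<le>sweeps. I j t \<and> expr_val t ?b = 0"
    then obtain j where I: "I j t" and "expr_val t ?b = 0" by blast
    then have less: "wmax * \<epsilon> ^ (i + j * S) * \<epsilon> < wmin * \<epsilon> ^ S" using guard by blast
    obtain F where F: "chosen t F" "is_matching E F" and pot:
      "sum w {e\<in>Opt. lev e + S < 1 + i + j * S \<and> lev e mod S \<noteq> i} +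
        (1 + \<epsilon>) * (3 * (wmax * \<epsilon> ^ (i + j * S) * \<epsilon> / \<epsilon> ^ S) * real (card F))
        \<le> (1 + \<epsilon>) * ((1 + 3 * \<epsilon>) * sum w F)"
      using I by (auto simp: I_def)
    \<comment> \<open>On exit the minimum weight exceeds the upper end of the bucket, so every
      undeleted optimum edge is accounted for.\<close>
    have "lev e + S < 1 + i + j * S" if "e \<in> Opt" for e
    proof -
      have e: "e \<in> E" using that Opt_E by auto
      have "wmin * \<epsilon> ^ S \<le> w e * \<epsilon> ^ S" using weight_bounds[OF e] eps by (intro mult_right_mono) auto
      then have "\<not> w e * \<epsilon> ^ S \<le> wmax * \<epsilon> ^ (1 + i + j * S)" using less by (simp add: mult_ac)
      then show ?thesis unfolding lev_shifted[OF e] by (simp only: not_le)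
    qed
    then have "{e\<in>Opt. lev e + S < 1 + i + j * S \<and> lev e mod S \<noteq> i} = {e\<in>Opt. lev e mod S \<noteq> i}" by auto
    moreover have "0 \<le> (1 + \<epsilon>) * (3 * (wmax * \<epsilon> ^ (i + j * S) * \<epsilon> / \<epsilon> ^ S) * real (card F))"
      using eps wmax by simp
    ultimately have "sum w {e\<in>Opt. lev e mod S \<noteq> i} \<le> (1 + \<epsilon>) * ((1 + 3 * \<epsilon>) * sum w F)"
      using pot by simp
    then show "\<exists>F. chosen t F \<and> is_matching E F \<and> agrees t s \<and>
      sum w {e\<in>Opt. lev e mod S \<noteq> i} \<le> (1 + \<epsilon>) * ((1 + 3 * \<epsilon>) * sum w F)"
      using F I by (auto simp: I_def)
  qed simp
qed

end


section \<open>Keeping the best matching and preparing the input\<close>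

definition marked :: "store \<Rightarrow> nat set set \<Rightarrow> bool" where
  "marked s G \<longleftrightarrow> G \<subseteq> E \<and> (\<forall>k<m. s ''out'' (int k) = of_bool (ed k \<in> G)) \<and> s (v BestV) 0 = sum w G"

lemma output_edges_marked:
  assumes "marked s G" shows "output_edges es s = G"
proof -
  have out: "s ''out'' (int k) \<noteq> 0 \<longleftrightarrow> ed k \<in> G" if "k < m" for k
    using assms that by (simp add: marked_def)
  have "G \<subseteq> ed ` {..<m}" using assms unfolding marked_def E_eq[symmetric] by simp
  then have "G = {ed k | k. k < m \<and> ed k \<in> G}" by blast
  also have "\<dots> = output_edges es s"
    unfolding output_edges_def m[symmetric] ed_def[symmetric] using out by blast
  finally show ?thesis ..
qed

lemma sum_selected:
  assumes "F \<subseteq> E" and "0 < m"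
  shows "(\<Sum>j\<le>m - 1. of_bool (ed j \<in> F) * w (ed j)) = sum w F"
proof -
  have "{..m - 1} = {..<m}" using assms(2) by auto
  then have "(\<Sum>j\<le>m - 1. of_bool (ed j \<in> F) * w (ed j)) = (\<Sum>j<m. of_bool (ed j \<in> F) * w (ed j))"
    by simp
  also have "\<dots> = (\<Sum>e\<in>E. of_bool (e \<in> F) * w e)"
    unfolding E_eq by (simp add: sum.reindex[OF inj_ed])
  also have "\<dots> = (\<Sum>e\<in>F. of_bool (e \<in> F) * w e)"
    using assms(1) finite_E by (intro sum.mono_neutral_right) auto
  also have "\<dots> = sum w F" by (rule sum.cong) auto
  finally show ?thesis .
qed

lemma keep_best_correct:
  assumes input: "holds_input s" and "0 < m" and F: "chosen s F" and G: "marked s G"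
  shows "runs 5 keep_best s (\<lambda>t. \<exists>G'. marked t G' \<and> (G' = F \<or> G' = G) \<and>
    sum w F \<le> sum w G' \<and> sum w G \<le> sum w G' \<and>
    (\<forall>a. a \<noteq> v TmpV \<and> a \<noteq> v BestV \<and> a \<noteq> ''out'' \<longrightarrow> t a = s a))"
proof -
  note in_s = holds_inputD[OF input]
  have F_E: "F \<subseteq> E" and cand: "\<And>k. k < m \<Longrightarrow> s (v CandV) (int k) = of_bool (ed k \<in> F)"
    using F by (auto simp: chosen_def)
  define f where "f k = of_bool (ed k \<in> F) * w (ed k)" for k
  define s1 where "s1 = s(v TmpV := patch (s (v TmpV)) f)"
  define s2 where "s2 = s1(v TmpV := patch (s (v TmpV)) (\<lambda>k. \<Sum>j\<le>k. f j))"
  have 1: "reach 1 (par_map (v TmpV) (arr CandV idx \<^bold>* arr WtV idx)) s s1"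
    unfolding s1_def by (rule reach_par_map) (use in_s cand in \<open>auto simp: f_def\<close>)
  have 2: "reach 1 (Scan ScanSum (v TmpV) (sc MV)) s1 s2"
    unfolding s2_def by (rule reach_scan_patch(1)) (use in_s in \<open>auto simp: s1_def\<close>)
  have total: "t (v TmpV) \<lfloor>t (v MV) 0 - 1\<rfloor> = sum w F"
    if "t (v TmpV) = s2 (v TmpV)" "t (v MV) = s (v MV)" for t
    using that in_s sum_selected[OF F_E \<open>0 < m\<close>] \<open>0 < m\<close> by (simp add: s2_def f_def)
  define s3 where "s3 = s2(''out'' := patch (s2 ''out'') (\<lambda>k. of_bool (ed k \<in> F)))"
  define s4 where "s4 = s3(v BestV := (s3 (v BestV))(0 := sum w F))"
  have 3: "reach 1 (par_map ''out'' (arr CandV idx)) s2 s3"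
    unfolding s3_def by (rule reach_par_map) (use in_s cand in \<open>auto simp: s2_def s1_def\<close>)
  have 4: "reach 1 (set_scalar (v BestV) (arr TmpV (sc MV \<^bold>- Num 1))) s3 s4"
    unfolding s4_def by (rule reach_set_scalar) (use total[of s3] in \<open>auto simp: s3_def s2_def s1_def\<close>)
  have best: "s2 (v BestV) 0 = sum w G" using G by (simp add: marked_def s2_def s1_def)
  have total2: "expr_val s2 (arr TmpV (sc MV \<^bold>- Num 1)) = sum w F"
    using total[of s2] by (simp add: s2_def s1_def)
  have "runs (1 + (1 + Suc 2)) keep_best s (\<lambda>t. \<exists>G'. marked t G' \<and> (G' = F \<or> G' = G) \<and>
    sum w F \<le> sum w G' \<and> sum w G \<le> sum w G' \<and>
    (\<forall>a. a \<noteq> v TmpV \<and> a \<noteq> v BestV \<and> a \<noteq> ''out'' \<longrightarrow> t a = s a))" (is "runs _ _ _ ?Q")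
    unfolding keep_best_def
  proof (rule runs_Seq_reach[OF 1 runs_Seq_reach[OF 2]])
    show "runs (Suc 2) (Cond (sc BestV \<^bold>< arr TmpV (sc MV \<^bold>- Num 1))
        (par_map ''out'' (arr CandV idx) ;; set_scalar (v BestV) (arr TmpV (sc MV \<^bold>- Num 1))) Skip) s2 ?Q"
    proof (rule runs_Cond)
      assume "expr_val s2 (sc BestV \<^bold>< arr TmpV (sc MV \<^bold>- Num 1)) \<noteq> 0"
      then have less: "sum w G < sum w F" using best total2 by (simp split: if_splits)
      have "marked s4 F" using F_E by (simp add: marked_def s4_def s3_def)
      moreover have "s4 a = s a" if "a \<noteq> v TmpV" "a \<noteq> v BestV" "a \<noteq> ''out''" for a
        using that by (simp add: s4_def s3_def s2_def s1_def)
      ultimately have "?Q s4" using less by (intro exI[of _ F]) auto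
      then show "runs 2 (par_map ''out'' (arr CandV idx) ;;
          set_scalar (v BestV) (arr TmpV (sc MV \<^bold>- Num 1))) s2 ?Q"
        by (rule runsI[OF reach_mono[OF reach_Seq[OF 3 4]], rotated]) simp
    next
      assume "expr_val s2 (sc BestV \<^bold>< arr TmpV (sc MV \<^bold>- Num 1)) = 0"
      then have ge: "sum w F \<le> sum w G" using best total2 by (simp split: if_splits)
      have "marked s2 G" using G by (simp add: marked_def s2_def s1_def)
      moreover have "s2 a = s a" if "a \<noteq> v TmpV" for a using that by (simp add: s2_def s1_def)
      ultimately have "?Q s2" using ge by (intro exI[of _ G]) auto
      then show "runs 2 Skip s2 ?Q" by (intro runsI[OF reach_mono[OF reach_Skip]]) simp_all
    qed simp
  qed
  then show ?thesis by simp
qed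

lemma copy_input_correct:
  "runs 6 copy_input (input_store N es w \<epsilon>) (\<lambda>t. holds_input t \<and>
    (\<forall>a. a \<notin> v ` {NV, MV, EpsV, SrcV, DstV, WtV} \<longrightarrow> t a = input_store N es w \<epsilon> a))"
proof -
  define s0 where "s0 = input_store N es w \<epsilon>"
  define s1 where "s1 = s0(v NV := (s0 (v NV))(0 := real N))"
  define s2 where "s2 = s1(v MV := (s1 (v MV))(0 := real m))"
  define s3 where "s3 = s2(v EpsV := (s2 (v EpsV))(0 := \<epsilon>))"
  define s4 where "s4 = s3(v SrcV := patch (s3 (v SrcV)) (\<lambda>k. real (fst (es ! k))))"
  define s5 where "s5 = s4(v DstV := patch (s4 (v DstV)) (\<lambda>k. real (snd (es ! k))))"
  define s6 where "s6 = s5(v WtV := patch (s5 (v WtV)) (\<lambda>k. w (ed k)))"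
  have 1: "reach 1 (set_scalar (v NV) (Get ''n'' (Num 0))) s0 s1"
    unfolding s1_def by (rule reach_set_scalar) (auto simp: s0_def input_store_def)
  have 2: "reach 1 (set_scalar (v MV) (Get ''m'' (Num 0))) s1 s2"
    unfolding s2_def by (rule reach_set_scalar) (auto simp: s1_def s0_def input_store_def m)
  have 3: "reach 1 (set_scalar (v EpsV) (Get ''eps'' (Num 0))) s2 s3"
    unfolding s3_def by (rule reach_set_scalar) (auto simp: s2_def s1_def s0_def input_store_def)
  have 4: "reach 1 (par_map (v SrcV) (Get ''src'' idx)) s3 s4"
    unfolding s4_def by (rule reach_par_map)
      (auto simp: s3_def s2_def s1_def s0_def input_store_def list_array_def m)
  have 5: "reach 1 (par_map (v DstV) (Get ''dst'' idx)) s4 s5"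
    unfolding s5_def by (rule reach_par_map)
      (auto simp: s4_def s3_def s2_def s1_def s0_def input_store_def list_array_def m)
  have 6: "reach 1 (par_map (v WtV) (Get ''wt'' idx)) s5 s6"
    unfolding s6_def by (rule reach_par_map)
      (auto simp: s5_def s4_def s3_def s2_def s1_def s0_def input_store_def list_array_def m ed_def)
  have "holds_input s6" by (auto simp: holds_input_def s6_def s5_def s4_def s3_def s2_def s1_def)
  moreover have "s6 a = s0 a" if "a \<notin> v ` {NV, MV, EpsV, SrcV, DstV, WtV}" for a
    using that by (simp add: s6_def s5_def s4_def s3_def s2_def s1_def)
  moreover have "reach 6 copy_input s0 s6"
    unfolding copy_input_def
    by (rule reach_mono[OF reach_Seq[OF 1 reach_Seq[OF 2 reach_Seq[OF 3 reach_Seq[OF 4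
      reach_Seq[OF 5 6]]]]]]) simp
  ultimately show ?thesis unfolding runs_def s0_def[symmetric] by blast
qed

lemma weight_range_correct:
  assumes input: "holds_input s" and "0 < m"
  shows "runs 6 weight_range s (\<lambda>t. t (v WmaxV) 0 = wmax \<and> t (v WminV) 0 = wmin \<and>
    (\<forall>a. a \<notin> v ` {TmpV, WmaxV, WminV} \<longrightarrow> t a = s a))"
proof -
  note in_s = holds_inputD[OF input]
  have E_atMost: "E = ed ` {..m - 1}" "E \<noteq> {}"
    using \<open>0 < m\<close> by (auto simp: E_eq intro!: image_eqI)
  have max: "Max ((\<lambda>k. w (ed k)) ` {..m - 1}) = wmax"
    unfolding wmax_def by (subst E_atMost(1)) (simp add: image_image)
  have min: "Max ((\<lambda>k. 0 - w (ed k)) ` {..m - 1}) = - wmin"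
  proof -
    have "(\<lambda>k. 0 - w (ed k)) ` {..m - 1} = uminus ` (w ` E)"
      by (subst E_atMost(1)) (simp add: image_image)
    then show ?thesis unfolding wmin_def
      using minus_Min_eq_Max[of "w ` E"] finite_E E_atMost(2) by simp
  qed
  define g where "g = s (v TmpV)"
  define s1 where "s1 = s(v TmpV := patch g (\<lambda>k. w (ed k)))"
  define s2 where "s2 = s1(v TmpV := patch g (\<lambda>k. Max ((\<lambda>k. w (ed k)) ` {..k})))"
  define s3 where "s3 = s2(v WmaxV := (s2 (v WmaxV))(0 := wmax))"
  define s4 where "s4 = s3(v TmpV := patch (s3 (v TmpV)) (\<lambda>k. 0 - w (ed k)))"
  define s5 where "s5 = s4(v TmpV := patch g (\<lambda>k. Max ((\<lambda>k. 0 - w (ed k)) ` {..k})))"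
  define s6 where "s6 = s5(v WminV := (s5 (v WminV))(0 := wmin))"
  have 1: "reach 1 (par_map (v TmpV) (arr WtV idx)) s s1"
    unfolding s1_def g_def by (rule reach_par_map) (use in_s in auto)
  have 2: "reach 1 (Scan ScanMax (v TmpV) (sc MV)) s1 s2"
    unfolding s2_def by (rule reach_scan_patch(2)) (use in_s in \<open>auto simp: s1_def\<close>)
  have "expr_val s2 (arr TmpV (sc MV \<^bold>- Num 1)) = wmax"
    using in_s \<open>0 < m\<close> max by (simp add: s2_def s1_def)
  then have 3: "reach 1 (set_scalar (v WmaxV) (arr TmpV (sc MV \<^bold>- Num 1))) s2 s3"
    unfolding s3_def by (intro reach_set_scalar) auto
  have 4: "reach 1 (par_map (v TmpV) (Num 0 \<^bold>- arr WtV idx)) s3 s4"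
    unfolding s4_def by (rule reach_par_map) (use in_s in \<open>auto simp: s3_def s2_def s1_def\<close>)
  have 5: "reach 1 (Scan ScanMax (v TmpV) (sc MV)) s4 s5"
    unfolding s5_def by (rule reach_scan_patch(2)) (use in_s in \<open>auto simp: s4_def s3_def s2_def s1_def\<close>)
  have "expr_val s5 (Num 0 \<^bold>- arr TmpV (sc MV \<^bold>- Num 1)) = wmin"
    using in_s \<open>0 < m\<close> min by (simp add: s5_def s4_def s3_def s2_def s1_def)
  then have 6: "reach 1 (set_scalar (v WminV) (Num 0 \<^bold>- arr TmpV (sc MV \<^bold>- Num 1))) s5 s6"
    unfolding s6_def by (intro reach_set_scalar) auto
  have "reach 6 weight_range s s6"
    unfolding weight_range_def
    by (rule reach_mono[OF reach_Seq[OF 1 reach_Seq[OF 2 reach_Seq[OF 3 reach_Seq[OF 4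
      reach_Seq[OF 5 6]]]]]]) simp
  moreover have "s6 (v WmaxV) 0 = wmax" "s6 (v WminV) 0 = wmin"
    by (simp_all add: s6_def s5_def s4_def s3_def)
  moreover have "s6 a = s a" if "a \<notin> v ` {TmpV, WmaxV, WminV}" for a
    using that by (simp add: s6_def s5_def s4_def s3_def s2_def s1_def)
  ultimately show ?thesis unfolding runs_def by blast
qed

definition levels :: nat where "levels = nat \<lceil>log (1 / \<epsilon>) (wmax / wmin)\<rceil>"

lemma less_log_ratio:
  assumes "0 < m" and "wmin < \<epsilon> ^ j * wmax"
  shows "real j < log (1 / \<epsilon>) (wmax / wmin)"
proof -
  have w: "0 < wmin" "0 < wmax" using wmin_pos[OF assms(1)] by auto
  have "(1 / \<epsilon>) ^ j < wmax / wmin" using assms(2) w eps by (simp add: field_simps power_divide)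
  then have "log (1 / \<epsilon>) ((1 / \<epsilon>) ^ j) < log (1 / \<epsilon>) (wmax / wmin)"
    using eps w by (subst log_less_cancel_iff) simp_all
  then show ?thesis using eps by (subst (asm) log_pow_cancel) auto
qed

lemma bounded_power_correct:
  assumes input: "holds_input s" and "0 < m" and wmax: "s (v WmaxV) 0 = wmax"
    and wmin: "s (v WminV) 0 = wmin" and cnt: "s (v CntV) 0 = 0"
  shows "runs (levels * 3 + 2) bounded_power s (\<lambda>t. \<exists>j\<le>S. t (v PowV) 0 = \<epsilon> ^ j \<and>
    t (v CntV) 0 = real j \<and> (wmin < \<epsilon> ^ j * wmax \<longrightarrow> j = S) \<and>
    (\<forall>a. a \<noteq> v PowV \<and> a \<noteq> v CntV \<longrightarrow> t a = s a))"
proof -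
  define I where "I j t \<longleftrightarrow> j \<le> S \<and> t (v PowV) 0 = \<epsilon> ^ j \<and> t (v CntV) 0 = real j \<and>
    (\<forall>a. a \<noteq> v PowV \<and> a \<noteq> v CntV \<longrightarrow> t a = s a)" for j t
  let ?b = "(sc CntV \<^bold>* sc EpsV \<^bold>< Num 1) \<^bold>* (sc WminV \<^bold>< sc PowV \<^bold>* sc WmaxV)"
  let ?c = "set_scalar (v PowV) (sc PowV \<^bold>* sc EpsV) ;; set_scalar (v CntV) (sc CntV \<^bold>+ Num 1)"
  have vals: "t (v PowV) 0 = \<epsilon> ^ j" "t (v CntV) 0 = real j" "t (v EpsV) 0 = \<epsilon>"
    "t (v WminV) 0 = wmin" "t (v WmaxV) 0 = wmax" if "I j t" for j t
    using that holds_inputD(3)[OF input] wmax wmin by (auto simp: I_def)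
  have guard: "expr_val t ?b \<noteq> 0 \<longleftrightarrow> real j * \<epsilon> < 1 \<and> wmin < \<epsilon> ^ j * wmax" if "I j t" for j t
    using vals[OF that] by simp
  define s1 where "s1 = s(v PowV := (s (v PowV))(0 := 1))"
  have 1: "reach 1 (set_scalar (v PowV) (Num 1)) s s1"
    unfolding s1_def by (rule reach_set_scalar) auto
  have 2: "runs (levels * Suc 2 + 1) (While ?b ?c) s1 (\<lambda>t. \<exists>j\<le>levels. I j t \<and> expr_val t ?b = 0)"
  proof (rule runs_While)
    fix j t assume I: "I j t" and "expr_val t ?b \<noteq> 0"
    then have le: "real j * \<epsilon> < 1" "wmin < \<epsilon> ^ j * wmax" using guard by auto
    have "j < levels" unfolding levels_def using less_log_ratio[OF \<open>0 < m\<close> le(2)] by linarith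
    moreover have "j < S"
    proof (rule ccontr)
      assume "\<not> j < S"
      then have "real S * \<epsilon> \<le> real j * \<epsilon>" using eps by (intro mult_right_mono) auto
      then show False using S_eps le by linarith
    qed
    moreover have "runs 2 ?c t (I (Suc j))"
    proof -
      define t1 where "t1 = t(v PowV := (t (v PowV))(0 := \<epsilon> ^ Suc j))"
      define t2 where "t2 = t1(v CntV := (t1 (v CntV))(0 := real (Suc j)))"
      have "reach 1 (set_scalar (v PowV) (sc PowV \<^bold>* sc EpsV)) t t1"
        unfolding t1_def by (rule reach_set_scalar) (use vals[OF I] in auto)
      moreover have "reach 1 (set_scalar (v CntV) (sc CntV \<^bold>+ Num 1)) t1 t2"
        unfolding t2_def by (rule reach_set_scalar) (use vals[OF I] in \<open>auto simp: t1_def\<close>)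
      ultimately have "reach (1 + 1) ?c t t2" by (rule reach_Seq)
      moreover have "I (Suc j) t2" using I \<open>j < S\<close> by (simp add: I_def t2_def t1_def)
      ultimately show ?thesis by (intro runsI[of _ _ _ t2]) (simp_all add: numeral_2_eq_2)
    qed
    ultimately show "j < levels \<and> runs 2 ?c t (I (Suc j))" by blast
  next
    show "I 0 s1" using cnt by (simp add: I_def s1_def)
  qed simp
  have "runs (1 + (levels * Suc 2 + 1)) bounded_power s (\<lambda>t. \<exists>j\<le>levels. I j t \<and> expr_val t ?b = 0)"
    unfolding bounded_power_def by (rule runs_Seq_reach[OF 1 2])
  then show ?thesis
  proof (rule runs_mono)
    fix t assume "\<exists>j\<le>levels. I j t \<and> expr_val t ?b = 0"
    then obtain j where I: "I j t" and "expr_val t ?b = 0" by blast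
    then have "\<not> (real j * \<epsilon> < 1 \<and> wmin < \<epsilon> ^ j * wmax)" using guard by blast
    moreover have "j = S" if "\<not> real j * \<epsilon> < 1"
    proof -
      have "1 / \<epsilon> \<le> real j" using that eps by (simp add: field_simps)
      then have "S \<le> j" unfolding S_def by (simp add: nat_ceiling_le_eq)
      then show ?thesis using I by (simp add: I_def)
    qed
    ultimately show "\<exists>j\<le>S. t (v PowV) 0 = \<epsilon> ^ j \<and> t (v CntV) 0 = real j \<and>
      (wmin < \<epsilon> ^ j * wmax \<longrightarrow> j = S) \<and> (\<forall>a. a \<noteq> v PowV \<and> a \<noteq> v CntV \<longrightarrow> t a = s a)"
      using I unfolding I_def by blast
  qed simp
qed


lemma sum_w_nonneg: "F \<subseteq> E \<Longrightarrow> 0 \<le> sum w F"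
  by (rule sum_nonneg) (meson less_imp_le subsetD w_pos)

section \<open>Averaging over the shifts\<close>

context
  fixes lev :: "nat set \<Rightarrow> nat" and Opt :: "nat set set"
  assumes lev: "\<forall>e\<in>E. \<forall>k. w e \<le> wmax * \<epsilon> ^ k \<longleftrightarrow> k \<le> lev e" and Opt: "is_matching E Opt"
begin

text \<open>The averaging in additive form: the bounds of the first \<open>i\<close> shifts are
  summed, with the best matching found so far in place of the matching of each shift. Each shift
  loses one residue class of levels, so after \<open>S\<close> shifts the lost classes partition the
  optimum and its weight appears only once on the right.\<close>

definition shift_state :: "nat \<Rightarrow> store \<Rightarrow> bool" where
  "shift_state i s \<longleftrightarrow> holds_input s \<and> s (v PowV) 0 = \<epsilon> ^ S \<and> s (v WminV) 0 = wmin \<and>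
     s (v CntV) 0 = real S \<and> s (v StartV) 0 = wmax * \<epsilon> ^ i \<and> s (v ShiftV) 0 = real i \<and> i \<le> S \<and>
     (\<exists>G. marked s G \<and> is_matching E G \<and>
       real i * sum w Opt \<le> sum w {e\<in>Opt. lev e mod S < i} + real i * ((1 + \<epsilon>) * (1 + 3 * \<epsilon>) * sum w G))"

lemma shift_correct:
  assumes "0 < m" and state: "shift_state i s" and "i < S"
  shows "runs (sweeps * 17 + 10) shift s (shift_state (Suc i))"
proof -
  have input: "holds_input s" and vals: "s (v PowV) 0 = \<epsilon> ^ S" "s (v WminV) 0 = wmin"
    "s (v CntV) 0 = real S" "s (v StartV) 0 = wmax * \<epsilon> ^ i" "s (v ShiftV) 0 = real i"
    using state by (auto simp: shift_state_def)
  obtain G where G: "marked s G" "is_matching E G" and avg: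
    "real i * sum w Opt \<le> sum w {e\<in>Opt. lev e mod S < i} + real i * ((1 + \<epsilon>) * (1 + 3 * \<epsilon>) * sum w G)"
    using state by (auto simp: shift_state_def)
  define L where "L = [v CandV, v UsedV]"
  have L: "length L \<le> U" "length L \<le> V" using U V by (auto simp: L_def)
  define s0 where "s0 = (\<lambda>a. if a \<in> set L then (\<lambda>_. 0) else s a)"
  have s0_v: "s0 (v x) = s (v x)" if "x \<noteq> CandV" "x \<noteq> UsedV" for x
    using that by (simp add: s0_def L_def)
  have s0_other: "s0 a = s a" if "a \<noteq> v CandV" "a \<noteq> v UsedV" for a
    using that by (simp add: s0_def L_def)
  define s1 where "s1 = s0(v QV := (s0 (v QV))(0 := wmax * \<epsilon> ^ i))"
  have 1: "reach 1 (set_scalar (v QV) (sc StartV)) s0 s1"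
    unfolding s1_def by (rule reach_set_scalar) (use vals in \<open>auto simp: s0_v\<close>)
  have input1: "holds_input s1"
    by (rule holds_input_cong[OF input]) (auto simp: s1_def s0_v)
  have chosen1: "chosen s1 {}" by (simp add: chosen_def s1_def s0_def L_def)
  have 2: "runs (sweeps * Suc 16 + 1)
    (While (Num 1 \<^bold>- (sc QV \<^bold>* sc EpsV \<^bold>< sc WminV \<^bold>* sc PowV)) bucket_round) s1
    (\<lambda>t. \<exists>F. chosen t F \<and> is_matching E F \<and> agrees t s1 \<and>
      sum w {e\<in>Opt. lev e mod S \<noteq> i} \<le> (1 + \<epsilon>) * ((1 + 3 * \<epsilon>) * sum w F))"
    by (rule sweep_correct[OF lev input1 \<open>0 < m\<close> _ _ _ \<open>i < S\<close> chosen1 Opt])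
      (use vals in \<open>auto simp: s1_def s0_v\<close>)
  define Q where "Q t \<longleftrightarrow> (\<exists>G'. marked t G' \<and> is_matching E G' \<and> sum w G \<le> sum w G' \<and>
      sum w {e\<in>Opt. lev e mod S \<noteq> i} \<le> (1 + \<epsilon>) * (1 + 3 * \<epsilon>) * sum w G') \<and>
      (\<forall>x. x \<notin> {FlagV, PosV, SelV, CandV, UsedV, QV, TmpV, BestV} \<longrightarrow> t (v x) = s (v x))" for t
  have 3: "runs 5 keep_best t Q" if t: "\<exists>F. chosen t F \<and> is_matching E F \<and> agrees t s1 \<and>
      sum w {e\<in>Opt. lev e mod S \<noteq> i} \<le> (1 + \<epsilon>) * ((1 + 3 * \<epsilon>) * sum w F)" for t
  proof -
    obtain F where F: "chosen t F" "is_matching E F" and agr: "agrees t s1"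
      and le: "sum w {e\<in>Opt. lev e mod S \<noteq> i} \<le> (1 + \<epsilon>) * ((1 + 3 * \<epsilon>) * sum w F)" using t by blast
    have "t ''out'' = s1 ''out''" using agr by (auto simp: agrees_def scratch_def)
    moreover have "s1 ''out'' = s ''out''" by (simp add: s1_def s0_other)
    moreover have "t (v BestV) = s (v BestV)" using agr by (simp add: agrees_v s1_def s0_v)
    ultimately have marked_t: "marked t G" using G(1) unfolding marked_def by simp
    show ?thesis
    proof (rule runs_mono[OF keep_best_correct[OF agrees_input[OF agr input1] \<open>0 < m\<close> F(1) marked_t]])
      fix u assume "\<exists>G'. marked u G' \<and> (G' = F \<or> G' = G) \<and> sum w F \<le> sum w G' \<and> sum w G \<le> sum w G' \<and>
        (\<forall>a. a \<noteq> v TmpV \<and> a \<noteq> v BestV \<and> a \<noteq> ''out'' \<longrightarrow> u a = t a)"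
      then obtain G' where G': "marked u G'" "G' = F \<or> G' = G" "sum w F \<le> sum w G'" "sum w G \<le> sum w G'"
        and frame: "\<And>a. a \<noteq> v TmpV \<Longrightarrow> a \<noteq> v BestV \<Longrightarrow> a \<noteq> ''out'' \<Longrightarrow> u a = t a" by blast
      have "(1 + \<epsilon>) * (1 + 3 * \<epsilon>) * sum w F \<le> (1 + \<epsilon>) * (1 + 3 * \<epsilon>) * sum w G'"
        using G'(3) eps by (intro mult_left_mono) auto
      then have "sum w {e\<in>Opt. lev e mod S \<noteq> i} \<le> (1 + \<epsilon>) * (1 + 3 * \<epsilon>) * sum w G'"
        using le by (simp add: mult.assoc)
      moreover have "is_matching E G'" using G'(2) G(2) F(2) by blast
      moreover have "u (v x) = s (v x)" if "x \<notin> {FlagV, PosV, SelV, CandV, UsedV, QV, TmpV, BestV}" for x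
        using that agr by (simp add: frame agrees_v s1_def s0_v)
      ultimately show "Q u" unfolding Q_def using G' by blast
    qed simp
  qed
  have body: "runs (1 + (sweeps * Suc 16 + 1 + 5)) (set_scalar (v QV) (sc StartV) ;;
     While (Num 1 \<^bold>- (sc QV \<^bold>* sc EpsV \<^bold>< sc WminV \<^bold>* sc PowV)) bucket_round ;; keep_best) s0 Q"
    by (rule runs_Seq_reach[OF 1 runs_Seq[OF 2 3]])
  define Q' where "Q' t \<longleftrightarrow> (\<exists>G'. marked t G' \<and> is_matching E G' \<and> sum w G \<le> sum w G' \<and>
      sum w {e\<in>Opt. lev e mod S \<noteq> i} \<le> (1 + \<epsilon>) * (1 + 3 * \<epsilon>) * sum w G') \<and>
      (\<forall>x\<in>{NV, MV, EpsV, SrcV, DstV, WtV, PowV, WminV, CntV, StartV, ShiftV}. t (v x) = s (v x))" for t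
  have Q_Q': "Q' (\<lambda>a. if a \<in> set L then s a else t a)" if "Q t" for t
  proof -
    have "marked (\<lambda>a. if a \<in> set L then s a else t a) G'" if "marked t G'" for G'
      using that by (simp add: marked_def L_def)
    moreover have "(if v x \<in> set L then s (v x) else t (v x)) = s (v x)"
      if "x \<in> {NV, MV, EpsV, SrcV, DstV, WtV, PowV, WminV, CntV, StartV, ShiftV}" for x
      using that \<open>Q t\<close> unfolding Q_def by auto
    ultimately show ?thesis using \<open>Q t\<close> unfolding Q_def Q'_def by blast
  qed
  have 4: "runs (Suc (1 + (sweeps * Suc 16 + 1 + 5))) (locals L (set_scalar (v QV) (sc StartV) ;;
     While (Num 1 \<^bold>- (sc QV \<^bold>* sc EpsV \<^bold>< sc WminV \<^bold>* sc PowV)) bucket_round ;; keep_best)) s Q'"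
    by (rule runs_locals[OF L], rule runs_mono[OF body[unfolded s0_def]]) (use Q_Q' in auto)
  have 5: "runs (1 + 1) (set_scalar (v StartV) (sc StartV \<^bold>* sc EpsV) ;;
      set_scalar (v ShiftV) (sc ShiftV \<^bold>+ Num 1)) t (shift_state (Suc i))" if Q': "Q' t" for t
  proof -
    have frame: "t (v x) = s (v x)"
      if "x \<in> {NV, MV, EpsV, SrcV, DstV, WtV, PowV, WminV, CntV, StartV, ShiftV}" for x
      using Q' that unfolding Q'_def by blast
    have input_t: "holds_input t" by (rule holds_input_cong[OF input]) (auto intro!: frame)
    obtain G' where G': "marked t G'" "is_matching E G'" "sum w G \<le> sum w G'"
      "sum w {e\<in>Opt. lev e mod S \<noteq> i} \<le> (1 + \<epsilon>) * (1 + 3 * \<epsilon>) * sum w G'"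
      using Q' unfolding Q'_def by blast
    define t1 where "t1 = t(v StartV := (t (v StartV))(0 := wmax * \<epsilon> ^ Suc i))"
    define t2 where "t2 = t1(v ShiftV := (t1 (v ShiftV))(0 := real (Suc i)))"
    have r1: "reach 1 (set_scalar (v StartV) (sc StartV \<^bold>* sc EpsV)) t t1"
      unfolding t1_def
      by (rule reach_set_scalar) (use vals holds_inputD(3)[OF input] in \<open>auto simp: frame\<close>)
    have r2: "reach 1 (set_scalar (v ShiftV) (sc ShiftV \<^bold>+ Num 1)) t1 t2"
      unfolding t2_def by (rule reach_set_scalar) (use vals in \<open>auto simp: frame t1_def\<close>)
    have fin: "finite Opt" using Opt finite_subset[OF _ finite_E] by (auto simp: is_matching_def)
    have "sum w Opt = sum w {e\<in>Opt. lev e mod S \<noteq> i} + sum w {e\<in>Opt. lev e mod S = i}"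
    proof -
      have "Opt = {e\<in>Opt. lev e mod S \<noteq> i} \<union> {e\<in>Opt. lev e mod S = i}" by blast
      then have "sum w Opt = sum w ({e\<in>Opt. lev e mod S \<noteq> i} \<union> {e\<in>Opt. lev e mod S = i})" by simp
      also have "\<dots> = sum w {e\<in>Opt. lev e mod S \<noteq> i} + sum w {e\<in>Opt. lev e mod S = i}"
        using fin by (intro sum.union_disjoint) auto
      finally show ?thesis .
    qed
    moreover have "sum w {e\<in>Opt. lev e mod S < Suc i} =
        sum w {e\<in>Opt. lev e mod S < i} + sum w {e\<in>Opt. lev e mod S = i}"
    proof -
      have "{e\<in>Opt. lev e mod S < Suc i} = {e\<in>Opt. lev e mod S < i} \<union> {e\<in>Opt. lev e mod S = i}"
        by (auto simp: less_Suc_eq)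
      then show ?thesis using fin by (simp add: sum.union_disjoint disjoint_iff)
    qed
    \<comment> \<open>The best weight only grows, so the summands of earlier shifts may be restated
      with \<open>G'\<close>.\<close>
    moreover have "real i * ((1 + \<epsilon>) * (1 + 3 * \<epsilon>) * sum w G) \<le> real i * ((1 + \<epsilon>) * (1 + 3 * \<epsilon>) * sum w G')"
      using G'(3) eps by (intro mult_left_mono) auto
    ultimately have "real i * sum w Opt + sum w Opt \<le> sum w {e\<in>Opt. lev e mod S < Suc i} +
        (real i * ((1 + \<epsilon>) * (1 + 3 * \<epsilon>) * sum w G') + (1 + \<epsilon>) * (1 + 3 * \<epsilon>) * sum w G')"
      using avg G'(4) by linarith
    moreover have "real (Suc i) * x = real i * x + x" for x :: real by (simp add: algebra_simps)
    ultimately have "real (Suc i) * sum w Opt \<le>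
        sum w {e\<in>Opt. lev e mod S < Suc i} + real (Suc i) * ((1 + \<epsilon>) * (1 + 3 * \<epsilon>) * sum w G')"
      by simp
    moreover have "marked t2 G'" using G'(1) by (simp add: marked_def t2_def t1_def)
    moreover have "holds_input t2" by (rule holds_input_cong[OF input_t]) (auto simp: t2_def t1_def)
    moreover have "t2 (v PowV) 0 = \<epsilon> ^ S" "t2 (v WminV) 0 = wmin" "t2 (v CntV) 0 = real S"
      "t2 (v StartV) 0 = wmax * \<epsilon> ^ Suc i" "t2 (v ShiftV) 0 = real (Suc i)"
      using vals by (simp_all add: t2_def t1_def frame)
    ultimately have "shift_state (Suc i) t2"
      unfolding shift_state_def using \<open>i < S\<close> G'(2) by (intro conjI exI[of _ G']) auto
    then show ?thesis using reach_Seq[OF r1 r2] by (intro runsI)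
  qed
  show ?thesis
    unfolding shift_def
    by (rule runs_mono[OF runs_Seq[OF 4[unfolded L_def] 5]]) auto
qed

lemma all_shifts_correct:
  assumes "0 < m" and input: "holds_input s" and vals: "s (v PowV) 0 = \<epsilon> ^ S" "s (v WminV) 0 = wmin"
    "s (v WmaxV) 0 = wmax" "s (v CntV) 0 = real S" "s (v ShiftV) 0 = 0" and empty: "marked s {}"
  shows "runs (S * (sweeps * 17 + 11) + 2) all_shifts s
    (\<lambda>t. is_matching E (output_edges es t) \<and> sum w Opt \<le> (1 + 16 * \<epsilon>) * sum w (output_edges es t))"
proof -
  define s1 where "s1 = s(v StartV := (s (v StartV))(0 := wmax))"
  have 1: "reach 1 (set_scalar (v StartV) (sc WmaxV)) s s1"
    unfolding s1_def by (rule reach_set_scalar) (use vals in auto)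
  have "holds_input s1" by (rule holds_input_cong[OF input]) (auto simp: s1_def)
  moreover have "marked s1 {}" using empty by (simp add: marked_def s1_def)
  moreover have "is_matching E {}" by (simp add: is_matching_def)
  ultimately have state: "shift_state 0 s1"
    unfolding shift_state_def using vals by (intro conjI exI[of _ "{}"]) (auto simp: s1_def)
  have guard: "expr_val t (sc ShiftV \<^bold>< sc CntV) \<noteq> 0 \<longleftrightarrow> i < S" if "shift_state i t" for i t
    using that by (simp add: shift_state_def)
  have 2: "runs (S * Suc (sweeps * 17 + 10) + 1) (While (sc ShiftV \<^bold>< sc CntV) shift) s1
      (\<lambda>t. \<exists>i\<le>S. shift_state i t \<and> expr_val t (sc ShiftV \<^bold>< sc CntV) = 0)"
    by (rule runs_While) (use guard shift_correct[OF \<open>0 < m\<close>] state in auto)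
  have fin: "finite Opt" and Opt_E: "Opt \<subseteq> E"
    using Opt finite_subset[OF _ finite_E] by (auto simp: is_matching_def)
  show ?thesis
    unfolding all_shifts_def
  proof (rule runs_mono[OF runs_Seq_reach[OF 1 2]])
    fix t assume "\<exists>i\<le>S. shift_state i t \<and> expr_val t (sc ShiftV \<^bold>< sc CntV) = 0"
    then obtain i where "i \<le> S" and i: "shift_state i t" and "expr_val t (sc ShiftV \<^bold>< sc CntV) = 0" by blast
    then have "i = S" using guard[OF i] by simp
    then obtain G where G: "marked t G" "is_matching E G" and avg: "real S * sum w Opt \<le>
        sum w {e\<in>Opt. lev e mod S < S} + real S * ((1 + \<epsilon>) * (1 + 3 * \<epsilon>) * sum w G)"
      using i by (auto simp: shift_state_def)
    have "{e\<in>Opt. lev e mod S < S} = Opt" using S_ge by auto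
    then have avg': "real S * sum w Opt \<le> sum w Opt + real S * ((1 + \<epsilon>) * (1 + 3 * \<epsilon>) * sum w G)"
      using avg by simp
    have "0 \<le> sum w G" "0 \<le> sum w Opt"
      using G(1) Opt_E by (auto intro!: sum_w_nonneg simp: marked_def)
    then have "sum w Opt \<le> (1 + 16 * \<epsilon>) * sum w G"
      using S_ge S_eps avg' by (intro approximation_factor[OF eps, of "real S"]) auto
    then show "is_matching E (output_edges es t) \<and> sum w Opt \<le> (1 + 16 * \<epsilon>) * sum w (output_edges es t)"
      using G(2) by (simp add: output_edges_marked[OF G(1)])
  qed simp
qed

end

text \<open>The number of rounds per shift has \<open>S\<close> in its denominator, which cancels
  over all \<open>S\<close> shifts; the remaining \<open>2 * S\<close> is harmless once
  \<open>S\<close> is below the logarithm.\<close>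

lemma sweeps_bound: "0 < m \<Longrightarrow> real S * real sweeps \<le> log (1 / \<epsilon>) (wmax / wmin) + 2 * real S"
proof -
  assume "0 < m"
  let ?l = "log (1 / \<epsilon>) (wmax / wmin)"
  have "1 \<le> wmax / wmin" using wmin_pos[OF \<open>0 < m\<close>] by simp
  then have "0 \<le> ?l" using eps by simp
  then have "real sweeps \<le> ?l / real S + 2" unfolding sweeps_def using S_ge by simp
  then have "real S * real sweeps \<le> real S * (?l / real S + 2)" by (intro mult_left_mono) auto
  also have "\<dots> = ?l + 2 * real S" using S_ge by (simp add: field_simps)
  finally show ?thesis .
qed

theorem main_correct:
  "\<exists>k. runs k main (input_store N es w \<epsilon>)
      (\<lambda>t. approx_max_weight_matching (1 + 16 * \<epsilon>) E w (output_edges es t)) \<and>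
    real k \<le> 100 * log_inv \<epsilon> (edge_weight_ratio E w)"
proof (cases "0 < m")
  case False
  then have E: "E = {}" and es: "es = []" using m by (auto simp: E_eq)
  have "approx_max_weight_matching (1 + 16 * \<epsilon>) E w (output_edges es t)" for t
    by (simp add: E es output_edges_def approx_max_weight_matching_def max_weight_matching_def
      is_matching_def)
  then have "runs (Suc 1) (Cond (Num 0 \<^bold>< sc MV) (weight_range ;; bounded_power ;;
      Cond (sc WminV \<^bold>< sc PowV \<^bold>* sc WmaxV) all_shifts (snd A)) Skip) t
      (\<lambda>t. approx_max_weight_matching (1 + 16 * \<epsilon>) E w (output_edges es t))"
    if "holds_input t" for t
    using holds_inputD(2)[OF that] False
    by (intro runs_Cond) (auto intro!: runsI[OF reach_Skip[unfolded One_nat_def]])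
  then have "runs (6 + Suc 1) main (input_store N es w \<epsilon>)
      (\<lambda>t. approx_max_weight_matching (1 + 16 * \<epsilon>) E w (output_edges es t))"
    unfolding main_def using runs_Seq[OF copy_input_correct] by blast
  then show ?thesis by (intro exI[of _ 8]) (simp add: log_inv_def)
next
  case True
  define r where "r = log (1 / \<epsilon>) (wmax / wmin)"
  obtain lev where lev: "\<forall>e\<in>E. \<forall>k. w e \<le> wmax * \<epsilon> ^ k \<longleftrightarrow> k \<le> lev e"
    using level_exists[of \<epsilon> E w wmax] eps w_pos weight_bounds by auto
  obtain Opt where Opt: "max_weight_matching E w Opt"
    using max_weight_matching_exists[OF finite_E] by blast
  define Q where "Q t \<longleftrightarrow> approx_max_weight_matching (1 + 16 * \<epsilon>) E w (output_edges es t)" for t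
  define K where "K = (if real S < r then S * (sweeps * 17 + 11) + 2 else 1)"
  \<comment> \<open>The shifts are run only if \<open>S < r\<close>; then
    \<open>S * sweeps \<le> r + 2 * S \<le> 3 * r\<close>, and
    \<open>62 = 17 * 3 + 11\<close>.\<close>
  have K: "real K \<le> 2 + 62 * max 1 r"
  proof (cases "real S < r")
    case True
    have "real S * real sweeps \<le> 3 * r" using sweeps_bound[OF \<open>0 < m\<close>] True by (simp add: r_def)
    then have "17 * (real S * real sweeps) + 11 * real S + 2 \<le> 62 * r + 2" using True by linarith
    then show ?thesis using True by (simp add: K_def algebra_simps max_def)
  qed (simp add: K_def)
  have inner: "runs (Suc K) (Cond (sc WminV \<^bold>< sc PowV \<^bold>* sc WmaxV) all_shifts (snd A)) t Q"
    if input: "holds_input t" and range: "t (v WmaxV) 0 = wmax" "t (v WminV) 0 = wmin"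
      and pow: "\<exists>j\<le>S. t (v PowV) 0 = \<epsilon> ^ j \<and> t (v CntV) 0 = real j \<and> (wmin < \<epsilon> ^ j * wmax \<longrightarrow> j = S)"
      and X: "\<And>a. a \<in> set X \<Longrightarrow> t a = input_store N es w \<epsilon> a"
      and zero: "t (v ShiftV) 0 = 0" "t (v BestV) 0 = 0" for t
  proof -
    obtain j where j: "j \<le> S" "t (v PowV) 0 = \<epsilon> ^ j" "t (v CntV) 0 = real j" "wmin < \<epsilon> ^ j * wmax \<longrightarrow> j = S"
      using pow by blast
    show ?thesis
    proof (rule runs_Cond)
      assume "expr_val t (sc WminV \<^bold>< sc PowV \<^bold>* sc WmaxV) \<noteq> 0"
      then have less: "wmin < \<epsilon> ^ j * wmax" using range j by (simp split: if_splits)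
      then have "j = S" using j by blast
      have "real S < r" unfolding r_def by (rule less_log_ratio[OF True less[unfolded \<open>j = S\<close>]])
      have "marked t {}"
        using X[of "''out''"] zero by (simp add: marked_def input_store_def)
      then have "runs (S * (sweeps * 17 + 11) + 2) all_shifts t
        (\<lambda>t. is_matching E (output_edges es t) \<and> sum w Opt \<le> (1 + 16 * \<epsilon>) * sum w (output_edges es t))"
        using j \<open>j = S\<close> range zero input Opt
        by (intro all_shifts_correct[OF lev _ True]) (auto simp: max_weight_matching_def)
      then show "runs K all_shifts t Q"
      proof (rule runs_mono)
        fix u assume u: "is_matching E (output_edges es u) \<and>
          sum w Opt \<le> (1 + 16 * \<epsilon>) * sum w (output_edges es u)"
        have "sum w M' \<le> sum w Opt" if "max_weight_matching E w M'" for M'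
          using that Opt by (auto simp: max_weight_matching_def)
        then show "Q u" unfolding Q_def approx_max_weight_matching_def using u by fastforce
      qed (use \<open>real S < r\<close> in \<open>simp add: K_def\<close>)
    next
      assume "expr_val t (sc WminV \<^bold>< sc PowV \<^bold>* sc WmaxV) = 0"
      then have ge: "\<epsilon> ^ j * wmax \<le> wmin" using range j by (simp split: if_splits)
      have w: "0 < wmin" "0 < wmax" using wmin_pos[OF True] by auto
      \<comment> \<open>Whatever stopped the power loop, \<open>j \<le> S\<close> gives
        \<open>\<epsilon> ^ S \<le> \<epsilon> ^ j\<close>, so the failed test bounds the ratio by
        \<open>R\<close>.\<close>
      have "wmax = R * (\<epsilon> ^ S * wmax)" using R_eq by (simp add: mult.assoc[symmetric])
      also have "\<dots> \<le> R * (\<epsilon> ^ j * wmax)"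
        using j(1) eps w R_ge by (intro mult_left_mono mult_right_mono power_decreasing) auto
      also have "\<dots> \<le> R * wmin" using ge R_ge by (intro mult_left_mono) auto
      finally have "wmax \<le> R * wmin" .
      then have ratio: "edge_weight_ratio E w \<le> R"
        using weight_bounds w R_ge by (intro edge_weight_ratio_le[OF finite_E w(1)]) force+
      obtain tA where tA: "reach 1 (snd A) (input_store N es w \<epsilon>) tA"
        and approx: "approx_max_weight_matching (1 + \<epsilon>) E w (output_edges es tA)"
        using subrun[OF order_refl lists ratio] by blast
      have "output_edges es (\<lambda>a. if a \<in> set X then tA a else t a) = output_edges es tA"
        by (simp add: output_edges_def)
      moreover have "Q tA"
      proof -
        have "is_matching E (output_edges es tA)"
          using approx by (simp add: approx_max_weight_matching_def)
        then have "0 \<le> sum w (output_edges es tA)"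
          by (intro sum_w_nonneg) (simp add: is_matching_def)
        then have "(1 + \<epsilon>) * sum w (output_edges es tA) \<le> (1 + 16 * \<epsilon>) * sum w (output_edges es tA)"
          using eps by (intro mult_right_mono) auto
        then show ?thesis using approx unfolding Q_def approx_max_weight_matching_def by fastforce
      qed
      ultimately have "Q (\<lambda>a. if a \<in> set X then tA a else t a)" by (simp add: Q_def)
      moreover have "1 \<le> K" by (simp add: K_def)
      ultimately show "runs K (snd A) t Q"
        using call_frame[OF tA X] by (intro runsI[OF reach_mono]) auto
    qed simp
  qed
  have middle: "runs (Suc (6 + (levels * 3 + 2 + Suc K))) (Cond (Num 0 \<^bold>< sc MV) (weight_range ;;
      bounded_power ;; Cond (sc WminV \<^bold>< sc PowV \<^bold>* sc WmaxV) all_shifts (snd A)) Skip) t Q"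
    if t: "holds_input t \<and> (\<forall>a. a \<notin> v ` {NV, MV, EpsV, SrcV, DstV, WtV} \<longrightarrow>
      t a = input_store N es w \<epsilon> a)" for t
  proof (rule runs_Cond)
    have input: "holds_input t" using t by blast
    have fresh: "t (v x) = (\<lambda>_. 0)" if "x \<notin> {NV, MV, EpsV, SrcV, DstV, WtV}" for x
    proof -
      have "v x \<notin> v ` {NV, MV, EpsV, SrcV, DstV, WtV}" using that by auto
      then have "t (v x) = input_store N es w \<epsilon> (v x)" using t by blast
      then show ?thesis by (simp add: input_store_def)
    qed
    have X: "t a = input_store N es w \<epsilon> a" if "a \<in> set X" for a
    proof -
      have "a \<notin> v ` {NV, MV, EpsV, SrcV, DstV, WtV}" using that by auto
      then show ?thesis using t by blast
    qed
    show "runs (6 + (levels * 3 + 2 + Suc K)) (weight_range ;; bounded_power ;;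
        Cond (sc WminV \<^bold>< sc PowV \<^bold>* sc WmaxV) all_shifts (snd A)) t Q"
    proof (rule runs_Seq[OF weight_range_correct[OF input True]], rule runs_Seq[OF bounded_power_correct])
      fix t1 assume "t1 (v WmaxV) 0 = wmax \<and> t1 (v WminV) 0 = wmin \<and>
        (\<forall>a. a \<notin> v ` {TmpV, WmaxV, WminV} \<longrightarrow> t1 a = t a)"
      then have range: "t1 (v WmaxV) 0 = wmax" "t1 (v WminV) 0 = wmin"
        and frame: "\<And>a. a \<notin> v ` {TmpV, WmaxV, WminV} \<Longrightarrow> t1 a = t a" by blast+
      have input1: "holds_input t1" by (rule holds_input_cong[OF input]) (auto intro!: frame)
      show "holds_input t1" "0 < m" "t1 (v WmaxV) 0 = wmax" "t1 (v WminV) 0 = wmin" "t1 (v CntV) 0 = 0"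
        using input1 True range by (auto simp: frame fresh)
      fix t2 assume "\<exists>j\<le>S. t2 (v PowV) 0 = \<epsilon> ^ j \<and> t2 (v CntV) 0 = real j \<and>
        (wmin < \<epsilon> ^ j * wmax \<longrightarrow> j = S) \<and> (\<forall>a. a \<noteq> v PowV \<and> a \<noteq> v CntV \<longrightarrow> t2 a = t1 a)"
      then have pow: "\<exists>j\<le>S. t2 (v PowV) 0 = \<epsilon> ^ j \<and> t2 (v CntV) 0 = real j \<and>
          (wmin < \<epsilon> ^ j * wmax \<longrightarrow> j = S)"
        and frame2: "\<And>a. a \<noteq> v PowV \<Longrightarrow> a \<noteq> v CntV \<Longrightarrow> t2 a = t1 a" by blast+
      show "runs (Suc K) (Cond (sc WminV \<^bold>< sc PowV \<^bold>* sc WmaxV) all_shifts (snd A)) t2 Q"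
      proof (rule inner[of t2, OF _ _ _ pow])
        show "holds_input t2" by (rule holds_input_cong[OF input1]) (auto intro!: frame2)
        show "t2 a = input_store N es w \<epsilon> a" if "a \<in> set X" for a
        proof -
          have "a \<noteq> v x" for x using that by auto
          then show ?thesis using frame2 frame X[OF that] by auto
        qed
      qed (use range in \<open>auto simp: frame2 frame fresh\<close>)
    qed
  next
    assume "expr_val t (Num 0 \<^bold>< sc MV) = 0"
    moreover have "t (v MV) 0 = real m" using t by (simp add: holds_input_def)
    ultimately show "runs (6 + (levels * 3 + 2 + Suc K)) Skip t Q" using True by simp
  qed simp
  have "runs (6 + Suc (6 + (levels * 3 + 2 + Suc K))) main (input_store N es w \<epsilon>) Q"
    unfolding main_def by (rule runs_Seq[OF copy_input_correct middle])
  \<comment> \<open>The counter is \<open>16 + 3 * levels + K\<close>, at most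
    \<open>21 + 65 * max 1 r\<close>; as \<open>log_inv\<close> is at least 1, it absorbs the
    additive constant.\<close>
  moreover have "real (6 + Suc (6 + (levels * 3 + 2 + Suc K))) \<le> 100 * log_inv \<epsilon> (edge_weight_ratio E w)"
  proof -
    have "E \<noteq> {}" using True by (auto simp: E_eq)
    then have "log_inv \<epsilon> (edge_weight_ratio E w) = max 1 r"
      by (simp add: log_inv_def edge_weight_ratio_def r_def wmax_def wmin_def)
    moreover have "real levels \<le> max 1 r + 1" unfolding levels_def r_def[symmetric] by linarith
    ultimately show ?thesis using K by simp
  qed
  ultimately show ?thesis unfolding Q_def by blast
qed

end

text \<open>Strings longer than all names in \<open>Y\<close>, told apart by their lengths.\<close>

lemma fresh_names_exist:
  assumes "finite Y"
  shows "\<exists>v :: var \<Rightarrow> string. inj v \<and> range v \<inter> Y = {}"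
proof -
  define L where "L = Suc (Max (insert 0 (length ` Y)))"
  define v :: "var \<Rightarrow> string" where "v x = replicate (L + to_nat x) CHR ''x''" for x
  have "inj v"
  proof (rule injI)
    fix x y assume "v x = v y"
    then have "length (v x) = length (v y)" by simp
    then show "x = y" by (simp add: v_def)
  qed
  moreover have "length y < L" if "y \<in> Y" for y
    using that assms by (auto simp: L_def less_Suc_eq_le intro!: Max_ge)
  then have "range v \<inter> Y = {}" by (fastforce simp: v_def)
  ultimately show ?thesis by blast
qed

theorem theorem13:
  shows "\<exists>f :: real \<Rightarrow> real. \<forall>(A :: program) B D.
    computes_approx_mwm A (\<lambda>\<epsilon>. 1 + \<epsilon>) B D \<longrightarrow>
    (\<exists>(A' :: program) C. 0 < C \<and>
       computes_approx_mwm A' (\<lambda>\<epsilon>. 1 + 16 * \<epsilon>)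
         (\<lambda>n m W \<epsilon>. C * (B n m (f \<epsilon>) \<epsilon> * log_inv \<epsilon> W / \<epsilon>))
         (\<lambda>n m W \<epsilon>. C * (D n m (f \<epsilon>) \<epsilon> * log_inv \<epsilon> W)))"
proof -
  define f :: "real \<Rightarrow> real" where "f \<epsilon> = (1 / \<epsilon>) ^ nat \<lceil>1 / \<epsilon>\<rceil>" for \<epsilon>
  show ?thesis
  proof (rule exI[of _ f], intro allI impI)
    fix A :: program and B D :: "nat \<Rightarrow> nat \<Rightarrow> real \<Rightarrow> real \<Rightarrow> real"
    assume comp: "computes_approx_mwm A (\<lambda>\<epsilon>. 1 + \<epsilon>) B D"
    define Y where "Y = com_names (snd A) \<union> \<Union> (com_names ` set (fst A)) \<union>
      set [''n'', ''m'', ''eps'', ''src'', ''dst'', ''wt'', ''out'']"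
    have "finite Y" by (auto simp: Y_def finite_com_names)
    then obtain X where X: "set X = Y" using finite_list by blast
    obtain v :: "var \<Rightarrow> string" where v: "inj v" "range v \<inter> Y = {}"
      using fresh_names_exist[OF \<open>finite Y\<close>] by blast
    interpret reduction A X v
    proof
      show "com_names (snd A) \<subseteq> set X" "\<Union> (com_names ` set (fst A)) \<subseteq> set X"
        "set [''n'', ''m'', ''eps'', ''src'', ''dst'', ''wt'', ''out''] \<subseteq> set X"
        unfolding X Y_def by blast+
      show "v x = v y \<longleftrightarrow> x = y" for x y using v(1) by (rule inj_eq)
      show "v x \<notin> set X" for x unfolding X using v(2) by blast
    qed
    \<comment> \<open>100 comes from the number of units in \<open>main_correct\<close>. A unit is
      at most \<open>2000 + length X\<close> times \<open>b\<close> or \<open>d\<close>, because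
      \<open>60 * (18 + 1) + 1 \<le> 2000\<close>. \<open>C\<close> depends on the program
      \<open>A\<close> alone.\<close>
    define C where "C = 100 * (2000 + real (length X))"
    have "computes_approx_mwm (fst A, main) (\<lambda>\<epsilon>. 1 + 16 * \<epsilon>)
           (\<lambda>n m W \<epsilon>. C * (B n m (f \<epsilon>) \<epsilon> * log_inv \<epsilon> W / \<epsilon>))
           (\<lambda>n m W \<epsilon>. C * (D n m (f \<epsilon>) \<epsilon> * log_inv \<epsilon> W))"
      unfolding computes_approx_mwm_def
    proof (intro allI impI, elim conjE)
      fix \<epsilon> W :: real and n m N :: nat and E w es
      assume eps: "0 < \<epsilon>" "\<epsilon> < 1 / 2" and graph: "weighted_graph N E w" and lists: "lists_edges es E"
        and le: "N \<le> n" "card E \<le> m" and ratio: "edge_weight_ratio E w \<le> W"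
      have "3 \<le> f \<epsilon>"
      proof -
        have "2 \<le> 1 / \<epsilon>" using eps by (simp add: field_simps)
        then have "2 \<le> nat \<lceil>1 / \<epsilon>\<rceil>" by linarith
        then have "(2::real) ^ 2 \<le> (1 / \<epsilon>) ^ nat \<lceil>1 / \<epsilon>\<rceil>"
          using \<open>2 \<le> 1 / \<epsilon>\<close> by (meson dual_order.trans one_le_numeral power_increasing power_mono zero_le_numeral)
        then show ?thesis by (simp add: f_def)
      qed
      define b where "b = B n m (f \<epsilon>) \<epsilon>"
      define d where "d = D n m (f \<epsilon>) \<epsilon>"
      have lower: "1 \<le> b" "1 \<le> d" "real (card E) \<le> 18 * b" "real (ceillog2 (card E)) \<le> 6 * d"
        unfolding b_def d_def using cost_lower_bounds[OF comp eps \<open>3 \<le> f \<epsilon>\<close> graph le] by auto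
      have len: "length es = card E"
        using lists distinct_card[of "map edge_of es"] by (simp add: lists_edges_def)
      \<comment> \<open>One unit pays for a pass, for allocating the arrays \<open>X\<close>, or for
        a run of \<open>A\<close>; costs are naturals, hence the floor of the real bounds.\<close>
      define U where "U = 60 * (length es + 1) + length X + nat \<lfloor>b\<rfloor>"
      define V where "V = 60 + ceillog2 (length es) + length X + nat \<lfloor>d\<rfloor>"
      interpret cost_units "fst A" "length es" U V by unfold_locales (auto simp: U_def V_def)
      interpret reduction_run A X v "length es" U V N E w es \<epsilon> "f \<epsilon>"
      proof unfold_locales
        fix E' es' assume E': "E' \<subseteq> E" "lists_edges es' E'" "edge_weight_ratio E' w \<le> f \<epsilon>"
        have "weighted_graph N E' w" using graph E'(1) unfolding weighted_graph_def by blast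
        moreover have "card E' \<le> m"
          using card_mono[OF weighted_graph_finite[OF graph] E'(1)] le by linarith
        ultimately obtain t work depth where t: "exec (fst A) (snd A) (input_store N es' w \<epsilon>) t work depth"
          "approx_max_weight_matching (1 + \<epsilon>) E' w (output_edges es' t)"
          "real work \<le> b" "real depth \<le> d"
          unfolding b_def d_def using computes_approx_mwmD[OF comp eps _ E'(2) le(1) _ E'(3)] by metis
        have "work \<le> nat \<lfloor>b\<rfloor>" "depth \<le> nat \<lfloor>d\<rfloor>" using t(3,4) by (auto simp: le_nat_floor)
        then have "reach 1 (snd A) (input_store N es' w \<epsilon>) t"
          by (intro reachI[OF t(1)]) (auto simp: U_def V_def)
        then show "\<exists>t. reach 1 (snd A) (input_store N es' w \<epsilon>) t \<and>
            approx_max_weight_matching (1 + \<epsilon>) E' w (output_edges es' t)" using t(2) by blast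
      qed (use eps graph lists in \<open>auto simp: f_def U_def V_def\<close>)
      obtain k where k: "runs k main (input_store N es w \<epsilon>)
          (\<lambda>t. approx_max_weight_matching (1 + 16 * \<epsilon>) E w (output_edges es t))"
        "real k \<le> 100 * log_inv \<epsilon> (edge_weight_ratio E w)"
        using main_correct by blast
      obtain t work depth where t: "exec (fst A) main (input_store N es w \<epsilon>) t work depth"
        "work \<le> k * U" "depth \<le> k * V" "approx_max_weight_matching (1 + 16 * \<epsilon>) E w (output_edges es t)"
        using k(1) unfolding runs_def reach_def by blast
      \<comment> \<open>\<open>W\<close> only bounds the ratio from above; positivity makes the
        logarithm monotone.\<close>
      have "0 < edge_weight_ratio E w"
      proof (cases "E = {}")
        case False
        have "Min (w ` E) \<in> w ` E" "Max (w ` E) \<in> w ` E"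
          using False weighted_graph_finite[OF graph] by auto
        then show ?thesis using False w_pos by (auto simp: edge_weight_ratio_def)
      qed (simp add: edge_weight_ratio_def)
      then have "log_inv \<epsilon> (edge_weight_ratio E w) \<le> log_inv \<epsilon> W"
        unfolding log_inv_def using ratio eps by (intro max.mono) auto
      then have k_le: "real k \<le> 100 * log_inv \<epsilon> W" using k(2) by linarith
      have log_pos: "1 \<le> log_inv \<epsilon> W" by (simp add: log_inv_def)
      have X_mult: "real (length X) \<le> real (length X) * b" "real (length X) \<le> real (length X) * d"
        using mult_left_mono[OF lower(1), of "real (length X)"]
          mult_left_mono[OF lower(2), of "real (length X)"] by simp_all
      have nat_floor: "real (nat \<lfloor>x\<rfloor>) \<le> x" if "1 \<le> x" for x :: real using that by linarith
      have unit_le: "60 * (y + 1) + l + c \<le> 2000 * x + z"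
        if "1 \<le> x" "y \<le> 18 * x" "l \<le> z" "c \<le> x" for y l c x z :: real
        using that by simp
      have "real U \<le> (2000 + real (length X)) * b"
      proof -
        have "real U = 60 * (real (card E) + 1) + real (length X) + real (nat \<lfloor>b\<rfloor>)"
          by (simp add: U_def len)
        also have "\<dots> \<le> 2000 * b + real (length X) * b"
          by (rule unit_le[OF lower(1,3) X_mult(1) nat_floor[OF lower(1)]])
        finally show ?thesis by (simp only: distrib_right)
      qed
      then have "real k * real U \<le> (100 * log_inv \<epsilon> W) * ((2000 + real (length X)) * b)"
        using k_le lower by (intro mult_mono) auto
      also have "\<dots> = C * (b * log_inv \<epsilon> W)" by (simp add: C_def)
      also have "\<dots> \<le> C * (b * log_inv \<epsilon> W / \<epsilon>)"
      proof (rule mult_left_mono)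
        have "0 \<le> b * log_inv \<epsilon> W" using lower log_pos by simp
        then show "b * log_inv \<epsilon> W \<le> b * log_inv \<epsilon> W / \<epsilon>"
          using eps mult_left_le[of \<epsilon> "b * log_inv \<epsilon> W"] by (simp add: le_divide_eq)
      qed (simp add: C_def)
      finally have "real work \<le> C * (b * log_inv \<epsilon> W / \<epsilon>)"
        using t(2) by (metis of_nat_le_iff of_nat_mult order_trans)
      moreover have "real V \<le> (2000 + real (length X)) * d"
      proof -
        have "real V \<le> 60 * (real (ceillog2 (card E)) + 1) + real (length X) + real (nat \<lfloor>d\<rfloor>)"
          by (simp add: V_def len)
        also have "\<dots> \<le> 2000 * d + real (length X) * d"
          using lower(2,4) by (intro unit_le X_mult nat_floor) auto
        finally show ?thesis by (simp only: distrib_right)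
      qed
      then have "real k * real V \<le> (100 * log_inv \<epsilon> W) * ((2000 + real (length X)) * d)"
        using k_le lower by (intro mult_mono) auto
      then have "real k * real V \<le> C * (d * log_inv \<epsilon> W)" by (simp add: C_def mult_ac)
      then have "real depth \<le> C * (d * log_inv \<epsilon> W)"
        using t(3) by (metis of_nat_le_iff of_nat_mult order_trans)
      ultimately show "\<exists>t work depth.
          exec (fst (fst A, main)) (snd (fst A, main)) (input_store N es w \<epsilon>) t work depth \<and>
          approx_max_weight_matching (1 + 16 * \<epsilon>) E w (output_edges es t) \<and>
          real work \<le> C * (B n m (f \<epsilon>) \<epsilon> * log_inv \<epsilon> W / \<epsilon>) \<and>
          real depth \<le> C * (D n m (f \<epsilon>) \<epsilon> * log_inv \<epsilon> W)"
        using t(1,4) unfolding b_def d_def by auto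
    qed
    moreover have "0 < C" by (simp add: C_def)
    ultimately show "\<exists>(A' :: program) C. 0 < C \<and> computes_approx_mwm A' (\<lambda>\<epsilon>. 1 + 16 * \<epsilon>)
           (\<lambda>n m W \<epsilon>. C * (B n m (f \<epsilon>) \<epsilon> * log_inv \<epsilon> W / \<epsilon>))
           (\<lambda>n m W \<epsilon>. C * (D n m (f \<epsilon>) \<epsilon> * log_inv \<epsilon> W))" by blast
  qed
qed

end
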